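(* Let $U\subset J^1=\mathbb R^3$ (coordinates $(x,y,p)$, $p=y'$) be open and let $f:U\to\mathbb R$ be real analytic with $$f_y+\tfrac29 f_p^2-\tfrac13\mathfrak D(f_p)\equiv 0\quad\text{on }U,\qquad \mathfrak D=\partial_x+p\,\partial_y+f\,\partial_p .$$ Let $H$ be the $2$-dimensional closed subgroup of $ASL(2,\mathbb R)$ defined in the context, with Lie algebra $\mathfrak h$, and let $B=B(f)$ be the $5$-dimensional principal right $H$-bundle $U\times H\to U$ with fibre coordinates $(u_1,u_3)$. Then: (1) There is a Cartan connection $\omega$ on $B$ with values in $\mathfrak{asl}(2,\mathbb R)$, i.e. a Cartan geometry on $U$ modeled on $(\mathfrak{asl}(2,\mathbb R),\mathfrak h)$ with group $H$, which is normal (in the sense defined in the context), and the normal Cartan connection is unique. (2) Writing $$\omega=\begin{pmatrix}0&0&0\\ \theta^3&\Omega^1&-\Omega^2\\ \theta^1&\theta^2&-\Omega^1\end{pmatrix},$$ the curvature of $\omega$ is $$d\omega+\omega\wedge\omega=\begin{pmatrix}0&0&0\\0& I_1\,\theta^3\wedge\theta^1& -I_2\,\theta^2\wedge\theta^1-I_3\,\theta^3\wedge\theta^1\\0&0&-I_1\,\theta^3\wedge\theta^1\end{pmatrix},$$ where $$I_1=-\tfrac13 f_{py}-\tfrac1{18}f_pf_{pp}+\tfrac16\mathfrak D(f_{pp}),\qquad I_2=-\frac{1}{6u_1^5}f_{pppp},$$ $$I_3=\frac1{u_1^2}\Big(\tfrac16 f_{ppy}-\tfrac16\mathfrak D(f_{ppp})-\tfrac19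 f_pf_{ppp}+\tfrac1{18}f_{pp}^2\Big)+2\frac{u_3}{u_1}I_1 .$$ (3) Let $\bar U\subset J^1$ be open and $\bar f:\bar U\to\mathbb R$ be real analytic with $\bar f_{\bar y}+\tfrac29\bar f_{\bar p}^2-\tfrac13\bar{\mathfrak D}(\bar f_{\bar p})\equiv0$ on $\bar U$, where $\bar{\mathfrak D}=\partial_{\bar x}+\bar p\,\partial_{\bar y}+\bar f\,\partial_{\bar p}$, and let $(\bar B,\bar\omega)$ be the corresponding bundle and normal Cartan connection. For $q\in U$, $\bar q\in\bar U$, the equations $y''=f(x,y,y')$ and $\bar y''=\bar f(\bar x,\bar y,\bar y')$ are area-preserving equivalent at $(q,\bar q)$ if and only if there are open neighbourhoods $V\ni q$, $\bar V\ni\bar q$ and a bundle map $F:B|_V\to\bar B|_{\bar V}$ (a real analytic diffeomorphism commuting with the right actions of $H$, covering a diffeomorphism $V\to\bar V$ that sends $q$ to $\bar q$) such that $F^*\bar\omega=\omega$.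
   Context: All functions, maps and forms are real analytic. $J^1=J^1(\mathbb R,\mathbb R)=\mathbb R^3$ has coordinates $(x,y,p)$, where $p$ stands for $y'$; subscripts on $f$ denote partial derivatives. Groups. $ASL(2,\mathbb R)=\left\{\begin{pmatrix}1&0\\ v&A\end{pmatrix}: v\in\mathbb R^2, A\in SL(2,\mathbb R)\right\}\subset GL(3,\mathbb R)$, with Lie algebra $\mathfrak{asl}(2,\mathbb R)$ (matrices $\begin{pmatrix}0&0\\ v&a\end{pmatrix}$, $v\in\mathbb R^2$, $\operatorname{tr}a=0$). $H$ is the group of matrices $\begin{pmatrix}1&0&0\\0&u_1&-u_3\\0&0&1/u_1\end{pmatrix}$, $u_1\in\mathbb R\setminus\{0\}$, $u_3\in\mathbb R$. $H$ acts on $U\times H$ by $(q,S)\cdot T=(q,ST)$. Cartan connection. A Cartan connection on a principal right $H$-bundle $P\to M$ modeled on $(\mathfrak g,\mathfrak h)$ ($H$ a closed subgroup of $G$) is a $\mathfrak g$-valued $1$-form $\omega$ on $P$ such that (i) $\omega_q:T_qP\to\mathfrak g$ is a linear isomorphism for each $q\in P$; (ii) $R_h^*\omega=\mathrm{Ad}_{h^{-1}}\omega$ for all $h\in H$; (iii) $\omega(\varrho(v))=v$ for all $v\in\mathfrak h$, where $\varrho(v)$ is the fundamental vector field of the right action. Its curvature is $d\omega+\omega\wedge\omega$ (matrix product with wedge of entries). Normality. Let $s:U\to U\times H$, $s(q)=(q,e)$ (i.e. $u_1=1,u_3=0$). For a Cartan connection $\omega$ on $U\times H$ with values in $\mathfrak{asl}(2,\mathbb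 R)$ write $$s^*\omega=\eta=\begin{pmatrix}0&0&0\\ \eta^1&\eta^1_1&\eta^1_2\\ \eta^2&\eta^2_1&\eta^2_2\end{pmatrix},\ \eta^1_1+\eta^2_2=0,\qquad d\eta+\eta\wedge\eta=\begin{pmatrix}0&0&0\\ \Theta^1&\Theta^1_1&\Theta^1_2\\ \Theta^2&\Theta^2_1&\Theta^2_2\end{pmatrix}.$$ $\omega$ is called normal (for $f$) if $\eta^1=dx$, $\eta^2=dy-p\,dx$, $\eta^2_1=\Pi:=dp-f\,dx+\mu(dy-p\,dx)$ for some function $\mu$ on $U$, and, writing $\Theta^i_1=R^i_{113}\,\eta^1\wedge\Pi+R^i_{123}\,\eta^2\wedge\Pi+R^i_{112}\,\eta^1\wedge\eta^2$ for $i=1,2$, one has $$\Theta^1=\Theta^2=0,\qquad R^1_{113}=R^1_{123}=R^2_{113}=R^2_{123}=0 .$$ Equivalence. The first prolongation of a local diffeomorphism $\Phi(x,y)=(\chi(x,y),\phi(x,y))$ of $\mathbb R^2$ is $p^1\Phi(x,y,p)=\left(\chi,\phi,\frac{\phi_x+p\phi_y}{\chi_x+p\chi_y}\right)$, defined where $\chi_x+p\chi_y\neq0$. The equations $y''=f$ (on $U$) and $\bar y''=\bar f$ (on $\bar U$) are area-preserving equivalent at $(q,\bar q)$ if there are open neighbourhoods $V\subset U$ of $q$, $\bar V\subset\bar U$ of $\bar q$ and a diffeomorphism $\Psi:V\to\bar V$ with $\Psi(q)=\bar q$ which is the first prolongation of some local diffeomorphism $\Phi=(\chi,\phi)$ with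 $\chi_x\phi_y-\chi_y\phi_x\equiv1$ and which maps $1$-jets $x\mapsto(x,c(x),c'(x))$ of solutions of $y''=f$ to (reparametrized) $1$-jets of solutions of $\bar y''=\bar f$. *)

theory Defs
  imports "HOL-Analysis.Analysis"
begin

text \<open>
  Multi-indices are functions on the type which vanish off the standard basis. In finite
  dimensions \<open>has_sum\<close> is absolute (unconditional) convergence, as usual for
  multivariate power series.
\<close>

definition real_analytic_at :: "('a::euclidean_space \<Rightarrow> 'b::euclidean_space) \<Rightarrow> 'a \<Rightarrow> bool" where
  "real_analytic_at f a \<longleftrightarrow>
     (\<exists>c r. 0 < r \<and>
        (\<forall>x\<in>ball a r.
           ((\<lambda>\<alpha>. (\<Prod>b\<in>Basis. ((x - a) \<bullet> b) ^ \<alpha> b) *\<^sub>R c \<alpha>) has_sum f x)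
             {\<alpha> :: 'a \<Rightarrow> nat. \<forall>b. b \<notin> Basis \<longrightarrow> \<alpha> b = 0}))"

definition real_analytic_on :: "('a::euclidean_space \<Rightarrow> 'b::euclidean_space) \<Rightarrow> 'a set \<Rightarrow> bool" where
  "real_analytic_on f S \<longleftrightarrow> (\<forall>a\<in>S. real_analytic_at f a)"

definition analytic_diffeo ::
    "('a::euclidean_space \<Rightarrow> 'b::euclidean_space) \<Rightarrow> 'a set \<Rightarrow> 'b set \<Rightarrow> bool" where
  "analytic_diffeo F S T \<longleftrightarrow>
     open S \<and> open T \<and> real_analytic_on F S \<and> F ` S = T \<and>
     (\<exists>G. real_analytic_on G T \<and> G ` T = S \<and> (\<forall>x\<in>S. G (F x) = x) \<and> (\<forall>y\<in>T. F (G y) = y))"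

definition partial :: "'n::finite \<Rightarrow> (real^'n \<Rightarrow> real) \<Rightarrow> real^'n \<Rightarrow> real" where
  "partial i g q = deriv (\<lambda>t. g (q + t *\<^sub>R axis i 1)) 0"

text \<open>
  A \<open>k\<close>-form is a function of the base point and of \<open>k\<close> tangent vectors; the tangent space at
  every point is the ambient vector space. Forms and maps are total functions, but only their
  values on the open set under consideration are relevant. Conventions:
  \<open>(\<alpha> \<and> \<beta>)(v,w) = \<alpha>(v) \<beta>(w) - \<alpha>(w) \<beta>(v)\<close> and
  \<open>d\<omega>(X,Y) = X \<omega>(Y) - Y \<omega>(X) - \<omega>([X,Y])\<close>, which below is evaluated on constant vector fields.
\<close>

type_synonym ('a, 'b) form1 = "'a \<Rightarrow> 'a \<Rightarrow> 'b"
type_synonym ('a, 'b) form2 = "'a \<Rightarrow> 'a \<Rightarrow> 'a \<Rightarrow> 'b"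
type_synonym mat3 = "real^3^3"

definition analytic_form1 ::
    "('a::euclidean_space, 'b::euclidean_space) form1 \<Rightarrow> 'a set \<Rightarrow> bool" where
  "analytic_form1 \<omega> S \<longleftrightarrow>
     (\<forall>x\<in>S. linear (\<omega> x)) \<and> (\<forall>v. real_analytic_on (\<lambda>x. \<omega> x v) S)"

definition pullback ::
    "('a::euclidean_space \<Rightarrow> 'b::euclidean_space) \<Rightarrow> ('b, 'c) form1 \<Rightarrow> ('a, 'c) form1" where
  "pullback \<phi> \<omega> x v = \<omega> (\<phi> x) (frechet_derivative \<phi> (at x) v)"

definition ext_deriv ::
    "('a::euclidean_space, 'b::euclidean_space) form1 \<Rightarrow> ('a, 'b) form2" where
  "ext_deriv \<omega> x v w =
     frechet_derivative (\<lambda>z. \<omega> z w) (at x) v - frechet_derivative (\<lambda>z. \<omega> z v) (at x) w"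

definition wedge :: "('a, real) form1 \<Rightarrow> ('a, real) form1 \<Rightarrow> ('a, real) form2" where
  "wedge \<alpha> \<beta> x v w = \<alpha> x v * \<beta> x w - \<alpha> x w * \<beta> x v"

definition mat_wedge :: "('a, mat3) form1 \<Rightarrow> ('a, mat3) form1 \<Rightarrow> ('a, mat3) form2" where
  "mat_wedge \<alpha> \<beta> x v w = \<alpha> x v ** \<beta> x w - \<alpha> x w ** \<beta> x v"

definition curvature :: "('a::euclidean_space, mat3) form1 \<Rightarrow> ('a, mat3) form2" where
  "curvature \<omega> x v w = ext_deriv \<omega> x v w + mat_wedge \<omega> \<omega> x v w"

definition entry :: "('a, mat3) form1 \<Rightarrow> 3 \<Rightarrow> 3 \<Rightarrow> ('a, real) form1" where
  "entry \<omega> i j x v = \<omega> x v $ i $ j"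

definition mexp :: "mat3 \<Rightarrow> mat3" where
  "mexp A = (\<Sum>n. (1 / fact n) *\<^sub>R (((**) A) ^^ n) (mat 1))"

definition lie_algebra :: "mat3 set \<Rightarrow> mat3 set" where
  "lie_algebra H = {X. \<forall>t::real. mexp (t *\<^sub>R X) \<in> H}"

definition fundamental_field ::
    "('a::euclidean_space \<Rightarrow> mat3 \<Rightarrow> 'a) \<Rightarrow> mat3 \<Rightarrow> 'a \<Rightarrow> 'a" where
  "fundamental_field act X b = vector_derivative (\<lambda>t. act b (mexp (t *\<^sub>R X))) (at 0)"

text \<open>
  Here \<open>P\<close> is the total space (an open subset of a Euclidean space) of a principal bundle with
  right action \<open>act\<close> of \<open>H\<close>, and \<open>g\<close> is the Lie algebra in which the connection takes values.
\<close>

definition cartan_connection ::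
    "'a::euclidean_space set \<Rightarrow> ('a \<Rightarrow> mat3 \<Rightarrow> 'a) \<Rightarrow> mat3 set \<Rightarrow> mat3 set \<Rightarrow> ('a, mat3) form1 \<Rightarrow> bool"
  where
  "cartan_connection P act H g \<omega> \<longleftrightarrow>
     analytic_form1 \<omega> P \<and>
     (\<forall>b\<in>P. bij_betw (\<omega> b) UNIV g) \<and>
     (\<forall>h\<in>H. \<forall>b\<in>P. \<forall>v. pullback (\<lambda>z. act z h) \<omega> b v = matrix_inv h ** \<omega> b v ** h) \<and>
     (\<forall>X\<in>lie_algebra H. \<forall>b\<in>P. \<omega> b (fundamental_field act X b) = X)"

definition ASL2 :: "mat3 set" where
  "ASL2 = {M. M $ 1 = vector [1, 0, 0] \<and> M $ 2 $ 2 * M $ 3 $ 3 - M $ 2 $ 3 * M $ 3 $ 2 = 1}"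

definition asl2 :: "mat3 set" where
  "asl2 = {X. X $ 1 = 0 \<and> X $ 2 $ 2 + X $ 3 $ 3 = 0}"

definition Hmat :: "real \<times> real \<Rightarrow> mat3" where
  "Hmat = (\<lambda>(u1, u3). vector [vector [1, 0, 0], vector [0, u1, - u3], vector [0, 0, 1 / u1]])"

definition Hgrp :: "mat3 set" where
  "Hgrp = {Hmat (u1, u3) | u1 u3. u1 \<noteq> 0}"

definition Hcoord :: "mat3 \<Rightarrow> real \<times> real" where
  "Hcoord S = (S $ 2 $ 2, - S $ 2 $ 3)"

text \<open>
  A point of the jet space is \<open>q = (x, y, p)\<close> with \<open>x = q $ 1\<close>, \<open>y = q $ 2\<close>, \<open>p = q $ 3\<close>.
  The element \<open>(q, S)\<close> of \<open>U \<times> H\<close> is represented by \<open>(q, u1, u3)\<close> where \<open>S = Hmat (u1, u3)\<close>, so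
  that the total space becomes an open subset of a five-dimensional Euclidean space.
\<close>

type_synonym jet = "real^3"
type_synonym bpoint = "jet \<times> real \<times> real"

definition H_bundle :: "jet set \<Rightarrow> bpoint set" where
  "H_bundle U = U \<times> ({u. u \<noteq> 0} \<times> UNIV)"

definition ract :: "bpoint \<Rightarrow> mat3 \<Rightarrow> bpoint" where
  "ract b T = (fst b, Hcoord (Hmat (snd b) ** T))"

definition id_section :: "jet \<Rightarrow> bpoint" where
  "id_section q = (q, 1, 0)"

lemma Hmat_entries:
  "Hmat (u1, u3) $ 1 $ 1 = 1" "Hmat (u1, u3) $ 1 $ 2 = 0" "Hmat (u1, u3) $ 1 $ 3 = 0"
  "Hmat (u1, u3) $ 2 $ 1 = 0" "Hmat (u1, u3) $ 2 $ 2 = u1" "Hmat (u1, u3) $ 2 $ 3 = - u3"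
  "Hmat (u1, u3) $ 3 $ 1 = 0" "Hmat (u1, u3) $ 3 $ 2 = 0" "Hmat (u1, u3) $ 3 $ 3 = 1 / u1"
  by (simp_all add: Hmat_def)

lemma Hcoord_Hmat: "Hcoord (Hmat u) = u"
  by (cases u) (simp add: Hcoord_def Hmat_entries)

lemma Hmat_mult:
  assumes "u1 \<noteq> 0" "t1 \<noteq> 0"
  shows "Hmat (u1, u3) ** Hmat (t1, t3) = Hmat (u1 * t1, u1 * t3 + u3 / t1)"
  by (simp add: vec_eq_iff matrix_matrix_mult_def forall_3 sum_3 Hmat_entries)

lemma ract_Hmat:
  assumes "u1 \<noteq> 0" "t1 \<noteq> 0"
  shows "ract (q, u1, u3) (Hmat (t1, t3)) = (q, u1 * t1, u1 * t3 + u3 / t1)"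
  using assms by (simp add: ract_def Hmat_mult Hcoord_Hmat)

lemma Hmat_one: "Hmat (1, 0) = mat 1"
  by (simp add: vec_eq_iff mat_def forall_3 Hmat_entries)

lemma Hmat_inverse:
  assumes "u1 \<noteq> 0"
  shows "Hmat (u1, u3) ** Hmat (1 / u1, - u3) = mat 1"
    and "Hmat (1 / u1, - u3) ** Hmat (u1, u3) = mat 1"
  using assms by (simp_all add: Hmat_mult flip: Hmat_one)

lemma Hgrp_alt: "Hgrp = {M \<in> ASL2. M $ 2 $ 1 = 0 \<and> M $ 3 $ 1 = 0 \<and> M $ 3 $ 2 = 0}"
proof (intro subset_antisym subsetI)
  fix M assume "M \<in> Hgrp"
  then show "M \<in> {M \<in> ASL2. M $ 2 $ 1 = 0 \<and> M $ 3 $ 1 = 0 \<and> M $ 3 $ 2 = 0}"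
    by (auto simp: Hgrp_def ASL2_def Hmat_entries vec_eq_iff forall_3)
next
  fix M assume *: "M \<in> {M \<in> ASL2. M $ 2 $ 1 = 0 \<and> M $ 3 $ 1 = 0 \<and> M $ 3 $ 2 = 0}"
  then have "M $ 2 $ 2 * M $ 3 $ 3 - M $ 2 $ 3 * M $ 3 $ 2 = 1" "M $ 3 $ 2 = 0"
    by (auto simp: ASL2_def)
  then have d: "M $ 2 $ 2 * M $ 3 $ 3 = 1" by simp
  then have nz: "M $ 2 $ 2 \<noteq> 0" by auto
  with d have "M $ 3 $ 3 = 1 / M $ 2 $ 2" by (simp add: field_simps)
  with * have "M = Hmat (M $ 2 $ 2, - M $ 2 $ 3)"
    by (simp add: vec_eq_iff forall_3 Hmat_entries ASL2_def)
  with nz show "M \<in> Hgrp" unfolding Hgrp_def by blast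
qed

lemma Hgrp_closed_subgroup:
  "Hgrp \<subseteq> ASL2" "closed Hgrp" "mat 1 \<in> Hgrp"
  "\<And>S T. S \<in> Hgrp \<Longrightarrow> T \<in> Hgrp \<Longrightarrow> S ** T \<in> Hgrp"
  "\<And>S. S \<in> Hgrp \<Longrightarrow> \<exists>T\<in>Hgrp. S ** T = mat 1 \<and> T ** S = mat 1"
proof -
  show "Hgrp \<subseteq> ASL2" by (auto simp: Hgrp_alt)
  show "closed Hgrp"
    unfolding Hgrp_alt ASL2_def mem_Collect_eq
    by (intro closed_Collect_conj closed_Collect_eq continuous_intros)
  show "mat 1 \<in> Hgrp"
    unfolding Hgrp_def Hmat_one[symmetric] by force
  show "S ** T \<in> Hgrp" if "S \<in> Hgrp" "T \<in> Hgrp" for S T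
    using that unfolding Hgrp_def by (auto simp: Hmat_mult) (metis mult_eq_0_iff)
  show "\<exists>T\<in>Hgrp. S ** T = mat 1 \<and> T ** S = mat 1" if S: "S \<in> Hgrp" for S
  proof -
    obtain u1 u3 where u: "S = Hmat (u1, u3)" "u1 \<noteq> 0" using S by (auto simp: Hgrp_def)
    then have "Hmat (1 / u1, - u3) \<in> Hgrp" unfolding Hgrp_def by force
    with u Hmat_inverse show ?thesis by blast
  qed
qed

definition total_D :: "(jet \<Rightarrow> real) \<Rightarrow> (jet \<Rightarrow> real) \<Rightarrow> jet \<Rightarrow> real" where
  "total_D f g q = partial 1 g q + q $ 3 * partial 2 g q + f q * partial 3 g q"

abbreviation d_x :: "(jet \<Rightarrow> real) \<Rightarrow> jet \<Rightarrow> real" where "d_x \<equiv> partial 1"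
abbreviation d_y :: "(jet \<Rightarrow> real) \<Rightarrow> jet \<Rightarrow> real" where "d_y \<equiv> partial 2"
abbreviation d_p :: "(jet \<Rightarrow> real) \<Rightarrow> jet \<Rightarrow> real" where "d_p \<equiv> partial 3"

definition form_dx :: "(jet, real) form1" where
  "form_dx q v = v $ 1"

definition form_contact :: "(jet, real) form1" where
  "form_contact q v = v $ 2 - q $ 3 * v $ 1"

definition form_Pi :: "(jet \<Rightarrow> real) \<Rightarrow> (jet \<Rightarrow> real) \<Rightarrow> (jet, real) form1" where
  "form_Pi f \<mu> q v = v $ 3 - f q * v $ 1 + \<mu> q * (v $ 2 - q $ 3 * v $ 1)"

text \<open>
  The indices \<open>1, 2\<close> of \<open>\<eta>\<^sup>i, \<eta>\<^sup>i\<^sub>j, \<Theta>\<^sup>i, \<Theta>\<^sup>i\<^sub>j\<close> correspond to the matrix indices \<open>2, 3\<close>, and the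
  entries \<open>\<eta>\<^sup>i, \<Theta>\<^sup>i\<close> stand in the first matrix column. In particular the functions \<open>R\<^sup>i\<^sub>1\<^sub>1\<^sub>3\<close> etc.
  are indexed by the matrix row \<open>i + 1\<close>; they are uniquely determined on \<open>U\<close>, as
  \<open>\<eta>\<^sup>1, \<eta>\<^sup>2, \<Pi>\<close> is a coframe.
\<close>

definition normal_cartan_connection ::
    "(jet \<Rightarrow> real) \<Rightarrow> jet set \<Rightarrow> (bpoint, mat3) form1 \<Rightarrow> bool" where
  "normal_cartan_connection f U \<omega> \<longleftrightarrow>
     cartan_connection (H_bundle U) ract Hgrp asl2 \<omega> \<and>
     (let \<eta> = pullback id_section \<omega>; \<Theta> = curvature \<eta> in
      \<exists>\<mu>. real_analytic_on \<mu> U \<and>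
        (\<forall>q\<in>U. \<forall>v. entry \<eta> 2 1 q v = form_dx q v \<and>
                    entry \<eta> 3 1 q v = form_contact q v \<and>
                    entry \<eta> 3 2 q v = form_Pi f \<mu> q v) \<and>
        (\<forall>q\<in>U. \<forall>v w. \<Theta> q v w $ 2 $ 1 = 0 \<and> \<Theta> q v w $ 3 $ 1 = 0) \<and>
        (\<exists>R113 R123 R112 :: 3 \<Rightarrow> jet \<Rightarrow> real.
           \<forall>q\<in>U. \<forall>i\<in>{2, 3}.
             (\<forall>v w. \<Theta> q v w $ i $ 2 =
                R113 i q * wedge form_dx (form_Pi f \<mu>) q v w +
                R123 i q * wedge form_contact (form_Pi f \<mu>) q v w +
                R112 i q * wedge form_dx form_contact q v w) \<and>
             R113 i q = 0 \<and> R123 i q = 0))"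

definition I1 :: "(jet \<Rightarrow> real) \<Rightarrow> bpoint \<Rightarrow> real" where
  "I1 f = (\<lambda>(q, u1, u3).
     - (1/3) * d_y (d_p f) q - (1/18) * d_p f q * d_p (d_p f) q
     + (1/6) * total_D f (d_p (d_p f)) q)"

definition I2 :: "(jet \<Rightarrow> real) \<Rightarrow> bpoint \<Rightarrow> real" where
  "I2 f = (\<lambda>(q, u1, u3). - (1 / (6 * u1 ^ 5)) * d_p (d_p (d_p (d_p f))) q)"

definition I3 :: "(jet \<Rightarrow> real) \<Rightarrow> bpoint \<Rightarrow> real" where
  "I3 f = (\<lambda>(q, u1, u3).
     (1 / u1\<^sup>2) *
       ((1/6) * d_y (d_p (d_p f)) q - (1/6) * total_D f (d_p (d_p (d_p f))) q
        - (1/9) * d_p f q * d_p (d_p (d_p f)) q + (1/18) * (d_p (d_p f) q)\<^sup>2)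
     + 2 * (u3 / u1) * I1 f (q, u1, u3))"

definition jet1 :: "(real \<Rightarrow> real) \<Rightarrow> real \<Rightarrow> jet" where
  "jet1 c x = vector [x, c x, deriv c x]"

text \<open>
  Solutions are only required to be twice differentiable; for analytic \<open>f\<close> they are then
  automatically analytic.
\<close>

definition ode_solution :: "(jet \<Rightarrow> real) \<Rightarrow> jet set \<Rightarrow> real set \<Rightarrow> (real \<Rightarrow> real) \<Rightarrow> bool" where
  "ode_solution f U I c \<longleftrightarrow>
     open I \<and> is_interval I \<and>
     (\<forall>x\<in>I. jet1 c x \<in> U \<and> c differentiable at x \<and>
             (deriv c has_real_derivative f (jet1 c x)) (at x))"

text \<open>In the following \<open>X\<close> and \<open>Y\<close> are the components of \<open>\<Phi>\<close>, so \<open>\<Phi>(x, y) = (X(x, y), Y(x, y))\<close>.\<close>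

definition plane_proj :: "jet \<Rightarrow> real^2" where
  "plane_proj r = vector [r $ 1, r $ 2]"

definition plane_jacobian :: "(real^2 \<Rightarrow> real^2) \<Rightarrow> real^2 \<Rightarrow> real" where
  "plane_jacobian \<Phi> z =
     (let X = (\<lambda>z. \<Phi> z $ 1); Y = (\<lambda>z. \<Phi> z $ 2) in
      partial 1 X z * partial 2 Y z - partial 2 X z * partial 1 Y z)"

definition prolong_denom :: "(real^2 \<Rightarrow> real^2) \<Rightarrow> jet \<Rightarrow> real" where
  "prolong_denom \<Phi> r =
     (let X = (\<lambda>z. \<Phi> z $ 1); z = plane_proj r in partial 1 X z + r $ 3 * partial 2 X z)"

definition prolong1 :: "(real^2 \<Rightarrow> real^2) \<Rightarrow> jet \<Rightarrow> jet" where
  "prolong1 \<Phi> r =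
     (let Y = (\<lambda>z. \<Phi> z $ 2); z = plane_proj r in
      vector [\<Phi> z $ 1, \<Phi> z $ 2,
              (partial 1 Y z + r $ 3 * partial 2 Y z) / prolong_denom \<Phi> r])"

definition is_area_preserving_prolongation :: "(jet \<Rightarrow> jet) \<Rightarrow> jet set \<Rightarrow> bool" where
  "is_area_preserving_prolongation \<Psi> V \<longleftrightarrow>
     (\<exists>W \<Phi>. plane_proj ` V \<subseteq> W \<and> analytic_diffeo \<Phi> W (\<Phi> ` W) \<and>
        (\<forall>z\<in>W. plane_jacobian \<Phi> z = 1) \<and>
        (\<forall>r\<in>V. prolong_denom \<Phi> r \<noteq> 0 \<and> \<Psi> r = prolong1 \<Phi> r))"

text \<open>
  Solution jets in \<open>V\<close> are mapped to solution jets in \<open>Vb\<close> up to the change of parameter \<open>\<tau>\<close>,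
  a diffeomorphism of open intervals.
\<close>

definition maps_solutions ::
    "(jet \<Rightarrow> real) \<Rightarrow> jet set \<Rightarrow> (jet \<Rightarrow> real) \<Rightarrow> jet set \<Rightarrow> (jet \<Rightarrow> jet) \<Rightarrow> bool" where
  "maps_solutions f V fb Vb \<Psi> \<longleftrightarrow>
     (\<forall>I c. ode_solution f V I c \<longrightarrow>
        (\<exists>J cb \<tau>. ode_solution fb Vb J cb \<and> bij_betw \<tau> I J \<and>
           (\<forall>x\<in>I. \<tau> differentiable at x \<and> deriv \<tau> x \<noteq> 0 \<and> \<Psi> (jet1 c x) = jet1 cb (\<tau> x))))"

definition area_preserving_equivalent ::
    "(jet \<Rightarrow> real) \<Rightarrow> jet set \<Rightarrow> (jet \<Rightarrow> real) \<Rightarrow> jet set \<Rightarrow> jet \<Rightarrow> jet \<Rightarrow> bool" where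
  "area_preserving_equivalent f U fb Ub q qb \<longleftrightarrow>
     (\<exists>V Vb \<Psi>. open V \<and> V \<subseteq> U \<and> q \<in> V \<and> open Vb \<and> Vb \<subseteq> Ub \<and> qb \<in> Vb \<and>
        analytic_diffeo \<Psi> V Vb \<and> \<Psi> q = qb \<and>
        is_area_preserving_prolongation \<Psi> V \<and> maps_solutions f V fb Vb \<Psi>)"

definition bundle_map :: "jet set \<Rightarrow> jet set \<Rightarrow> (jet \<Rightarrow> jet) \<Rightarrow> (bpoint \<Rightarrow> bpoint) \<Rightarrow> bool" where
  "bundle_map V Vb \<psi> F \<longleftrightarrow>
     analytic_diffeo \<psi> V Vb \<and> analytic_diffeo F (H_bundle V) (H_bundle Vb) \<and>
     (\<forall>b\<in>H_bundle V. fst (F b) = \<psi> (fst b)) \<and>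
     (\<forall>b\<in>H_bundle V. \<forall>T\<in>Hgrp. F (ract b T) = ract (F b) T)"

end

theory Submission
  imports Defs
begin

text \<open>
  The normality conditions determine the pulled back connection \<open>\<eta>\<close> algebraically: vanishing
  torsion expresses \<open>\<eta>\<^sup>1\<^sub>1\<close> and \<open>\<eta>\<^sup>1\<^sub>2\<close> by \<open>\<mu>\<close> and two unknown functions, and
  the curvature conditions force \<open>\<mu> = - f\<^sub>p / 3\<close> and identify these functions as
  \<open>f\<^sub>p\<^sub>p / 6\<close> and \<open>f\<^sub>p\<^sub>p\<^sub>p / 6\<close>; the remaining component of \<open>\<Theta>\<^sup>2\<^sub>1\<close> is the left hand
  side of the differential equation for \<open>f\<close>. A Cartan connection on \<open>U \<times> H\<close> is
  \<open>S\<inverse> \<eta> S + S\<inverse> dS\<close>, so its curvature is the conjugate of that of \<open>\<eta>\<close>.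

  The prolongation \<open>\<psi>\<close> of an area preserving map changes \<open>(\<eta>\<^sup>1, \<eta>\<^sup>2)\<close> by an element
  \<open>S\<^sub>0(q)\<close> of \<open>H\<close>, and if it maps solutions to solutions then it also rescales \<open>\<Pi>\<close>
  modulo \<open>\<eta>\<^sup>2\<close>. Hence the gauge transform of \<open>\<psi>\<^sup>* \<eta>\<close> by \<open>S\<^sub>0\<close> is normal, and by uniqueness
  \<open>(q, S) \<mapsto> (\<psi> q, S\<^sub>0(q) S)\<close> preserves the connections. Conversely, the components
  \<open>\<theta>\<^sup>1, \<theta>\<^sup>3\<close> of a connection preserving bundle map show that the covered map is a prolongation,
  and \<open>\<theta>\<^sup>2\<close> shows that it maps solutions to solutions.
\<close>

section \<open>Power series in several variables\<close>

text \<open>One construction, \<open>gauge\<close>, serves on two levels: over the bundle projection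
  it produces connections on \<open>U \<times> H\<close>, over a map of jet spaces it produces the
  transformed form on the base. A single curvature computation covers both. The entries (2,1),
  (3,1), (3,2) are coordinates on \<open>asl2\<close> modulo the Lie algebra of the group. The term
  \<open>S\<inverse> dS\<close> has zeros there, so connections are compared on these entries with
  that term left unspecified. Uniqueness of the normal form is proved for forms that are merely
  differentiable, so a gauge transform can be compared with it without first being shown analytic.
  Two obstacles account for much of the length. Analyticity means unconditional convergence of a
  power series, so differentiability, analyticity of derivatives and symmetry of second derivatives
  have to be extracted from coefficient estimates. And \<open>maps_solutions\<close> constrains a
  map at a jet only if a solution passes through that jet, so local existence of solutions is
  required before anything can be concluded from it.\<close>

definition multi_indices :: "('a::euclidean_space \<Rightarrow> nat) set" where
  "multi_indices = {\<alpha>. \<forall>b. b \<notin> Basis \<longrightarrow> \<alpha> b = 0}"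

definition mpow :: "'a::euclidean_space \<Rightarrow> ('a \<Rightarrow> nat) \<Rightarrow> real" where
  "mpow h \<alpha> = (\<Prod>b\<in>Basis. (h \<bullet> b) ^ \<alpha> b)"

definition mdeg :: "('a::euclidean_space \<Rightarrow> nat) \<Rightarrow> nat" where
  "mdeg \<alpha> = (\<Sum>b\<in>Basis. \<alpha> b)"

definition unit_index :: "'a \<Rightarrow> 'a \<Rightarrow> nat" where
  "unit_index i = (\<lambda>b. if b = i then 1 else 0)"

definition cube :: "real \<Rightarrow> 'a::euclidean_space set" where
  "cube \<rho> = {h. \<forall>b\<in>Basis. \<bar>h \<bullet> b\<bar> \<le> \<rho>}"

text \<open>The cube is the closed ball of the maximum norm. On it \<open>mpow h \<alpha>\<close> is
  bounded by \<open>\<rho> ^ mdeg \<alpha>\<close>, with equality at the corner, so one summable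
  majorant at the corner controls all later estimates.\<close>

definition has_power_series ::
    "('a::euclidean_space \<Rightarrow> 'b::euclidean_space) \<Rightarrow> 'a \<Rightarrow> (('a \<Rightarrow> nat) \<Rightarrow> 'b) \<Rightarrow> real \<Rightarrow> bool" where
  "has_power_series f a c \<rho> \<longleftrightarrow> 0 < \<rho> \<and>
     (\<lambda>\<alpha>. \<rho> ^ mdeg \<alpha> * norm (c \<alpha>)) summable_on multi_indices \<and>
     (\<forall>h\<in>cube \<rho>. ((\<lambda>\<alpha>. mpow h \<alpha> *\<^sub>R c \<alpha>) has_sum f (a + h)) multi_indices)"

lemma mpow_0 [simp]: "mpow h (\<lambda>_. 0) = 1"
  by (simp add: mpow_def)

lemma mpow_add: "mpow h (\<lambda>b. \<alpha> b + \<beta> b) = mpow h \<alpha> * mpow h \<beta>"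
  by (simp add: mpow_def power_add prod.distrib)

lemma mpow_unit_index:
  assumes "i \<in> Basis"
  shows "mpow h (unit_index i) = h \<bullet> i"
proof -
  have "mpow h (unit_index i) = (\<Prod>b\<in>Basis. if b = i then h \<bullet> b else 1)"
    unfolding mpow_def unit_index_def by (intro prod.cong) auto
  then show ?thesis using assms by simp
qed

lemma mpow_split:
  assumes "i \<in> Basis"
  shows "mpow h \<alpha> = (h \<bullet> i) ^ \<alpha> i * (\<Prod>b\<in>Basis - {i}. (h \<bullet> b) ^ \<alpha> b)"
  unfolding mpow_def using assms by (simp add: prod.remove)

lemma mdeg_split:
  assumes "i \<in> Basis"
  shows "mdeg \<alpha> = \<alpha> i + (\<Sum>b\<in>Basis - {i}. \<alpha> b)"
  unfolding mdeg_def using assms by (simp add: sum.remove)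

lemma mpow_abs_le:
  assumes "h \<in> cube \<rho>"
  shows "\<bar>mpow h \<alpha>\<bar> \<le> \<rho> ^ mdeg \<alpha>"
  unfolding mpow_def mdeg_def abs_prod power_sum
  using assms by (intro prod_mono) (auto simp: cube_def power_abs intro!: power_mono)

lemma mpow_One: "mpow (\<rho> *\<^sub>R One) \<alpha> = \<rho> ^ mdeg \<alpha>"
  by (simp add: mpow_def mdeg_def power_sum)

lemma cube_One: "0 \<le> \<rho> \<Longrightarrow> \<rho> *\<^sub>R One \<in> cube \<rho>"
  by (simp add: cube_def)

lemma cube_norm: "h \<in> cube (norm h)"
  by (simp add: cube_def Basis_le_norm)

lemma cube_mono: "h \<in> cube r \<Longrightarrow> r \<le> s \<Longrightarrow> h \<in> cube s"
  by (force simp: cube_def)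

lemma norm_cube:
  fixes h :: "'a::euclidean_space" and \<rho> :: real
  assumes "h \<in> cube \<rho>"
  shows "norm h \<le> DIM('a) * \<rho>"
proof -
  have "norm h \<le> (\<Sum>b\<in>Basis. \<bar>h \<bullet> b\<bar>)" by (rule norm_le_l1)
  also have "\<dots> \<le> (\<Sum>b\<in>(Basis::'a set). \<rho>)" using assms by (intro sum_mono) (auto simp: cube_def)
  finally show ?thesis by simp
qed

text \<open>Each real component is absolutely summable, and the norm is at most the sum of the
  absolute components.\<close>

lemma euclidean_abs_summable:
  fixes f :: "'i \<Rightarrow> 'b::euclidean_space"
  assumes "f summable_on A"
  shows "(\<lambda>x. norm (f x)) summable_on A"
proof -
  have "(\<lambda>x. \<bar>f x \<bullet> b\<bar>) summable_on A" for b
    using iffD1[OF summable_on_iff_abs_summable_on_real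
        summable_on_bounded_linear[OF bounded_linear_inner_left[of b] assms]] by simp
  then have "(\<lambda>x. \<Sum>b\<in>B. \<bar>f x \<bullet> b\<bar>) summable_on A" for B :: "'b set"
    by (induction B rule: infinite_finite_induct) (auto intro: summable_on_add)
  then have *: "(\<lambda>x. \<Sum>b\<in>Basis. \<bar>f x \<bullet> b\<bar>) summable_on A" .
  show ?thesis
    by (rule summable_on_comparison_test[OF *]) (auto intro: norm_le_l1)
qed

section \<open>Closure properties of analytic functions\<close>

lemma real_analytic_atI:
  assumes "0 < r" "\<And>x. x \<in> ball a r \<Longrightarrow> ((\<lambda>\<alpha>. mpow (x - a) \<alpha> *\<^sub>R c \<alpha>) has_sum f x) multi_indices"
  shows "real_analytic_at f a"
  using assms unfolding real_analytic_at_def mpow_def[abs_def] multi_indices_def by blast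

lemma real_analytic_atE:
  assumes "real_analytic_at f a"
  obtains r c where "0 < r"
    "\<And>x. x \<in> ball a r \<Longrightarrow> ((\<lambda>\<alpha>. mpow (x - a) \<alpha> *\<^sub>R c \<alpha>) has_sum f x) multi_indices"
  using assms unfolding real_analytic_at_def mpow_def[abs_def] multi_indices_def by blast

text \<open>Convergence at the single corner point \<open>\<rho> *\<^sub>R One\<close> is already
  absolute, which supplies the majorant.\<close>

lemma real_analytic_at_iff:
  fixes f :: "'a::euclidean_space \<Rightarrow> 'b::euclidean_space"
  shows "real_analytic_at f a \<longleftrightarrow> (\<exists>c \<rho>. has_power_series f a c \<rho>)"
proof
  assume "real_analytic_at f a"
  then obtain r c where r: "0 < r"
    and s: "\<And>x. x \<in> ball a r \<Longrightarrow> ((\<lambda>\<alpha>. mpow (x - a) \<alpha> *\<^sub>R c \<alpha>) has_sum f x) multi_indices"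
    using real_analytic_atE by blast
  \<comment> \<open>Points of the cube have norm at most \<open>DIM('a) * \<rho> = r / 2\<close>, so
    the cube lies in the given ball.\<close>
  define \<rho> where "\<rho> = r / (2 * DIM('a))"
  have \<rho>: "\<rho> > 0" using r by (simp add: \<rho>_def)
  have "DIM('a) * \<rho> < r" using r by (simp add: \<rho>_def)
  then have cub: "a + h \<in> ball a r" if "h \<in> cube \<rho>" for h
    using norm_cube[OF that] by (simp add: dist_norm)
  have 1: "((\<lambda>\<alpha>. mpow h \<alpha> *\<^sub>R c \<alpha>) has_sum f (a + h)) multi_indices" if "h \<in> cube \<rho>" for h
    using s[OF cub[OF that]] by simp
  have "(\<lambda>\<alpha>. norm (mpow (\<rho> *\<^sub>R One) \<alpha> *\<^sub>R c \<alpha>)) summable_on multi_indices"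
    by (intro euclidean_abs_summable has_sum_imp_summable[OF 1] cube_One) (use \<rho> in auto)
  then have "(\<lambda>\<alpha>. \<rho> ^ mdeg \<alpha> * norm (c \<alpha>)) summable_on multi_indices"
    using \<rho> by (simp only: mpow_One norm_scaleR) simp
  with 1 \<rho> show "\<exists>c \<rho>. has_power_series f a c \<rho>"
    unfolding has_power_series_def by blast
next
  assume "\<exists>c \<rho>. has_power_series f a c \<rho>"
  then obtain c \<rho> where h: "has_power_series f a c \<rho>" by blast
  have "((\<lambda>\<alpha>. mpow (x - a) \<alpha> *\<^sub>R c \<alpha>) has_sum f x) multi_indices" if "x \<in> ball a \<rho>" for x
  proof -
    have "x - a \<in> cube \<rho>"
      using that by (intro cube_mono[OF cube_norm]) (simp add: dist_norm norm_minus_commute)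
    then have "((\<lambda>\<alpha>. mpow (x - a) \<alpha> *\<^sub>R c \<alpha>) has_sum f (a + (x - a))) multi_indices"
      using h unfolding has_power_series_def by blast
    then show ?thesis by simp
  qed
  moreover have "0 < \<rho>" using h unfolding has_power_series_def by blast
  ultimately show "real_analytic_at f a" by (intro real_analytic_atI)
qed

lemma real_analytic_at_transfer:
  assumes "real_analytic_at f a" "open S" "a \<in> S" "\<And>x. x \<in> S \<Longrightarrow> g x = f x"
  shows "real_analytic_at g a"
proof -
  obtain r c where r: "0 < r"
    and s: "\<And>x. x \<in> ball a r \<Longrightarrow> ((\<lambda>\<alpha>. mpow (x - a) \<alpha> *\<^sub>R c \<alpha>) has_sum f x) multi_indices"
    using real_analytic_atE[OF assms(1)] by blast
  obtain e where e: "e > 0" "ball a e \<subseteq> S" using assms open_contains_ball by blast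
  have "((\<lambda>\<alpha>. mpow (x - a) \<alpha> *\<^sub>R c \<alpha>) has_sum g x) multi_indices" if "x \<in> ball a (min r e)" for x
    using s[of x] assms(4)[of x] e that by (auto simp: subset_iff)
  then show ?thesis
    using r e by (intro real_analytic_atI[of "min r e" a c]) simp_all
qed

lemma real_analytic_on_cong:
  assumes "open S" "\<And>x. x \<in> S \<Longrightarrow> g x = f x"
  shows "real_analytic_on g S \<longleftrightarrow> real_analytic_on f S"
  unfolding real_analytic_on_def using assms real_analytic_at_transfer[of _ _ S] by metis

lemma real_analytic_on_subset: "real_analytic_on f S \<Longrightarrow> T \<subseteq> S \<Longrightarrow> real_analytic_on f T"
  unfolding real_analytic_on_def by blast

lemma real_analytic_at_const [simp]: "real_analytic_at (\<lambda>_. k) a"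
proof -
  have "((\<lambda>\<alpha>. mpow h \<alpha> *\<^sub>R (if \<alpha> = (\<lambda>_. 0) then k else 0)) has_sum k) multi_indices" for h :: 'a
    by (rule has_sum_finite_neutralI[where B = "{\<lambda>_. 0}"]) (auto simp: multi_indices_def)
  then show ?thesis
    by (intro real_analytic_atI[of 1]) auto
qed

lemma real_analytic_at_add [intro]:
  assumes "real_analytic_at f a" "real_analytic_at g a"
  shows "real_analytic_at (\<lambda>x. f x + g x) a"
proof -
  obtain r c where r: "0 < r"
    and s: "\<And>x. x \<in> ball a r \<Longrightarrow> ((\<lambda>\<alpha>. mpow (x - a) \<alpha> *\<^sub>R c \<alpha>) has_sum f x) multi_indices"
    using real_analytic_atE[OF assms(1)] by blast
  obtain r' d where r': "0 < r'"
    and s': "\<And>x. x \<in> ball a r' \<Longrightarrow> ((\<lambda>\<alpha>. mpow (x - a) \<alpha> *\<^sub>R d \<alpha>) has_sum g x) multi_indices"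
    using real_analytic_atE[OF assms(2)] by blast
  have "((\<lambda>\<alpha>. mpow (x - a) \<alpha> *\<^sub>R (c \<alpha> + d \<alpha>)) has_sum f x + g x) multi_indices"
    if "x \<in> ball a (min r r')" for x
    using has_sum_add[OF s[of x] s'[of x]] that by (simp add: scaleR_add_right)
  then show ?thesis
    using r r' by (intro real_analytic_atI[of "min r r'" a "\<lambda>\<alpha>. c \<alpha> + d \<alpha>"]) simp_all
qed

lemma real_analytic_at_linear:
  assumes "linear L" "real_analytic_at f a"
  shows "real_analytic_at (\<lambda>x. L (f x)) a"
proof -
  obtain r c where r: "0 < r"
    and s: "\<And>x. x \<in> ball a r \<Longrightarrow> ((\<lambda>\<alpha>. mpow (x - a) \<alpha> *\<^sub>R c \<alpha>) has_sum f x) multi_indices"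
    using real_analytic_atE[OF assms(2)] by blast
  have L: "bounded_linear L" using assms(1) by (simp add: linear_conv_bounded_linear)
  have "((\<lambda>\<alpha>. mpow (x - a) \<alpha> *\<^sub>R L (c \<alpha>)) has_sum L (f x)) multi_indices" if "x \<in> ball a r" for x
    using has_sum_bounded_linear[OF L s[OF that]] by (simp add: linear_scale[OF assms(1)])
  with r show ?thesis by (rule real_analytic_atI)
qed

lemma real_analytic_at_inner_Basis:
  assumes "i \<in> Basis"
  shows "real_analytic_at (\<lambda>x. x \<bullet> i) a"
proof -
  have ne: "unit_index i \<noteq> (\<lambda>_. 0)" by (auto simp: unit_index_def fun_eq_iff)
  have "((\<lambda>\<alpha>. mpow (x - a) \<alpha> *\<^sub>R
     (if \<alpha> = (\<lambda>_. 0) then a \<bullet> i else if \<alpha> = unit_index i then 1 else 0)) has_sum (x \<bullet> i)) multi_indices" for x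
    by (rule has_sum_finite_neutralI[where B = "{\<lambda>_. 0, unit_index i}"])
      (use assms ne ne[symmetric] in \<open>auto simp: multi_indices_def mpow_unit_index inner_diff_left, auto simp: unit_index_def\<close>)
  then show ?thesis
    by (intro real_analytic_atI[of 1]) auto
qed

lemma real_analytic_at_sum:
  assumes "\<And>i. i \<in> A \<Longrightarrow> real_analytic_at (f i) a"
  shows "real_analytic_at (\<lambda>x. \<Sum>i\<in>A. f i x) a"
  using assms by (induction A rule: infinite_finite_induct) auto

lemma real_analytic_at_scaleR_const:
  fixes f :: "'a::euclidean_space \<Rightarrow> real"
  assumes "real_analytic_at f a"
  shows "real_analytic_at (\<lambda>x. f x *\<^sub>R v) a"
  by (rule real_analytic_at_linear[OF _ assms]) (simp add: linear_iff scaleR_add_left)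

lemma real_analytic_at_componentwise:
  fixes f :: "'a::euclidean_space \<Rightarrow> 'b::euclidean_space"
  shows "real_analytic_at f a \<longleftrightarrow> (\<forall>b\<in>Basis. real_analytic_at (\<lambda>x. f x \<bullet> b) a)"
proof
  assume "real_analytic_at f a"
  then show "\<forall>b\<in>Basis. real_analytic_at (\<lambda>x. f x \<bullet> b) a"
    by (auto intro!: real_analytic_at_linear[of "\<lambda>y. y \<bullet> _"] simp: linear_iff inner_add_left)
next
  assume "\<forall>b\<in>Basis. real_analytic_at (\<lambda>x. f x \<bullet> b) a"
  then have "real_analytic_at (\<lambda>x. \<Sum>b\<in>Basis. (f x \<bullet> b) *\<^sub>R b) a"
    by (intro real_analytic_at_sum real_analytic_at_scaleR_const) auto
  then show "real_analytic_at f a" by (simp add: euclidean_representation)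
qed

lemma real_analytic_at_linear_self: "linear L \<Longrightarrow> real_analytic_at L a"
  by (rule real_analytic_at_linear[where f = "\<lambda>x. x"])
    (auto simp: real_analytic_at_componentwise[of "\<lambda>x. x"] real_analytic_at_inner_Basis)

lemma real_analytic_at_uminus: "real_analytic_at f a \<Longrightarrow> real_analytic_at (\<lambda>x. - f x) a"
  by (rule real_analytic_at_linear) (auto simp: linear_iff)

lemma real_analytic_at_diff:
  "real_analytic_at f a \<Longrightarrow> real_analytic_at g a \<Longrightarrow> real_analytic_at (\<lambda>x. f x - g x) a"
  using real_analytic_at_add[OF _ real_analytic_at_uminus, of f a g] by simp

text \<open>Fubini for real families: absolute summability of both factors makes the product family
  summable on the rectangle, and the iterated sum then gives its value.\<close>

lemma has_sum_product:
  fixes f :: "'i \<Rightarrow> real" and g :: "'j \<Rightarrow> real"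
  assumes f: "(f has_sum s) A" and g: "(g has_sum t) B"
  shows "((\<lambda>(x, y). f x * g y) has_sum s * t) (A \<times> B)"
proof (rule has_sum_SigmaI)
  show "((\<lambda>y. case (x, y) of (x, y) \<Rightarrow> f x * g y) has_sum f x * t) B" for x
    using has_sum_cmult_right[OF g] by simp
  show "((\<lambda>x. f x * t) has_sum s * t) A"
    using has_sum_cmult_left[OF f] by simp
  have af: "(\<lambda>x. \<bar>f x\<bar>) summable_on A" and ag: "(\<lambda>x. \<bar>g x\<bar>) summable_on B"
    using f g iffD1[OF summable_on_iff_abs_summable_on_real has_sum_imp_summable]
    by (simp_all flip: real_norm_def)
  obtain t' where t': "((\<lambda>x. \<bar>g x\<bar>) has_sum t') B" using ag by (auto simp: summable_on_def)
  have "(\<lambda>(x, y). \<bar>f x\<bar> * \<bar>g y\<bar>) summable_on A \<times> B"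
    by (rule summable_on_SigmaI[where g = "\<lambda>x. \<bar>f x\<bar> * t'"])
      (use has_sum_cmult_right[OF t'] summable_on_cmult_left[OF af] in auto)
  then have "(\<lambda>z. norm (case z of (x, y) \<Rightarrow> f x * g y)) summable_on A \<times> B"
    by (simp add: case_prod_unfold abs_mult)
  then show "(\<lambda>(x, y). f x * g y) summable_on A \<times> B"
    using summable_on_iff_abs_summable_on_real by blast
qed

text \<open>Cauchy product: pairs of indices are regrouped by their sum \<open>\<gamma>\<close>,
  with the first index, pointwise below \<open>\<gamma>\<close>, as second parameter.\<close>

lemma real_analytic_at_mult:
  fixes f g :: "'a::euclidean_space \<Rightarrow> real"
  assumes "real_analytic_at f a" "real_analytic_at g a"
  shows "real_analytic_at (\<lambda>x. f x * g x) a"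
proof -
  let ?M = "multi_indices :: ('a \<Rightarrow> nat) set"
  obtain r c where r: "0 < r"
    and s: "\<And>x. x \<in> ball a r \<Longrightarrow> ((\<lambda>\<alpha>. mpow (x - a) \<alpha> *\<^sub>R c \<alpha>) has_sum f x) ?M"
    using real_analytic_atE[OF assms(1)] by blast
  obtain r' d where r': "0 < r'"
    and s': "\<And>x. x \<in> ball a r' \<Longrightarrow> ((\<lambda>\<alpha>. mpow (x - a) \<alpha> *\<^sub>R d \<alpha>) has_sum g x) ?M"
    using real_analytic_atE[OF assms(2)] by blast
  define B where "B = (\<lambda>\<gamma> :: 'a \<Rightarrow> nat. {\<alpha>. \<forall>b. \<alpha> b \<le> \<gamma> b})"
  \<comment> \<open>With \<open>infsum\<close> over \<open>B \<gamma>\<close> no finiteness argument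
    is required; the inner families inherit summability from the family of all pairs.\<close>
  define e where "e = (\<lambda>\<gamma>. infsum (\<lambda>\<alpha>. c \<alpha> * d (\<lambda>b. \<gamma> b - \<alpha> b)) (B \<gamma>))"
  have "((\<lambda>\<gamma>. mpow (x - a) \<gamma> *\<^sub>R e \<gamma>) has_sum f x * g x) ?M" if "x \<in> ball a (min r r')" for x
  proof -
    let ?p = "mpow (x - a)"
    have 1: "((\<lambda>(\<alpha>, \<beta>). (?p \<alpha> *\<^sub>R c \<alpha>) * (?p \<beta> *\<^sub>R d \<beta>)) has_sum f x * g x) (?M \<times> ?M)"
      by (rule has_sum_product) (use s s' that in auto)
    have 2: "((\<lambda>(\<gamma>, \<alpha>). ?p \<gamma> * (c \<alpha> * d (\<lambda>b. \<gamma> b - \<alpha> b))) has_sum f x * g x) (Sigma ?M B)"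
    proof (rule iffD1[OF has_sum_reindex_bij_witness[where g = "\<lambda>(\<alpha>, \<beta>). (?p \<alpha> *\<^sub>R c \<alpha>) * (?p \<beta> *\<^sub>R d \<beta>)"
            and S = "?M \<times> ?M" and i = "\<lambda>(\<gamma>, \<alpha>). (\<alpha>, \<lambda>b. \<gamma> b - \<alpha> b)" and j = "\<lambda>(\<alpha>, \<beta>). (\<lambda>b. \<alpha> b + \<beta> b, \<alpha>)"] 1])
    qed (auto simp: B_def multi_indices_def mpow_add, metis le_zero_eq)
    have 3: "((\<lambda>\<alpha>. ?p \<gamma> * (c \<alpha> * d (\<lambda>b. \<gamma> b - \<alpha> b))) has_sum ?p \<gamma> * e \<gamma>) (B \<gamma>)" if "\<gamma> \<in> ?M" for \<gamma>
      using summable_on_SigmaD1[OF has_sum_imp_summable[OF 2] that]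
      unfolding e_def by (simp add: has_sum_iff infsum_cmult_right')
    have "((\<lambda>\<gamma>. ?p \<gamma> * e \<gamma>) has_sum f x * g x) ?M"
      by (rule has_sum_SigmaD[OF 2]) (use 3 in auto)
    then show ?thesis by simp
  qed
  then show ?thesis
    using r r' by (intro real_analytic_atI[of "min r r'" a e]) simp_all
qed

lemma real_analytic_at_scaleR:
  fixes f :: "'a::euclidean_space \<Rightarrow> real" and g :: "'a \<Rightarrow> 'b::euclidean_space"
  assumes "real_analytic_at f a" "real_analytic_at g a"
  shows "real_analytic_at (\<lambda>x. f x *\<^sub>R g x) a"
  using assms by (subst real_analytic_at_componentwise)
    (auto intro!: real_analytic_at_mult simp: real_analytic_at_componentwise[of g])

text \<open>Geometric series in \<open>- (x - u) / u\<close>, whose absolute value is below 1 on the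
  ball of radius \<open>\<bar>u\<bar>\<close>. A multi-index on the reals is just its exponent at
  the basis vector 1.\<close>

lemma real_analytic_at_inverse_real:
  assumes "u \<noteq> 0"
  shows "real_analytic_at (inverse :: real \<Rightarrow> real) u"
proof -
  define c where "c = (\<lambda>\<alpha>::real \<Rightarrow> nat. (- 1) ^ \<alpha> 1 / u ^ Suc (\<alpha> 1))"
  have "((\<lambda>\<alpha>. mpow (x - u) \<alpha> *\<^sub>R c \<alpha>) has_sum inverse x) multi_indices" if x: "x \<in> ball u \<bar>u\<bar>" for x
  proof -
    let ?z = "- (x - u) / u"
    have z: "\<bar>?z\<bar> < 1" using x assms by (simp add: dist_real_def abs_minus_commute)
    have "x \<noteq> 0" using x by auto
    then have *: "1 / (1 - ?z) * (1 / u) = inverse x" using assms by (simp add: field_simps)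
    have "((\<lambda>n. ?z ^ n) has_sum 1 / (1 - ?z)) UNIV"
      by (rule norm_summable_imp_has_sum)
        (use z in \<open>auto intro!: geometric_sums summable_geometric simp: power_abs\<close>)
    from has_sum_cmult_left[OF this, of "1 / u"]
    have "((\<lambda>n. ?z ^ n * (1 / u)) has_sum inverse x) UNIV" unfolding * .
    then show ?thesis
      by (rule iffD1[OF has_sum_reindex_bij_witness[where i = "\<lambda>\<alpha>. \<alpha> 1" and j = "\<lambda>n b. if b = 1 then n else 0"], rotated -1])
        (use assms in \<open>auto simp: multi_indices_def mpow_def c_def field_simps power_mult_distrib[symmetric] power_minus'\<close>)
  qed
  then show ?thesis
    using assms by (intro real_analytic_atI[of "\<bar>u\<bar>"]) auto
qed

text \<open>
  Only coordinate projections, inclusions and slices are ever composed with analytic maps below, so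
  a reindexing of the power series replaces the general composition theorem.
\<close>

lemma real_analytic_at_compose_coords:
  fixes f :: "'b::euclidean_space \<Rightarrow> 'c::euclidean_space" and g :: "'a::euclidean_space \<Rightarrow> 'b"
  assumes f: "real_analytic_at f (g a)"
    and J: "J \<subseteq> Basis" and \<sigma>: "inj_on \<sigma> J" "\<sigma> ` J \<subseteq> Basis"
    and g1: "\<And>x b. b \<in> J \<Longrightarrow> (g x - g a) \<bullet> b = (x - a) \<bullet> \<sigma> b"
    and g0: "\<And>x b. b \<in> Basis - J \<Longrightarrow> (g x - g a) \<bullet> b = 0"
  shows "real_analytic_at (\<lambda>x. f (g x)) a"
proof -
  obtain c r where hc: "has_power_series f (g a) c r" using f by (auto simp: real_analytic_at_iff)
  then have r: "0 < r"
    and s: "\<And>h. h \<in> cube r \<Longrightarrow> ((\<lambda>\<alpha>. mpow h \<alpha> *\<^sub>R c \<alpha>) has_sum f (g a + h)) multi_indices"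
    by (auto simp: has_power_series_def)
  \<comment> \<open>\<open>J\<close> contains the coordinates that vary along \<open>g\<close>;
    \<open>pull\<close> and \<open>push\<close> identify multi-indices supported on \<open>J\<close>
    with those supported on its image under \<open>\<sigma>\<close>. Indices with a positive
    exponent outside \<open>J\<close> contribute nothing, as the corresponding factor is 0.\<close>
  define pull where "pull = (\<lambda>(\<alpha>::'a \<Rightarrow> nat) b. if b \<in> J then \<alpha> (\<sigma> b) else 0)"
  define push where "push = (\<lambda>(\<beta>::'b \<Rightarrow> nat) y. if y \<in> \<sigma> ` J then \<beta> (inv_into J \<sigma> y) else 0)"
  define A where "A = {\<alpha>::'a \<Rightarrow> nat. \<forall>b. b \<notin> \<sigma> ` J \<longrightarrow> \<alpha> b = 0}"
  define B where "B = {\<beta>::'b \<Rightarrow> nat. \<forall>b. b \<notin> J \<longrightarrow> \<beta> b = 0}"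
  define d where "d = (\<lambda>\<alpha>. if \<alpha> \<in> A then c (pull \<alpha>) else 0)"
  have AM: "A \<subseteq> multi_indices" using \<sigma>(2) by (force simp: A_def multi_indices_def)
  have "((\<lambda>\<alpha>. mpow (x - a) \<alpha> *\<^sub>R d \<alpha>) has_sum f (g x)) multi_indices" if x: "x \<in> ball a r" for x
  proof -
    let ?h = "g x - g a"
    have xc: "\<bar>(x - a) \<bullet> b\<bar> \<le> r" if "b \<in> Basis" for b
      using Basis_le_norm[OF that, of "x - a"] x by (simp add: dist_norm norm_minus_commute)
    have "?h \<in> cube r"
      unfolding cube_def using g1 g0 xc \<sigma> J r by (auto simp: image_subset_iff) (metis Diff_iff abs_zero less_imp_le)
    from s[OF this] have "((\<lambda>\<alpha>. mpow ?h \<alpha> *\<^sub>R c \<alpha>) has_sum f (g x)) multi_indices" by simp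
    also have "?this \<longleftrightarrow> ((\<lambda>\<alpha>. mpow ?h \<alpha> *\<^sub>R c \<alpha>) has_sum f (g x)) B"
    proof (rule has_sum_cong_neutral)
      fix \<beta> :: "'b \<Rightarrow> nat" assume "\<beta> \<in> multi_indices - B"
      then obtain b where b: "b \<notin> J" "\<beta> b \<noteq> 0" "b \<in> Basis"
        by (force simp: B_def multi_indices_def)
      then have "(?h \<bullet> b) ^ \<beta> b = 0" using g0 by auto
      with b have "mpow ?h \<beta> = 0" unfolding mpow_def by (metis finite_Basis prod_zero_iff)
      then show "mpow ?h \<beta> *\<^sub>R c \<beta> = 0" by simp
    qed (use J in \<open>auto simp: B_def multi_indices_def\<close>)
    also have "\<dots> \<longleftrightarrow> ((\<lambda>\<alpha>. mpow (x - a) \<alpha> *\<^sub>R d \<alpha>) has_sum f (g x)) A"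
    proof (rule has_sum_reindex_bij_witness[where i = pull and j = push])
      fix \<beta> assume \<beta>: "\<beta> \<in> B"
      show pp: "pull (push \<beta>) = \<beta>"
        using \<beta> \<sigma> by (auto simp: pull_def push_def B_def fun_eq_iff)
      show pA: "push \<beta> \<in> A" by (simp add: push_def A_def)
      have "mpow (x - a) (push \<beta>) = (\<Prod>y\<in>\<sigma> ` J. ((x - a) \<bullet> y) ^ push \<beta> y)"
        unfolding mpow_def by (rule prod.mono_neutral_right) (use \<sigma> in \<open>auto simp: push_def\<close>)
      also have "\<dots> = (\<Prod>b\<in>J. ((x - a) \<bullet> \<sigma> b) ^ push \<beta> (\<sigma> b))"
        by (rule prod.reindex_cong[OF \<sigma>(1)]) auto
      also have "\<dots> = (\<Prod>b\<in>J. (?h \<bullet> b) ^ \<beta> b)"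
        using g1 \<sigma> by (intro prod.cong) (auto simp: push_def)
      also have "\<dots> = mpow ?h \<beta>"
        unfolding mpow_def by (rule prod.mono_neutral_left) (use J \<beta> in \<open>auto simp: B_def\<close>)
      finally show "mpow (x - a) (push \<beta>) *\<^sub>R d (push \<beta>) = mpow ?h \<beta> *\<^sub>R c \<beta>"
        using pA by (simp add: d_def pp)
    next
      fix \<alpha> assume \<alpha>: "\<alpha> \<in> A"
      show "push (pull \<alpha>) = \<alpha>"
        using \<alpha> by (auto simp: pull_def push_def A_def fun_eq_iff inv_into_into f_inv_into_f)
      show "pull \<alpha> \<in> B" by (simp add: pull_def B_def)
    qed auto
    also have "\<dots> \<longleftrightarrow> ((\<lambda>\<alpha>. mpow (x - a) \<alpha> *\<^sub>R d \<alpha>) has_sum f (g x)) multi_indices"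
      by (rule has_sum_cong_neutral) (use AM in \<open>auto simp: d_def\<close>)
    finally show ?thesis .
  qed
  with r show ?thesis by (rule real_analytic_atI)
qed

section \<open>Differentiation of power series\<close>

abbreviation Df :: "('a::real_normed_vector \<Rightarrow> 'b::real_normed_vector) \<Rightarrow> 'a \<Rightarrow> 'a \<Rightarrow> 'b" where
  "Df f x \<equiv> frechet_derivative f (at x)"

text \<open>Remainders of power series come with quadratic bounds. This is applied to the total
  derivative at the centre of a series and, on the real line, to partial derivatives at other points
  of the cube.\<close>

lemma quadratic_bound_has_derivative:
  fixes f :: "'a::real_normed_vector \<Rightarrow> 'b::real_normed_vector"
  assumes L: "bounded_linear L" and r: "0 < r"
    and b: "\<And>h. norm h \<le> r \<Longrightarrow> norm (f (a + h) - f a - L h) \<le> K * (norm h)\<^sup>2"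
  shows "(f has_derivative L) (at a)"
  unfolding has_derivative_within
proof (intro conjI L)
  have "((\<lambda>y. norm (y - a)) \<longlongrightarrow> 0) (at a)"
    by (rule tendsto_eq_intros | simp)+
  from tendsto_mult_left[OF this, of K] have t: "((\<lambda>y. K * norm (y - a)) \<longlongrightarrow> 0) (at a)" by simp
  have "eventually (\<lambda>y. y \<in> ball a r) (at a)"
    unfolding eventually_at using r by (auto simp: dist_commute)
  then have "eventually (\<lambda>y. norm ((1 / norm (y - a)) *\<^sub>R (f y - f a - L (y - a))) \<le> K * norm (y - a)) (at a)"
  proof eventually_elim
    case (elim y)
    then have "norm (f (a + (y - a)) - f a - L (y - a)) \<le> K * (norm (y - a))\<^sup>2"
      by (intro b) (simp add: dist_norm norm_minus_commute)
    then show ?case by (cases "y = a") (simp_all add: divide_simps power2_eq_square mult_ac)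
  qed
  then show "((\<lambda>y. (1 / norm (y - a)) *\<^sub>R (f y - (f a + L (y - a)))) \<longlongrightarrow> 0) (at a)"
    unfolding diff_diff_eq by (rule Lim_null_comparison[OF _ t])
qed

lemma mdeg_ge_2:
  fixes \<alpha> :: "'a::euclidean_space \<Rightarrow> nat"
  assumes "\<alpha> \<in> multi_indices" "\<alpha> \<noteq> (\<lambda>_. 0)" "\<alpha> \<notin> unit_index ` Basis"
  shows "2 \<le> mdeg \<alpha>"
proof (rule ccontr)
  assume "\<not> 2 \<le> mdeg \<alpha>"
  then consider "mdeg \<alpha> = 0" | "mdeg \<alpha> = Suc 0" by linarith
  then show False
  proof cases
    case 1
    then have "\<alpha> b = 0" for b using assms(1) by (cases "b \<in> Basis") (auto simp: mdeg_def multi_indices_def)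
    then show False using assms(2) by auto
  next
    case 2
    then obtain i where i: "i \<in> Basis" "\<alpha> i = 1" "\<And>b. b \<in> Basis \<Longrightarrow> i \<noteq> b \<Longrightarrow> \<alpha> b = 0"
      unfolding mdeg_def by (auto simp: sum_eq_Suc0_iff)
    then have "\<alpha> = unit_index i"
      using assms(1) by (auto simp: unit_index_def multi_indices_def fun_eq_iff)
    then show False using assms(3) i by blast
  qed
qed

text \<open>Beyond degree 1 every monomial has degree at least 2, so for
  \<open>norm h \<le> \<rho>\<close> it is at most
  \<open>(norm h / \<rho>)\<^sup>2 * \<rho> ^ mdeg \<alpha>\<close>; summation against the majorant
  gives a quadratic remainder.\<close>

lemma has_power_series_derivative:
  fixes f :: "'a::euclidean_space \<Rightarrow> 'b::euclidean_space"
  assumes "has_power_series f a c \<rho>"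
  shows "(f has_derivative (\<lambda>h. \<Sum>b\<in>Basis. (h \<bullet> b) *\<^sub>R c (unit_index b))) (at a)"
proof -
  let ?M = "multi_indices :: ('a \<Rightarrow> nat) set"
  let ?L = "\<lambda>h. \<Sum>b\<in>Basis. (h \<bullet> b) *\<^sub>R c (unit_index b)"
  define E where "E = insert (\<lambda>_. 0) (unit_index ` (Basis :: 'a set))"
  have \<rho>: "0 < \<rho>" and m: "(\<lambda>\<alpha>. \<rho> ^ mdeg \<alpha> * norm (c \<alpha>)) summable_on ?M"
    and s: "\<And>h. h \<in> cube \<rho> \<Longrightarrow> ((\<lambda>\<alpha>. mpow h \<alpha> *\<^sub>R c \<alpha>) has_sum f (a + h)) ?M"
    using assms by (auto simp: has_power_series_def)
  obtain K where K: "((\<lambda>\<alpha>. \<rho> ^ mdeg \<alpha> * norm (c \<alpha>)) has_sum K) ?M" using m by (auto simp: summable_on_def)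
  have injE: "inj_on unit_index (Basis :: 'a set)"
    by (rule inj_onI) (metis unit_index_def zero_neq_one)
  have ne: "(\<lambda>_. 0) \<noteq> unit_index b" for b :: 'a by (auto simp: unit_index_def fun_eq_iff)
  have finE: "finite E" by (simp add: E_def)
  have EM: "E \<subseteq> ?M" by (auto simp: E_def multi_indices_def unit_index_def)
  have sumE: "(\<Sum>\<alpha>\<in>E. mpow h \<alpha> *\<^sub>R c \<alpha>) = c (\<lambda>_. 0) + ?L h" for h
    unfolding E_def using ne by (subst sum.insert) (auto simp: sum.reindex[OF injE] mpow_unit_index)
  have "c (\<lambda>_. 0) = f a"
  proof -
    have "((\<lambda>\<alpha>. mpow 0 \<alpha> *\<^sub>R c \<alpha>) has_sum c (\<lambda>_. 0)) ?M"
    proof (rule has_sum_finite_neutralI[where B = "{\<lambda>_. 0}"])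
      fix \<alpha> assume "\<alpha> \<in> ?M - {\<lambda>_. 0}"
      then obtain b where "b \<in> Basis" "\<alpha> b \<noteq> 0" by (force simp: multi_indices_def)
      then have "mpow 0 \<alpha> = 0" unfolding mpow_def
        by (intro prod_zero) (auto intro!: bexI[of _ b])
      then show "mpow 0 \<alpha> *\<^sub>R c \<alpha> = 0" by simp
    qed (auto simp: multi_indices_def)
    moreover have "((\<lambda>\<alpha>. mpow 0 \<alpha> *\<^sub>R c \<alpha>) has_sum f a) ?M"
      using s[of 0] \<rho> by (simp add: cube_def)
    ultimately show ?thesis by (rule has_sum_unique)
  qed
  note c0 = this
  show ?thesis
  proof (rule quadratic_bound_has_derivative[OF _ \<rho>, where K = "K / \<rho>\<^sup>2"])
    show "bounded_linear ?L"
      by (intro bounded_linear_sum bounded_linear_compose[OF bounded_linear_scaleR_left] bounded_linear_inner_left)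
    fix h :: 'a assume h: "norm h \<le> \<rho>"
    let ?t = "norm h / \<rho>"
    have eq: "(\<lambda>\<alpha>. mpow h \<alpha> *\<^sub>R c \<alpha> + (if \<alpha> \<in> E then - (mpow h \<alpha> *\<^sub>R c \<alpha>) else 0)) =
        (\<lambda>\<alpha>. if \<alpha> \<in> E then 0 else mpow h \<alpha> *\<^sub>R c \<alpha>)" by auto
    have "((\<lambda>\<alpha>. if \<alpha> \<in> E then - (mpow h \<alpha> *\<^sub>R c \<alpha>) else 0) has_sum - (c (\<lambda>_. 0) + ?L h)) ?M"
      by (rule has_sum_finite_neutralI[where B = E]) (use EM in \<open>auto simp: sum_negf sumE finE\<close>)
    from has_sum_add[OF s[OF cube_mono[OF cube_norm h]] this]
    have r: "((\<lambda>\<alpha>. if \<alpha> \<in> E then 0 else mpow h \<alpha> *\<^sub>R c \<alpha>) has_sum f (a + h) - f a - ?L h) ?M"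
      unfolding eq c0 by (simp add: algebra_simps)
    have bound: "norm (if \<alpha> \<in> E then 0 else mpow h \<alpha> *\<^sub>R c \<alpha>) \<le> ?t\<^sup>2 * (\<rho> ^ mdeg \<alpha> * norm (c \<alpha>))"
      if \<alpha>: "\<alpha> \<in> ?M" for \<alpha>
    proof (cases "\<alpha> \<in> E")
      case False
      then have d: "2 \<le> mdeg \<alpha>" using mdeg_ge_2[OF \<alpha>] by (auto simp: E_def)
      have "\<bar>mpow h \<alpha>\<bar> \<le> norm h ^ mdeg \<alpha>" by (rule mpow_abs_le[OF cube_norm])
      also have "\<dots> = ?t ^ mdeg \<alpha> * \<rho> ^ mdeg \<alpha>" using \<rho> by (simp add: power_divide)
      also have "\<dots> \<le> ?t\<^sup>2 * \<rho> ^ mdeg \<alpha>"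
        using \<rho> h by (intro mult_right_mono power_decreasing[OF d]) auto
      finally show ?thesis using False by (simp add: mult_right_mono flip: mult.assoc)
    qed (use \<rho> in simp)
    have mm: "((\<lambda>\<alpha>. ?t\<^sup>2 * (\<rho> ^ mdeg \<alpha> * norm (c \<alpha>))) has_sum ?t\<^sup>2 * K) ?M"
      by (rule has_sum_cmult_right[OF K])
    have "(\<lambda>\<alpha>. norm (if \<alpha> \<in> E then 0 else mpow h \<alpha> *\<^sub>R c \<alpha>)) summable_on ?M"
      by (rule euclidean_abs_summable) (use r in \<open>auto simp: summable_on_def\<close>)
    then obtain n where n: "((\<lambda>\<alpha>. norm (if \<alpha> \<in> E then 0 else mpow h \<alpha> *\<^sub>R c \<alpha>)) has_sum n) ?M"
      by (auto simp: summable_on_def)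
    have "norm (f (a + h) - f a - ?L h) \<le> n" by (rule norm_has_sum_bound[OF n r])
    also have "n \<le> ?t\<^sup>2 * K" by (rule has_sum_mono[OF n mm bound])
    finally show "norm (f (a + h) - f a - ?L h) \<le> K / \<rho>\<^sup>2 * (norm h)\<^sup>2" by (simp add: power_divide mult_ac)
  qed
qed

lemma real_analytic_at_differentiable: "real_analytic_at f a \<Longrightarrow> f differentiable (at a)"
  unfolding real_analytic_at_iff differentiable_def using has_power_series_derivative by blast

text \<open>The left side is the binomial expansion from \<open>t\<^sup>2\<close> on. Each term is
  bounded by \<open>(t / \<tau>)\<^sup>2 * \<tau> ^ n\<close> times its binomial coefficient, and
  the coefficients from index 2 on add up to \<open>2 ^ n - n - 1\<close>. The induction replaces
  this sum by a recursion.\<close>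

lemma power_linear_approx:
  fixes s t \<tau> :: real
  assumes "\<bar>s\<bar> \<le> \<tau>" "\<bar>t\<bar> \<le> \<tau>" "0 < \<tau>"
  shows "\<bar>(s + t) ^ n - s ^ n - real n * t * s ^ (n - 1)\<bar> \<le> (t / \<tau>)\<^sup>2 * \<tau> ^ n * (2 ^ n - real n - 1)"
proof (induction n)
  case (Suc n)
  let ?E = "\<lambda>n. (s + t) ^ n - s ^ n - real n * t * s ^ (n - 1)"
  have E: "?E (Suc n) = (s + t) * ?E n + real n * t\<^sup>2 * s ^ (n - 1)"
    by (cases n) (simp_all add: algebra_simps power2_eq_square)
  have "\<bar>(s + t) * ?E n\<bar> \<le> (2 * \<tau>) * ((t / \<tau>)\<^sup>2 * \<tau> ^ n * (2 ^ n - real n - 1))"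
    unfolding abs_mult using assms by (intro mult_mono Suc) auto
  moreover have "\<bar>real n * t\<^sup>2 * s ^ (n - 1)\<bar> \<le> real n * t\<^sup>2 * \<tau> ^ (n - 1)"
    using assms by (auto simp: abs_mult power_abs intro!: mult_left_mono power_mono)
  moreover have "real n * t\<^sup>2 * \<tau> ^ (n - 1) = (t / \<tau>)\<^sup>2 * \<tau> ^ Suc n * n"
    using assms by (cases n) (simp_all add: field_simps power2_eq_square)
  ultimately have "\<bar>?E (Suc n)\<bar> \<le> (2 * \<tau>) * ((t / \<tau>)\<^sup>2 * \<tau> ^ n * (2 ^ n - real n - 1)) + (t / \<tau>)\<^sup>2 * \<tau> ^ Suc n * n"
    unfolding E by linarith
  also have "\<dots> = (t / \<tau>)\<^sup>2 * \<tau> ^ Suc n * (2 ^ Suc n - real (Suc n) - 1)"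
    by (simp add: algebra_simps)
  finally show ?case .
qed simp

lemma has_power_series_mono:
  assumes "has_power_series f a c \<rho>" "0 < \<rho>'" "\<rho>' \<le> \<rho>"
  shows "has_power_series f a c \<rho>'"
  using assms unfolding has_power_series_def
  by (auto intro!: cube_mono mult_right_mono power_mono
      elim!: summable_on_comparison_test[of "\<lambda>\<alpha>. \<rho> ^ mdeg \<alpha> * norm (c \<alpha>)"])

lemma has_power_series_transfer:
  assumes "has_power_series f a c \<rho>" "\<And>h. h \<in> cube \<rho> \<Longrightarrow> g (a + h) = f (a + h)"
  shows "has_power_series g a c \<rho>"
  using assms unfolding has_power_series_def by auto

text \<open>Termwise differentiation. Halving the radius pays for both estimates: with
  \<open>\<rho> = 2 * \<tau>\<close>, the powers of 2 absorb the factor \<open>\<alpha> i\<close> of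
  the differentiated monomial and the binomial factor of its remainder.\<close>

lemma has_power_series_partial:
  fixes f :: "'a::euclidean_space \<Rightarrow> 'b::euclidean_space"
  assumes hf: "has_power_series f a c \<rho>" and i: "i \<in> Basis"
  obtains g where
    "has_power_series g a (\<lambda>\<beta>. real (Suc (\<beta> i)) *\<^sub>R c (\<lambda>b. \<beta> b + unit_index i b)) (\<rho> / 2)"
    "\<And>h. h \<in> cube (\<rho> / 2) \<Longrightarrow> ((\<lambda>t. f (a + h + t *\<^sub>R i)) has_vector_derivative g (a + h)) (at 0)"
proof -
  let ?M = "multi_indices :: ('a \<Rightarrow> nat) set"
  define \<tau> where "\<tau> = \<rho> / 2"
  have \<rho>: "0 < \<rho>" and m: "(\<lambda>\<alpha>. \<rho> ^ mdeg \<alpha> * norm (c \<alpha>)) summable_on ?M"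
    and s: "\<And>h. h \<in> cube \<rho> \<Longrightarrow> ((\<lambda>\<alpha>. mpow h \<alpha> *\<^sub>R c \<alpha>) has_sum f (a + h)) ?M"
    using hf by (auto simp: has_power_series_def)
  obtain K where K: "((\<lambda>\<alpha>. \<rho> ^ mdeg \<alpha> * norm (c \<alpha>)) has_sum K) ?M" using m by (auto simp: summable_on_def)
  have \<tau>: "0 < \<tau>" "\<tau> \<le> \<rho>" "\<rho> = 2 * \<tau>" using \<rho> by (auto simp: \<tau>_def)
  \<comment> \<open>\<open>R\<close> is the monomial without coordinate \<open>i\<close>,
    \<open>D\<close> its full partial derivative, and \<open>sh\<close> raises the exponent at
    \<open>i\<close> by one.\<close>
  define R where "R = (\<lambda>(h::'a) \<alpha>. \<Prod>b\<in>Basis - {i}. (h \<bullet> b) ^ \<alpha> b)"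
  define D where "D = (\<lambda>h \<alpha>. real (\<alpha> i) * (h \<bullet> i) ^ (\<alpha> i - 1) * R h \<alpha>)"
  define sh where "sh = (\<lambda>(\<beta>::'a \<Rightarrow> nat) b. \<beta> b + unit_index i b)"
  define M1 where "M1 = {\<alpha>\<in>?M. 0 < \<alpha> i}"
  have R_le: "\<bar>R h \<alpha>\<bar> \<le> \<rho> ^ (\<Sum>b\<in>Basis - {i}. \<alpha> b)" if "h \<in> cube \<tau>" for h \<alpha>
    unfolding R_def abs_prod power_sum using cube_mono[OF that \<tau>(2)]
    by (intro prod_mono) (auto simp: cube_def power_abs intro!: power_mono)
  have D_le: "\<bar>D h \<alpha>\<bar> \<le> \<rho> ^ mdeg \<alpha> / \<tau>" if h: "h \<in> cube \<tau>" for h \<alpha>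
  proof -
    have "\<bar>real (\<alpha> i) * (h \<bullet> i) ^ (\<alpha> i - 1)\<bar> \<le> real (\<alpha> i) * \<tau> ^ (\<alpha> i - 1)"
      using h i by (auto simp: abs_mult power_abs cube_def intro!: mult_left_mono power_mono)
    also have "\<dots> = real (\<alpha> i) * \<tau> ^ \<alpha> i / \<tau>" using \<tau> by (cases "\<alpha> i") auto
    also have "\<dots> \<le> 2 ^ \<alpha> i * \<tau> ^ \<alpha> i / \<tau>"
      using \<tau> of_nat_less_two_power[of "\<alpha> i", where 'a = real]
      by (intro divide_right_mono mult_right_mono) auto
    also have "\<dots> = \<rho> ^ \<alpha> i / \<tau>" by (simp add: \<tau>(3) power_mult_distrib)
    finally have "\<bar>D h \<alpha>\<bar> \<le> \<rho> ^ \<alpha> i / \<tau> * \<rho> ^ (\<Sum>b\<in>Basis - {i}. \<alpha> b)"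
      unfolding D_def abs_mult using \<tau> \<rho> R_le[OF h, of \<alpha>] by (intro mult_mono) (auto simp: abs_mult)
    then show ?thesis by (simp add: mdeg_split[OF i] power_add)
  qed
  have D_abs: "(\<lambda>\<alpha>. norm (D h \<alpha> *\<^sub>R c \<alpha>)) summable_on ?M" if h: "h \<in> cube \<tau>" for h
  proof (rule summable_on_comparison_test)
    show "(\<lambda>\<alpha>. (\<rho> ^ mdeg \<alpha> * norm (c \<alpha>)) * (1 / \<tau>)) summable_on ?M"
      by (rule summable_on_cmult_left[OF m])
    show "norm (D h \<alpha> *\<^sub>R c \<alpha>) \<le> (\<rho> ^ mdeg \<alpha> * norm (c \<alpha>)) * (1 / \<tau>)" for \<alpha>
      using mult_right_mono[OF D_le[OF h, of \<alpha>] norm_ge_zero[of "c \<alpha>"]] by simp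
  qed simp
  define g where "g = (\<lambda>x. infsum (\<lambda>\<alpha>. D (x - a) \<alpha> *\<^sub>R c \<alpha>) ?M)"
  have g: "((\<lambda>\<alpha>. D h \<alpha> *\<^sub>R c \<alpha>) has_sum g (a + h)) ?M" if "h \<in> cube \<tau>" for h
    unfolding g_def using abs_summable_summable[OF D_abs[OF that]] by simp
  have D_sh: "D h (sh \<beta>) = real (Suc (\<beta> i)) * mpow h \<beta>" for h \<beta>
  proof -
    have "R h (sh \<beta>) = R h \<beta>"
      unfolding R_def sh_def by (intro prod.cong) (auto simp: unit_index_def)
    then show ?thesis by (simp add: D_def mpow_split[OF i] R_def sh_def unit_index_def)
  qed
  \<comment> \<open>A differentiated series has no terms with \<open>\<alpha> i = 0\<close>, so it
    may be indexed by \<open>sh \<beta>\<close>.\<close>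
  have shift: "(F has_sum y) ?M \<longleftrightarrow> ((\<lambda>\<beta>. F (sh \<beta>)) has_sum y) ?M"
    if "\<And>\<alpha>. \<alpha> i = 0 \<Longrightarrow> F \<alpha> = 0" for F :: "('a \<Rightarrow> nat) \<Rightarrow> 'd::real_normed_vector" and y
  proof -
    have "(F has_sum y) ?M \<longleftrightarrow> (F has_sum y) M1"
      by (rule has_sum_cong_neutral) (use that in \<open>auto simp: M1_def\<close>)
    also have "\<dots> \<longleftrightarrow> ((\<lambda>\<beta>. F (sh \<beta>)) has_sum y) ?M"
      by (rule has_sum_reindex_bij_witness[where j = "\<lambda>\<alpha> b. \<alpha> b - unit_index i b" and i = sh])
        (use i in \<open>auto simp: M1_def sh_def multi_indices_def unit_index_def fun_eq_iff intro!: arg_cong[of _ _ F]\<close>)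
    finally show ?thesis .
  qed
  show thesis
  proof
    show "has_power_series g a (\<lambda>\<beta>. real (Suc (\<beta> i)) *\<^sub>R c (\<lambda>b. \<beta> b + unit_index i b)) (\<rho> / 2)"
      unfolding has_power_series_def \<tau>_def[symmetric]
    proof (intro conjI ballI \<tau>)
      fix h :: 'a assume "h \<in> cube \<tau>"
      from iffD1[OF shift g[OF this]]
      show "((\<lambda>\<beta>. mpow h \<beta> *\<^sub>R real (Suc (\<beta> i)) *\<^sub>R c (\<lambda>b. \<beta> b + unit_index i b)) has_sum g (a + h)) ?M"
        unfolding D_sh by (simp add: D_def sh_def mult.commute)
    next
      \<comment> \<open>At the corner all monomials are positive, so absolute summability there is
        exactly the majorant for the new series.\<close>
      obtain y where "((\<lambda>\<alpha>. norm (D (\<tau> *\<^sub>R One) \<alpha> *\<^sub>R c \<alpha>)) has_sum y) ?M"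
        using D_abs[OF cube_One] \<tau> by (auto simp: summable_on_def)
      from iffD1[OF shift this]
      show "(\<lambda>\<beta>. \<tau> ^ mdeg \<beta> * norm (real (Suc (\<beta> i)) *\<^sub>R c (\<lambda>b. \<beta> b + unit_index i b))) summable_on ?M"
        unfolding D_sh mpow_One using \<tau> by (auto simp: summable_on_def D_def sh_def abs_mult mult_ac)
    qed
    fix h :: 'a assume "h \<in> cube (\<rho> / 2)"
    then have h: "h \<in> cube \<tau>" by (simp add: \<tau>_def)
    show "((\<lambda>t. f (a + h + t *\<^sub>R i)) has_vector_derivative g (a + h)) (at 0)"
      unfolding has_vector_derivative_def
    proof (rule quadratic_bound_has_derivative[OF bounded_linear_scaleR_left \<tau>(1), where K = "K / \<tau>\<^sup>2"])
      fix t :: real assume t: "norm t \<le> \<tau>"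
      let ?T = "\<lambda>\<alpha>. mpow (h + t *\<^sub>R i) \<alpha> - mpow h \<alpha> - t * D h \<alpha>"
      have "h + t *\<^sub>R i \<in> cube \<rho>"
        unfolding cube_def
      proof safe
        fix b :: 'a assume b: "b \<in> Basis"
        have "\<bar>h \<bullet> b\<bar> \<le> \<tau>" using h b by (auto simp: cube_def)
        moreover have "\<bar>t * (i \<bullet> b)\<bar> \<le> \<tau>" using t \<tau> b i by (auto simp: inner_Basis)
        ultimately show "\<bar>(h + t *\<^sub>R i) \<bullet> b\<bar> \<le> \<rho>" unfolding \<tau>(3) inner_add_left inner_scaleR_left by linarith
      qed
      from has_sum_add[OF has_sum_add[OF s[OF this] has_sum_scaleR[OF s[OF cube_mono[OF h \<tau>(2)]], of "- 1"]]
          has_sum_scaleR[OF g[OF h], of "- t"]]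
      have 1: "((\<lambda>\<alpha>. ?T \<alpha> *\<^sub>R c \<alpha>) has_sum f (a + h + t *\<^sub>R i) - f (a + h) - t *\<^sub>R g (a + h)) ?M"
        by (simp add: algebra_simps)
      have bound: "norm (?T \<alpha> *\<^sub>R c \<alpha>) \<le> (t / \<tau>)\<^sup>2 * (\<rho> ^ mdeg \<alpha> * norm (c \<alpha>))" for \<alpha>
      proof -
        have "R (h + t *\<^sub>R i) \<alpha> = R h \<alpha>"
          unfolding R_def using i by (intro prod.cong) (auto simp: inner_add_left inner_Basis)
        then have T: "?T \<alpha> = ((h \<bullet> i + t) ^ \<alpha> i - (h \<bullet> i) ^ \<alpha> i - real (\<alpha> i) * t * (h \<bullet> i) ^ (\<alpha> i - 1)) * R h \<alpha>"
          using i by (simp add: mpow_split[OF i] D_def R_def inner_add_left algebra_simps)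
        have "\<bar>(h \<bullet> i + t) ^ \<alpha> i - (h \<bullet> i) ^ \<alpha> i - real (\<alpha> i) * t * (h \<bullet> i) ^ (\<alpha> i - 1)\<bar>
            \<le> (t / \<tau>)\<^sup>2 * \<tau> ^ \<alpha> i * (2 ^ \<alpha> i - real (\<alpha> i) - 1)"
          by (rule power_linear_approx) (use h i t \<tau> in \<open>auto simp: cube_def\<close>)
        also have "\<dots> \<le> (t / \<tau>)\<^sup>2 * \<tau> ^ \<alpha> i * 2 ^ \<alpha> i"
          using \<tau> by (intro mult_left_mono) auto
        also have "\<dots> = (t / \<tau>)\<^sup>2 * \<rho> ^ \<alpha> i" by (simp add: \<tau>(3) power_mult_distrib)
        finally have "\<bar>?T \<alpha>\<bar> \<le> (t / \<tau>)\<^sup>2 * \<rho> ^ \<alpha> i * \<rho> ^ (\<Sum>b\<in>Basis - {i}. \<alpha> b)"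
          unfolding T abs_mult using R_le[OF h, of \<alpha>] \<rho> by (intro mult_mono) auto
        then have "\<bar>?T \<alpha>\<bar> \<le> (t / \<tau>)\<^sup>2 * \<rho> ^ mdeg \<alpha>" by (simp add: mdeg_split[OF i] power_add mult.assoc)
        from mult_right_mono[OF this norm_ge_zero[of "c \<alpha>"]] show ?thesis by (simp add: mult.assoc)
      qed
      have "(\<lambda>\<alpha>. norm (?T \<alpha> *\<^sub>R c \<alpha>)) summable_on ?M"
        by (rule euclidean_abs_summable) (rule has_sum_imp_summable[OF 1])
      then obtain n where n: "((\<lambda>\<alpha>. norm (?T \<alpha> *\<^sub>R c \<alpha>)) has_sum n) ?M" by (auto simp: summable_on_def)
      have "norm (f (a + h + t *\<^sub>R i) - f (a + h) - t *\<^sub>R g (a + h)) \<le> n" by (rule norm_has_sum_bound[OF n 1])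
      also have "n \<le> (t / \<tau>)\<^sup>2 * K" by (rule has_sum_mono[OF n has_sum_cmult_right[OF K] bound])
      finally show "norm (f (a + h + (0 + t) *\<^sub>R i) - f (a + h + 0 *\<^sub>R i) - t *\<^sub>R g (a + h)) \<le> K / \<tau>\<^sup>2 * (norm t)\<^sup>2"
        by (simp add: power_divide mult_ac)
    qed
  qed
qed

lemma real_analytic_at_has_derivative:
  "real_analytic_at f x \<Longrightarrow> (f has_derivative Df f x) (at x)"
  using real_analytic_at_differentiable frechet_derivative_works by blast

lemma frechet_derivative_expand:
  fixes f :: "'a::euclidean_space \<Rightarrow> 'b::real_normed_vector"
  assumes "f differentiable (at x)"
  shows "Df f x v = (\<Sum>b\<in>Basis. (v \<bullet> b) *\<^sub>R Df f x b)"
proof -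
  have l: "linear (Df f x)" by (rule linear_frechet_derivative[OF assms])
  have "Df f x (\<Sum>b\<in>Basis. (v \<bullet> b) *\<^sub>R b) = (\<Sum>b\<in>Basis. (v \<bullet> b) *\<^sub>R Df f x b)"
    by (simp add: linear_sum[OF l] linear_scale[OF l])
  then show ?thesis by (simp add: euclidean_representation)
qed

text \<open>The point is that one coefficient family \<open>c\<close> and one radius serve all
  directions \<open>i\<close>: second derivatives taken in different orders are then read off from
  the same coefficients.\<close>

lemma has_power_series_frechet_derivative:
  fixes f :: "'a::euclidean_space \<Rightarrow> 'b::euclidean_space"
  assumes f: "real_analytic_on f S" and S: "open S" and a: "a \<in> S"
  obtains c \<rho> where
    "\<And>i. i \<in> Basis \<Longrightarrow> has_power_series (\<lambda>x. Df f x i) a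
        (\<lambda>\<beta>. real (Suc (\<beta> i)) *\<^sub>R c (\<lambda>b. \<beta> b + unit_index i b)) \<rho>"
proof -
  obtain c r where c: "has_power_series f a c r"
    using f a by (auto simp: real_analytic_on_def real_analytic_at_iff)
  obtain e where e: "e > 0" "ball a e \<subseteq> S" using S a open_contains_ball by blast
  \<comment> \<open>The first bound allows termwise differentiation; the second keeps the cube
    inside \<open>S\<close>, where the Frechet derivative is known to exist.\<close>
  define \<rho> where "\<rho> = min (r / 2) (e / (2 * DIM('a)))"
  have "r > 0" using c by (simp add: has_power_series_def)
  then have \<rho>: "0 < \<rho>" "\<rho> \<le> r / 2" using e by (auto simp: \<rho>_def)
  have "DIM('a) * \<rho> \<le> DIM('a) * (e / (2 * DIM('a)))" unfolding \<rho>_def by (intro mult_left_mono) auto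
  then have "DIM('a) * \<rho> < e" using e by simp
  then have inS: "a + h \<in> S" if "h \<in> cube \<rho>" for h
    using norm_cube[OF that] e(2) by (auto simp: dist_norm subset_iff)
  show thesis
  proof
    fix i :: 'a assume i: "i \<in> Basis"
    obtain g where g: "has_power_series g a (\<lambda>\<beta>. real (Suc (\<beta> i)) *\<^sub>R c (\<lambda>b. \<beta> b + unit_index i b)) (r / 2)"
      "\<And>h. h \<in> cube (r / 2) \<Longrightarrow> ((\<lambda>t. f (a + h + t *\<^sub>R i)) has_vector_derivative g (a + h)) (at 0)"
      using has_power_series_partial[OF c i] by blast
    show "has_power_series (\<lambda>x. Df f x i) a
        (\<lambda>\<beta>. real (Suc (\<beta> i)) *\<^sub>R c (\<lambda>b. \<beta> b + unit_index i b)) \<rho>"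
    proof (rule has_power_series_transfer[OF has_power_series_mono[OF g(1) \<rho>]])
      fix h :: 'a assume h: "h \<in> cube \<rho>"
      have "(f has_derivative Df f (a + h)) (at (a + h))"
        using f inS[OF h] by (auto simp: real_analytic_on_def intro: real_analytic_at_has_derivative)
      then have "(f has_derivative Df f (a + h)) (at (a + h + 0 *\<^sub>R i))" by simp
      moreover have "((\<lambda>t. a + h + t *\<^sub>R i) has_derivative (\<lambda>t. t *\<^sub>R i)) (at 0)"
        by (auto intro!: derivative_eq_intros)
      ultimately have "((\<lambda>t. f (a + h + t *\<^sub>R i)) has_derivative (\<lambda>t. Df f (a + h) (t *\<^sub>R i))) (at 0)"
        using diff_chain_at[of "\<lambda>t. a + h + t *\<^sub>R i"] by (fastforce simp: o_def)
      moreover have "Df f (a + h) (t *\<^sub>R i) = t *\<^sub>R Df f (a + h) i" for t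
        using f inS[OF h] by (intro linear_scale linear_frechet_derivative real_analytic_at_differentiable)
          (auto simp: real_analytic_on_def)
      ultimately have "((\<lambda>t. f (a + h + t *\<^sub>R i)) has_vector_derivative Df f (a + h) i) (at 0)"
        by (simp add: has_vector_derivative_def)
      from vector_derivative_unique_at[OF this g(2)[OF cube_mono[OF h \<rho>(2)]]]
      show "Df f (a + h) i = g (a + h)" .
    qed
  qed
qed

lemma real_analytic_on_frechet_derivative:
  fixes f :: "'a::euclidean_space \<Rightarrow> 'b::euclidean_space"
  assumes "real_analytic_on f S" "open S"
  shows "real_analytic_on (\<lambda>x. Df f x v) S"
proof -
  have "real_analytic_on (\<lambda>x. Df f x i) S" if "i \<in> Basis" for i
    unfolding real_analytic_on_def real_analytic_at_iff
  proof
    fix a assume "a \<in> S"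
    from has_power_series_frechet_derivative[OF assms this] that
    show "\<exists>c \<rho>. has_power_series (\<lambda>x. Df f x i) a c \<rho>" by blast
  qed
  then have "real_analytic_on (\<lambda>x. \<Sum>b\<in>Basis. (v \<bullet> b) *\<^sub>R Df f x b) S"
    unfolding real_analytic_on_def by (auto intro!: real_analytic_at_sum real_analytic_at_scaleR)
  then show ?thesis
    using assms by (subst real_analytic_on_cong[OF assms(2)])
      (auto simp: real_analytic_on_def intro!: frechet_derivative_expand real_analytic_at_differentiable)
qed

text \<open>For basis vectors \<open>i\<close> and \<open>j\<close> both orders yield the
  coefficient at the sum of \<open>unit_index i\<close> and \<open>unit_index j\<close>, doubled if
  \<open>i = j\<close>.\<close>

lemma symmetric_second_derivative:
  fixes f :: "'a::euclidean_space \<Rightarrow> 'b::euclidean_space"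
  assumes "real_analytic_on f S" "open S" "a \<in> S"
  shows "Df (\<lambda>x. Df f x v) a w =
    Df (\<lambda>x. Df f x w) a v"
proof -
  obtain c \<rho> where c: "\<And>i. i \<in> Basis \<Longrightarrow> has_power_series (\<lambda>x. Df f x i) a
        (\<lambda>\<beta>. real (Suc (\<beta> i)) *\<^sub>R c (\<lambda>b. \<beta> b + unit_index i b)) \<rho>"
    using has_power_series_frechet_derivative[OF assms] by blast
  define C where "C = (\<lambda>i j. real (Suc (unit_index j i)) *\<^sub>R c (\<lambda>b. unit_index j b + unit_index i b))"
  have sym: "C i j = C j i" for i j
    by (simp add: C_def unit_index_def add.commute eq_commute)
  have D: "((\<lambda>x. Df f x v) has_derivative
      (\<lambda>w. \<Sum>i\<in>Basis. (v \<bullet> i) *\<^sub>R (\<Sum>j\<in>Basis. (w \<bullet> j) *\<^sub>R C i j))) (at a)" for v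
  proof -
    have "((\<lambda>x. \<Sum>i\<in>Basis. (v \<bullet> i) *\<^sub>R Df f x i) has_derivative
      (\<lambda>w. \<Sum>i\<in>Basis. (v \<bullet> i) *\<^sub>R (\<Sum>j\<in>Basis. (w \<bullet> j) *\<^sub>R C i j))) (at a)"
      unfolding C_def
      by (intro has_derivative_sum has_derivative_scaleR_right has_power_series_derivative[where \<rho> = \<rho>] c)
    then show ?thesis
      by (rule has_derivative_transform_within_open[OF _ assms(2,3)])
        (use assms in \<open>auto simp: real_analytic_on_def intro!: frechet_derivative_expand[symmetric] real_analytic_at_differentiable\<close>)
  qed
  have "Df (\<lambda>x. Df f x v) a w =
    (\<Sum>i\<in>Basis. \<Sum>j\<in>Basis. (v \<bullet> i) *\<^sub>R (w \<bullet> j) *\<^sub>R C i j)" for v w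
    unfolding frechet_derivative_at[OF D, symmetric] by (simp add: scaleR_sum_right)
  note E = this
  show ?thesis
    unfolding E by (subst sum.swap) (simp add: sym mult.commute)
qed

section \<open>The structure group and its Lie algebra\<close>

text \<open>The derivative of \<open>Hmat\<close> at (1, 0) in direction \<open>(a, b)\<close>; the
  sign of \<open>b\<close> follows that of the coordinate \<open>u3\<close>.\<close>

definition Hlie :: "real \<Rightarrow> real \<Rightarrow> mat3" where
  "Hlie a b = vector [vector [0, 0, 0], vector [0, a, - b], vector [0, 0, - a]]"

lemma Hlie_entries [simp]:
  "Hlie a b $ 1 = 0" "Hlie a b $ 2 $ 1 = 0" "Hlie a b $ 2 $ 2 = a" "Hlie a b $ 2 $ 3 = - b"
  "Hlie a b $ 3 $ 1 = 0" "Hlie a b $ 3 $ 2 = 0" "Hlie a b $ 3 $ 3 = - a"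
  by (simp_all add: Hlie_def vec_eq_iff forall_3)

lemma mat3_eqI:
  fixes A B :: mat3
  assumes "A $ 1 = B $ 1" "A $ 2 $ 1 = B $ 2 $ 1" "A $ 2 $ 2 = B $ 2 $ 2" "A $ 2 $ 3 = B $ 2 $ 3"
    "A $ 3 $ 1 = B $ 3 $ 1" "A $ 3 $ 2 = B $ 3 $ 2" "A $ 3 $ 3 = B $ 3 $ 3"
  shows "A = B"
  using assms by (simp add: vec_eq_iff forall_3)

lemma mat3_mult_entry: "((A :: mat3) ** B) $ i $ j = A $ i $ 1 * B $ 1 $ j + A $ i $ 2 * B $ 2 $ j + A $ i $ 3 * B $ 3 $ j"
  by (simp add: matrix_matrix_mult_def sum_3)

lemma bounded_bilinear_mat3: "bounded_bilinear ((**) :: mat3 \<Rightarrow> mat3 \<Rightarrow> mat3)"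
  unfolding bilinear_conv_bounded_bilinear[symmetric] bilinear_def linear_iff
  by (auto simp: vec_eq_iff mat3_mult_entry algebra_simps)

interpretation mm: bounded_bilinear "(**) :: mat3 \<Rightarrow> mat3 \<Rightarrow> mat3"
  by (rule bounded_bilinear_mat3)

definition mat_power :: "mat3 \<Rightarrow> nat \<Rightarrow> mat3" where
  "mat_power X n = (((**) X) ^^ n) (mat 1)"

lemma mat_power_simps [simp]:
  "mat_power X 0 = mat 1" "mat_power X (Suc n) = X ** mat_power X n"
  by (simp_all add: mat_power_def)

lemma mat_power_scaleR: "mat_power (t *\<^sub>R X) n = t ^ n *\<^sub>R mat_power X n"
  by (induction n) (simp_all add: mm.scaleR_left mm.scaleR_right)

text \<open>Entrywise, the exponential is a scalar power series in \<open>t\<close>, to which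
  termwise differentiation applies. Convergence comes from a bound \<open>K\<close> for left
  multiplication by \<open>X\<close>.\<close>

lemma mexp_entry:
  fixes X :: mat3
  shows "summable (\<lambda>n. (mat_power X n $ i $ j / fact n) * t ^ n)"
    and "mexp (t *\<^sub>R X) $ i $ j = (\<Sum>n. (mat_power X n $ i $ j / fact n) * t ^ n)"
proof -
  obtain K where K: "\<forall>Y :: mat3. norm (X ** Y) \<le> norm Y * K" "0 < K"
    using bounded_linear.pos_bounded[OF mm.bounded_linear_right[of X]] by blast
  have P: "norm (mat_power X n) \<le> K ^ n * norm (mat 1 :: mat3)" for n
  proof (induction n)
    case (Suc n)
    have "norm (X ** mat_power X n) \<le> norm (mat_power X n) * K" by (rule K(1)[rule_format])
    also have "\<dots> \<le> (K ^ n * norm (mat 1 :: mat3)) * K" using Suc K by (intro mult_right_mono) auto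
    finally show ?case by (simp add: mult_ac)
  qed simp
  let ?g = "\<lambda>n. (1 / fact n) *\<^sub>R mat_power (t *\<^sub>R X) n"
  have s: "summable ?g"
  proof (rule summable_comparison_test')
    show "summable (\<lambda>n. ((K * \<bar>t\<bar>) ^ n /\<^sub>R fact n) * norm (mat 1 :: mat3))"
      by (intro summable_mult2 summable_exp_generic)
    fix n :: nat
    have "\<bar>t ^ n\<bar> / fact n * norm (mat_power X n) \<le> \<bar>t ^ n\<bar> / fact n * (K ^ n * norm (mat 1 :: mat3))"
      by (intro mult_left_mono P) simp
    then show "norm (?g n) \<le> ((K * \<bar>t\<bar>) ^ n /\<^sub>R fact n) * norm (mat 1 :: mat3)"
      by (simp add: mat_power_scaleR power_mult_distrib power_abs field_simps)
  qed
  have L: "bounded_linear (\<lambda>M :: mat3. M $ i $ j)"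
    by (intro bounded_linear_compose[OF bounded_linear_vec_nth] bounded_linear_vec_nth)
  have e: "?g n $ i $ j = (mat_power X n $ i $ j / fact n) * t ^ n" for n
    by (simp add: mat_power_scaleR)
  show "summable (\<lambda>n. (mat_power X n $ i $ j / fact n) * t ^ n)"
    using bounded_linear.summable[OF L s] unfolding e .
  show "mexp (t *\<^sub>R X) $ i $ j = (\<Sum>n. (mat_power X n $ i $ j / fact n) * t ^ n)"
  proof -
    have "mexp (t *\<^sub>R X) = suminf ?g" by (simp add: mexp_def mat_power_def)
    then show ?thesis using bounded_linear.suminf[OF L s] unfolding e by simp
  qed
qed

lemma mexp_0_entry: "mexp 0 $ i $ j = (mat 1 :: mat3) $ i $ j"
  using mexp_entry(2)[of 0 0 i j] powser_zero[of "\<lambda>n. mat_power 0 n $ i $ j / fact n"] by simp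

lemma mexp_entry_derivative:
  "((\<lambda>t. mexp (t *\<^sub>R X) $ i $ j) has_real_derivative X $ i $ j) (at 0)"
proof -
  let ?c = "\<lambda>n. mat_power X n $ i $ j / fact n"
  have "((\<lambda>t. \<Sum>n. ?c n * t ^ n) has_field_derivative (\<Sum>n. diffs ?c n * 0 ^ n)) (at 0)"
    by (rule termdiffs_strong_converges_everywhere) (rule mexp_entry(1))
  moreover have "(\<Sum>n. diffs ?c n * 0 ^ n) = X $ i $ j"
    unfolding powser_zero by (simp add: diffs_def)
  ultimately show ?thesis unfolding mexp_entry(2) by simp
qed

text \<open>The powers are upper triangular with diagonal entries \<open>a ^ n\<close> and
  \<open>(- a) ^ n\<close>, so the determinant condition becomes
  \<open>exp (a * t) * exp (- a * t) = 1\<close>. The entry (2,3) is unconstrained in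
  \<open>Hgrp_alt\<close> and is not computed.\<close>

lemma mexp_Hlie: "mexp (t *\<^sub>R Hlie a b) \<in> Hgrp"
proof -
  let ?P = "mat_power (Hlie a b)"
  have 1: "?P n $ 1 = (if n = 0 then vector [1, 0, 0] else 0)" for n
    by (cases n) (simp_all add: vec_eq_iff forall_3 mat3_mult_entry mat_def)
  have 2: "?P n $ 3 $ 1 = 0 \<and> ?P n $ 3 $ 2 = 0 \<and> ?P n $ 3 $ 3 = (- a) ^ n" for n
    by (induction n) (simp_all add: mat3_mult_entry mat_def)
  have 3: "?P n $ 2 $ 1 = 0 \<and> ?P n $ 2 $ 2 = a ^ n" for n
    by (induction n) (simp_all add: mat3_mult_entry mat_def 1 2)
  have e: "(\<Sum>n. a ^ n / fact n * t ^ n) = exp (a * t)" for a :: real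
    by (simp add: exp_def power_mult_distrib divide_inverse mult_ac scaleR_conv_of_real)
  have f: "(\<Sum>n. (if n = 0 then 1 else 0) / fact n * t ^ n) = (1::real)"
for t
    using suminf_finite[of "{0}" "\<lambda>n. (if n = 0 then 1 else 0) / fact n * t ^ n"] by simp
  have "mexp (t *\<^sub>R Hlie a b) $ 1 = vector [1, 0, 0]"
    by (simp add: vec_eq_iff forall_3 mexp_entry(2) 1 if_distrib[of "\<lambda>v. v $ _"] f
        del: times_divide_eq_left cong: if_cong)
  then show ?thesis
    unfolding Hgrp_alt ASL2_def by (simp add: mexp_entry(2) 2 3 e del: times_divide_eq_left flip: exp_add)
qed

text \<open>The equations defining the group are differentiated at \<open>t = 0\<close> along
  \<open>mexp (t *\<^sub>R X)\<close>; the determinant condition becomes the vanishing of the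
  trace.\<close>

lemma lie_algebra_Hgrp: "lie_algebra Hgrp = {Hlie a b | a b. True}"
proof (intro subset_antisym subsetI)
  fix X assume "X \<in> lie_algebra Hgrp"
  then have X: "\<And>t. mexp (t *\<^sub>R X) \<in> Hgrp" by (simp add: lie_algebra_def)
  let ?M = "\<lambda>t. mexp (t *\<^sub>R X)"
  have const: "X $ i $ j = 0" if "\<And>t. ?M t $ i $ j = k" for i j k
    using DERIV_unique[OF mexp_entry_derivative[of X i j], of 0] that by simp
  have M1: "?M t $ 1 = vector [1, 0, 0]" for t using X[of t] by (simp add: Hgrp_alt ASL2_def)
  have M0: "?M t $ 2 $ 1 = 0" "?M t $ 3 $ 1 = 0" "?M t $ 3 $ 2 = 0" "?M t $ 2 $ 2 * ?M t $ 3 $ 3 = 1" for t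
    using X[of t] by (auto simp: Hgrp_alt ASL2_def)
  have "((\<lambda>t. ?M t $ 2 $ 2 * ?M t $ 3 $ 3) has_real_derivative X $ 2 $ 2 + X $ 3 $ 3) (at 0)"
    by (rule DERIV_cong[OF DERIV_mult[OF mexp_entry_derivative mexp_entry_derivative]])
      (simp add: mexp_0_entry mat_def)
  from DERIV_unique[OF this[unfolded M0(4)] DERIV_const] have tr: "X $ 2 $ 2 + X $ 3 $ 3 = 0" .
  have "X $ 1 $ 1 = 0" "X $ 1 $ 2 = 0" "X $ 1 $ 3 = 0"
    using const[of 1 1 1] const[of 1 2 0] const[of 1 3 0] by (simp_all add: M1)
  then have "X $ 1 = 0" by (simp add: vec_eq_iff forall_3)
  then have "X = Hlie (X $ 2 $ 2) (- X $ 2 $ 3)"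
    using tr const[OF M0(1)] const[OF M0(2)] const[OF M0(3)] by (intro mat3_eqI) auto
  then show "X \<in> {Hlie a b | a b. True}" by blast
qed (auto simp: lie_algebra_def mexp_Hlie)

text \<open>\<open>Hcoord\<close> reads only the second row of the product, so the action is linear
  in the point. Its derivative is therefore the action itself, as used in
  \<open>pullback_ract\<close>.\<close>

lemma ract_explicit:
  "ract (q, u1, u3) T = (q, u1 * T $ 2 $ 2 - u3 * T $ 3 $ 2, u3 * T $ 3 $ 3 - u1 * T $ 2 $ 3)"
  by (simp add: ract_def Hcoord_def mat3_mult_entry Hmat_entries)

lemma linear_ract: "linear (\<lambda>z. ract z T)"
  by (auto simp: linear_iff ract_explicit algebra_simps)

lemma fundamental_field_ract:
  "fundamental_field ract (Hlie a b) (q, u1, u3) = (0, u1 * a, u1 * b - u3 * a)"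
proof -
  let ?M = "\<lambda>t. mexp (t *\<^sub>R Hlie a b)"
  note d = mexp_entry_derivative[of "Hlie a b"]
  have "((\<lambda>t. (q, u1 * ?M t $ 2 $ 2 - u3 * ?M t $ 3 $ 2, u3 * ?M t $ 3 $ 3 - u1 * ?M t $ 2 $ 3))
      has_vector_derivative (0, u1 * a, u1 * b - u3 * a)) (at 0)"
    by (intro has_vector_derivative_Pair has_vector_derivative_const
          iffD1[OF has_real_derivative_iff_has_vector_derivative])
      (auto intro!: derivative_eq_intros d)
  then show ?thesis
    unfolding fundamental_field_def ract_explicit by (rule vector_derivative_at)
qed

lemma matrix_inv_Hmat: "t1 \<noteq> 0 \<Longrightarrow> matrix_inv (Hmat (t1, t3)) = Hmat (1 / t1, - t3)"
  
  using Hmat_inverse[of t1 t3] unfolding matrix_inv_def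
  by (intro some_equality) (auto, metis matrix_mul_assoc matrix_mul_lid matrix_mul_rid)

definition dHmat :: "real \<times> real \<Rightarrow> real \<times> real \<Rightarrow> mat3" where
  "dHmat u v = vector [vector [0, 0, 0], vector [0, fst v, - snd v], vector [0, 0, - fst v / (fst u)\<^sup>2]]"

lemma dHmat_entries [simp]:
  "dHmat u v $ 1 = 0" "dHmat u v $ 2 $ 1 = 0" "dHmat u v $ 2 $ 2 = fst v" "dHmat u v $ 2 $ 3 = - snd v"
  "dHmat u v $ 3 $ 1 = 0" "dHmat u v $ 3 $ 2 = 0" "dHmat u v $ 3 $ 3 = - fst v / (fst u)\<^sup>2"
  by (simp_all add: dHmat_def vec_eq_iff forall_3)

text \<open>The left invariant Maurer-Cartan form of the group in the coordinates
  \<open>(u1, u3)\<close>.\<close>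

lemma maurer_cartan_Hmat:
  assumes "u1 \<noteq> 0"
  shows "Hmat (1 / u1, - u3) ** dHmat (u1, u3) (a, b) = Hlie (a / u1) (b / u1 + u3 * a / u1\<^sup>2)"
  using assms by (simp add: vec_eq_iff forall_3 mat3_mult_entry Hmat_entries) (simp add: divide_simps power2_eq_square)

lemma Hmat_entry:
  "Hmat u $ 1 $ 1 = 1" "Hmat u $ 1 $ 2 = 0" "Hmat u $ 1 $ 3 = 0"
  "Hmat u $ 2 $ 1 = 0" "Hmat u $ 2 $ 2 = fst u" "Hmat u $ 2 $ 3 = - snd u"
  "Hmat u $ 3 $ 1 = 0" "Hmat u $ 3 $ 2 = 0" "Hmat u $ 3 $ 3 = 1 / fst u"
  by (cases u; simp add: Hmat_entries)+

lemma has_derivative_mat3: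
  fixes S :: "'a::real_normed_vector \<Rightarrow> mat3"
  assumes "\<And>i j. ((\<lambda>x. S x $ i $ j) has_derivative (\<lambda>v. S' v $ i $ j)) (at x)"
  shows "(S has_derivative S') (at x)"
  using assms by (subst has_derivative_componentwise_within) (auto simp: Basis_vec_def inner_axis)

lemma has_derivative_Hmat:
  assumes "fst u \<noteq> 0"
  shows "(Hmat has_derivative dHmat u) (at u)"
proof (rule has_derivative_mat3)
  have "\<forall>i j. ((\<lambda>x. Hmat x $ i $ j) has_derivative (\<lambda>v. dHmat u v $ i $ j)) (at u)"
    unfolding forall_3 using assms
    by (auto simp: Hmat_entry intro!: derivative_eq_intros) (simp_all add: power2_eq_square divide_simps)
  then show "((\<lambda>x. Hmat x $ i $ j) has_derivative (\<lambda>v. dHmat u v $ i $ j)) (at u)" for i j by blast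
qed

section \<open>Gauge transformations and Cartan connections\<close>

lemma form1_basis_expand:
  fixes \<eta> :: "('b::euclidean_space, 'c::real_normed_vector) form1"
  assumes "linear (\<eta> y)"
  shows "\<eta> y w = (\<Sum>b\<in>Basis. (w \<bullet> b) *\<^sub>R \<eta> y b)"
proof -
  have "\<eta> y (\<Sum>b\<in>Basis. (w \<bullet> b) *\<^sub>R b) = (\<Sum>b\<in>Basis. (w \<bullet> b) *\<^sub>R \<eta> y b)"
    by (simp add: linear_sum[OF assms] linear_scale[OF assms])
  then show ?thesis by (simp add: euclidean_representation)
qed

text \<open>The regularity used for gauge transformed forms: enough for exterior derivatives and for
  uniqueness of the normal form, and easier to verify than analyticity.\<close>

definition diff_form1 :: "('a::euclidean_space, 'c::real_normed_vector) form1 \<Rightarrow> 'a set \<Rightarrow> bool" where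
  "diff_form1 \<eta> S \<longleftrightarrow> (\<forall>x\<in>S. linear (\<eta> x) \<and> (\<forall>v. (\<lambda>z. \<eta> z v) differentiable (at x)))"

lemma analytic_form1_imp_diff_form1: "analytic_form1 \<omega> S \<Longrightarrow> diff_form1 \<omega> S"
  by (auto simp: analytic_form1_def diff_form1_def real_analytic_on_def real_analytic_at_differentiable)

text \<open>Expansion in a basis reduces this to the product rule. The last summand contains a
  second derivative of \<open>\<phi>\<close>, symmetric in \<open>v\<close> and \<open>w\<close>,
  and so drops out of the exterior derivative.\<close>

lemma has_derivative_pullback:
  fixes \<phi> :: "'a::euclidean_space \<Rightarrow> 'b::euclidean_space" and \<eta> :: "('b, 'c::real_normed_vector) form1"
  assumes P: "open P" "x \<in> P" and \<phi>: "real_analytic_on \<phi> P" and Q: "open Q" "\<phi> ` P \<subseteq> Q"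
    and \<eta>: "diff_form1 \<eta> Q"
  shows "((\<lambda>z. pullback \<phi> \<eta> z w) has_derivative
    (\<lambda>v. Df (\<lambda>y. \<eta> y (Df \<phi> x w)) (\<phi> x) (Df \<phi> x v)
       + \<eta> (\<phi> x) (Df (\<lambda>z. Df \<phi> z w) x v))) (at x)"
proof -
  let ?D = "\<lambda>z. Df \<phi> z"
  let ?DD = "Df (\<lambda>z. ?D z w) x"
  let ?d = "\<lambda>b. Df (\<lambda>y. \<eta> y b) (\<phi> x)"
  have x: "\<phi> x \<in> Q" using P Q by blast
  have d\<phi>: "(\<phi> has_derivative ?D x) (at x)"
    using \<phi> P by (auto simp: real_analytic_on_def intro: real_analytic_at_has_derivative)
  have dd: "((\<lambda>z. ?D z w) has_derivative ?DD) (at x)"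
    using real_analytic_on_frechet_derivative[OF \<phi> P(1)] P
    by (auto simp: real_analytic_on_def intro: real_analytic_at_has_derivative)
  have d\<eta>: "((\<lambda>y. \<eta> y b) has_derivative ?d b) (at (\<phi> x))" for b
    using \<eta> x frechet_derivative_works by (auto simp: diff_form1_def)
  have d\<eta>': "((\<lambda>z. \<eta> (\<phi> z) b) has_derivative (\<lambda>v. ?d b (?D x v))) (at x)" for b
    using diff_chain_at[OF d\<phi> d\<eta>] by (simp add: o_def)
  have e: "?d a v = (\<Sum>b\<in>Basis. (a \<bullet> b) *\<^sub>R ?d b v)" for a v
  proof -
    have "((\<lambda>y. \<Sum>b\<in>Basis. (a \<bullet> b) *\<^sub>R \<eta> y b) has_derivative (\<lambda>v. \<Sum>b\<in>Basis. (a \<bullet> b) *\<^sub>R ?d b v)) (at (\<phi> x))"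
      by (intro has_derivative_sum has_derivative_scaleR_right d\<eta>)
    then have "((\<lambda>y. \<eta> y a) has_derivative (\<lambda>v. \<Sum>b\<in>Basis. (a \<bullet> b) *\<^sub>R ?d b v)) (at (\<phi> x))"
      by (rule has_derivative_transform_within_open[OF _ Q(1) x])
        (use \<eta> in \<open>auto simp: diff_form1_def intro!: form1_basis_expand[symmetric]\<close>)
    from fun_cong[OF frechet_derivative_at[OF this]] show ?thesis by (rule sym)
  qed
  have "((\<lambda>z. \<Sum>b\<in>Basis. (?D z w \<bullet> b) *\<^sub>R \<eta> (\<phi> z) b) has_derivative
      (\<lambda>v. \<Sum>b\<in>Basis. (?D x w \<bullet> b) *\<^sub>R ?d b (?D x v) + (?DD v \<bullet> b) *\<^sub>R \<eta> (\<phi> x) b)) (at x)"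
    by (intro has_derivative_sum has_derivative_scaleR has_derivative_inner_left d\<eta>' dd)
  then have "((\<lambda>z. pullback \<phi> \<eta> z w) has_derivative
      (\<lambda>v. \<Sum>b\<in>Basis. (?D x w \<bullet> b) *\<^sub>R ?d b (?D x v) + (?DD v \<bullet> b) *\<^sub>R \<eta> (\<phi> x) b)) (at x)"
    unfolding pullback_def
    by (rule has_derivative_transform_within_open[OF _ P])
      (use \<eta> Q in \<open>auto simp: diff_form1_def intro!: form1_basis_expand[symmetric]\<close>)
  moreover have "\<eta> (\<phi> x) (?DD v) = (\<Sum>b\<in>Basis. (?DD v \<bullet> b) *\<^sub>R \<eta> (\<phi> x) b)" for v
    using \<eta> x by (intro form1_basis_expand) (auto simp: diff_form1_def)
  ultimately show ?thesis by (simp add: e[of "?D x w"] sum.distrib)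
qed

text \<open>\<open>T\<close> stands for the inverse of \<open>S\<close>; as a separate argument it
  can be given by an explicit formula.\<close>

definition gauge ::
    "('a::euclidean_space \<Rightarrow> 'b::euclidean_space) \<Rightarrow> ('a \<Rightarrow> mat3) \<Rightarrow> ('a \<Rightarrow> mat3) \<Rightarrow> ('b, mat3) form1 \<Rightarrow> ('a, mat3) form1"
  where
  "gauge \<phi> S T \<eta> x v = T x ** pullback \<phi> \<eta> x v ** S x + T x ** Df S x v"

lemma linear_gauge:
  assumes "linear (\<eta> (\<phi> x))" "\<phi> differentiable (at x)" "S differentiable (at x)"
  shows "linear (gauge \<phi> S T \<eta> x)"
proof -
  note l = assms(1) assms(2,3)[THEN linear_frechet_derivative]
  show ?thesis unfolding gauge_def pullback_def
    by (rule linearI) (simp_all add: l[THEN linear_add] l[THEN linear_scale] mm.add_left mm.add_right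
        mm.scaleR_left mm.scaleR_right scaleR_add_right)
qed

text \<open>Differentiate \<open>T ** S = mat 1\<close> and multiply by \<open>T\<close> on the
  right.\<close>

lemma has_derivative_inverse_matrix:
  fixes S T :: "'a::euclidean_space \<Rightarrow> mat3"
  assumes P: "open P" "x \<in> P" and S: "(S has_derivative S') (at x)" and T: "T differentiable (at x)"
    and inv: "\<And>z. z \<in> P \<Longrightarrow> T z ** S z = mat 1" "\<And>z. z \<in> P \<Longrightarrow> S z ** T z = mat 1"
  shows "(T has_derivative (\<lambda>v. - (T x ** S' v ** T x))) (at x)"
proof -
  let ?T = "Df T x"
  have T': "(T has_derivative ?T) (at x)" using T frechet_derivative_works by blast
  have "((\<lambda>z. T z ** S z) has_derivative (\<lambda>v. T x ** S' v + ?T v ** S x)) (at x)"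
    by (rule mm.FDERIV[OF T' S])
  moreover have "((\<lambda>z. T z ** S z) has_derivative (\<lambda>v. 0)) (at x)"
    by (rule has_derivative_transform_within_open[OF has_derivative_const[of "mat 1"] P]) (simp add: inv)
  ultimately have "T x ** S' v + ?T v ** S x = 0" for v
    using has_derivative_unique by (metis (mono_tags))
  then have "(T x ** S' v + ?T v ** S x) ** T x = 0" for v by (simp add: mm.zero_left)
  then have "T x ** S' v ** T x + ?T v = 0" for v
    using inv(2)[OF P(2)] by (simp add: mm.add_left flip: matrix_mul_assoc)
  then have "?T = (\<lambda>v. - (T x ** S' v ** T x))" by (simp add: fun_eq_iff eq_neg_iff_add_eq_0 add.commute)
  with T' show ?thesis by simp
qed

text \<open>Second derivatives of \<open>S\<close> and \<open>\<phi>\<close> cancel by symmetry, and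
  all terms containing first derivatives of \<open>S\<close> cancel once the derivative of
  \<open>T\<close> is written as \<open>- T dS T\<close>. Only the conjugated curvature
  remains.\<close>

lemma
  fixes \<phi> :: "'a::euclidean_space \<Rightarrow> 'b::euclidean_space" and \<eta> :: "('b, mat3) form1"
  assumes P: "open P" "x \<in> P" and \<phi>: "real_analytic_on \<phi> P" and Q: "open Q" "\<phi> ` P \<subseteq> Q"
    and \<eta>: "diff_form1 \<eta> Q" and S: "real_analytic_on S P" and T: "T differentiable (at x)"
    and inv: "\<And>z. z \<in> P \<Longrightarrow> T z ** S z = mat 1" "\<And>z. z \<in> P \<Longrightarrow> S z ** T z = mat 1"
  shows differentiable_gauge: "(\<lambda>z. gauge \<phi> S T \<eta> z w) differentiable (at x)"
    and curvature_gauge: "curvature (gauge \<phi> S T \<eta>) x v w =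
      T x ** curvature \<eta> (\<phi> x) (Df \<phi> x v) (Df \<phi> x w) ** S x"
proof -
  let ?D = "Df \<phi> x"
  let ?S = "Df S x"
  let ?DD = "\<lambda>w. Df (\<lambda>z. Df \<phi> z w) x"
  let ?SS = "\<lambda>w. Df (\<lambda>z. Df S z w) x"
  let ?A = "pullback \<phi> \<eta> x"
  define A' where "A' w v = Df (\<lambda>y. \<eta> y (?D w)) (\<phi> x) (?D v) + \<eta> (\<phi> x) (?DD w v)" for v w
  define t where "t = T x"
  define s where "s = S x"
  have S': "(S has_derivative ?S) (at x)"
    using S P by (auto simp: real_analytic_on_def intro: real_analytic_at_has_derivative)
  have SS: "((\<lambda>z. Df S z w) has_derivative ?SS w) (at x)" for w
    using real_analytic_on_frechet_derivative[OF S P(1)] P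
    by (auto simp: real_analytic_on_def intro: real_analytic_at_has_derivative)
  have T': "(T has_derivative (\<lambda>v. - (t ** ?S v ** t))) (at x)"
    unfolding t_def by (rule has_derivative_inverse_matrix[OF P S' T inv])
  have A: "((\<lambda>z. pullback \<phi> \<eta> z w) has_derivative A' w) (at x)" for w
    unfolding A'_def[abs_def] by (rule has_derivative_pullback[OF P \<phi> Q \<eta>])
  have G: "((\<lambda>z. gauge \<phi> S T \<eta> z w) has_derivative
      (\<lambda>v. (t ** ?A w ** ?S v + (t ** A' w v + - (t ** ?S v ** t) ** ?A w) ** s) +
            (t ** ?SS w v + - (t ** ?S v ** t) ** ?S w))) (at x)" for w
    unfolding gauge_def t_def s_def
    by (intro has_derivative_add mm.FDERIV S' SS T'[unfolded t_def] A)
  then show "(\<lambda>z. gauge \<phi> S T \<eta> z w) differentiable (at x)" unfolding differentiable_def by blast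
  have sym: "?SS w v = ?SS v w" "?DD w v = ?DD v w" for v w
    by (rule symmetric_second_derivative[OF S P] symmetric_second_derivative[OF \<phi> P])+
  have C: "curvature \<eta> (\<phi> x) (?D v) (?D w) = A' w v - A' v w + (?A v ** ?A w - ?A w ** ?A v)"
    unfolding curvature_def ext_deriv_def mat_wedge_def A'_def pullback_def by (simp add: sym(2)[of w v])
  have st: "s ** t = mat 1" unfolding s_def t_def by (rule inv(2)[OF P(2)])
  have st': "X ** s ** t = X" for X :: mat3 using st by (simp flip: matrix_mul_assoc)
  show "curvature (gauge \<phi> S T \<eta>) x v w = T x ** curvature \<eta> (\<phi> x) (?D v) (?D w) ** S x"
    unfolding C unfolding curvature_def ext_deriv_def mat_wedge_def frechet_derivative_at[OF G, symmetric]
    unfolding gauge_def t_def[symmetric] s_def[symmetric]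
    by (simp add: mm.add_left mm.add_right mm.diff_left mm.diff_right mm.minus_left mm.minus_right
        matrix_mul_assoc st' sym(1)[of w v])
qed

text \<open>The adjoint action of the inverse. In the result the entries (2,1), (3,1), (3,2) involve
  only the same entries of \<open>A\<close>, since they represent the quotient by the Lie algebra of
  the group.\<close>

lemma conj_Hmat_entries:
  fixes A :: mat3 and u1 u3 :: real
  assumes "u1 \<noteq> 0" "A $ 1 = 0"
  defines "B \<equiv> Hmat (1 / u1, - u3) ** A ** Hmat (u1, u3)"
  shows "B $ 1 = 0" "B $ 2 $ 1 = A $ 2 $ 1 / u1 + u3 * A $ 3 $ 1" "B $ 3 $ 1 = u1 * A $ 3 $ 1"
    "B $ 3 $ 2 = u1\<^sup>2 * A $ 3 $ 2" "B $ 2 $ 2 = A $ 2 $ 2 + u1 * u3 * A $ 3 $ 2"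
    "B $ 3 $ 3 = A $ 3 $ 3 - u1 * u3 * A $ 3 $ 2"
    "B $ 2 $ 3 = A $ 2 $ 3 / u1\<^sup>2 - u3 / u1 * A $ 2 $ 2 + u3 / u1 * A $ 3 $ 3 - u3\<^sup>2 * A $ 3 $ 2"
  using assms
  by (simp_all add: vec_eq_iff forall_3 mat3_mult_entry Hmat_entries power2_eq_square field_simps)

lemma conj_Hlie:
  assumes "t1 \<noteq> 0"
  shows "Hmat (1 / t1, - t3) ** Hlie a b ** Hmat (t1, t3) = Hlie a (b / t1\<^sup>2 + 2 * a * t3 / t1)"
  by (rule mat3_eqI) (simp_all add: conj_Hmat_entries[OF assms] assms field_simps)

section \<open>Connections on the trivial bundle and their restrictions to the identity
  section\<close>

lemma Hmat_inverse':
  assumes "fst u \<noteq> 0"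
  shows "Hmat u ** Hmat (1 / fst u, - snd u) = mat 1" "Hmat (1 / fst u, - snd u) ** Hmat u = mat 1"
  using Hmat_inverse[OF assms, of "snd u"] by simp_all

lemma open_H_bundle: "open U \<Longrightarrow> open (H_bundle U)"
proof -
  have "open {u::real. u \<noteq> 0}" using open_delete[of UNIV "0::real"] by (simp add: Diff_eq Compl_eq)
  then show "open U \<Longrightarrow> open (H_bundle U)" unfolding H_bundle_def by (intro open_Times open_UNIV)
qed

lemma mem_H_bundle: "b \<in> H_bundle U \<longleftrightarrow> fst b \<in> U \<and> fst (snd b) \<noteq> 0"
  by (cases b) (auto simp: H_bundle_def)

definition lift :: "(jet, mat3) form1 \<Rightarrow> (bpoint, mat3) form1" where
  "lift = gauge fst (\<lambda>b. Hmat (snd b)) (\<lambda>b. Hmat (1 / fst (snd b), - snd (snd b)))"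

lemma has_derivative_Hmat_snd:
  assumes "fst (snd b) \<noteq> 0"
  shows "((\<lambda>b. Hmat (snd b)) has_derivative (\<lambda>v. dHmat (snd b) (snd v))) (at (b :: bpoint))"
proof -
  have "(snd has_derivative snd) (at b)" by (intro derivative_intros)
  from diff_chain_at[OF this, of Hmat, OF has_derivative_Hmat[OF assms]] show ?thesis by (simp add: o_def)
qed

lemma frechet_derivative_fst: "Df fst b = fst"
  by (rule frechet_derivative_at[symmetric]) (intro derivative_intros)

lemma lift_explicit:
  assumes "u1 \<noteq> 0"
  shows "lift \<eta> (q, u1, u3) v = Hmat (1 / u1, - u3) ** \<eta> q (fst v) ** Hmat (u1, u3) +
    Hlie (fst (snd v) / u1) (snd (snd v) / u1 + u3 * fst (snd v) / u1\<^sup>2)"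
  using frechet_derivative_at[OF has_derivative_Hmat_snd[of "(q, u1, u3)"], symmetric] assms
    maurer_cartan_Hmat[OF assms, of u3 "fst (snd v)" "snd (snd v)"]
  by (simp add: lift_def gauge_def pullback_def frechet_derivative_fst)

lemma pullback_id_section: "pullback id_section \<omega> q v = \<omega> (q, 1, 0) (v, 0, 0)"
proof -
  have "(id_section has_derivative (\<lambda>v. (v, 0, 0))) (at q)"
    unfolding id_section_def by (auto intro!: derivative_eq_intros simp: zero_prod_def)
  from frechet_derivative_at[OF this, symmetric] show ?thesis
    by (simp add: pullback_def) (simp add: id_section_def)
qed

lemma pullback_ract: "pullback (\<lambda>z. ract z h) \<omega> b v = \<omega> (ract b h) (ract v h)"
  unfolding pullback_def
  using frechet_derivative_at[OF linear_imp_has_derivative[OF linear_ract, of h "at b"], symmetric] by simp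

text \<open>Equivariance carries every point back to the identity section. There the vertical
  directions are spanned by fundamental fields, on which the connection is prescribed, so only its
  values on vectors tangent to the section remain free.\<close>

lemma cartan_connection_eq_lift:
  assumes \<omega>: "cartan_connection (H_bundle U) ract Hgrp asl2 \<omega>" and b: "b \<in> H_bundle U"
  shows "\<omega> b v = lift (pullback id_section \<omega>) b v"
proof -
  obtain q u1 u3 where bq: "b = (q, u1, u3)" by (cases b)
  obtain x a c where v: "v = (x, a, c)" by (cases v)
  have q: "q \<in> U" and u: "u1 \<noteq> 0" using b by (auto simp: bq mem_H_bundle)
  define b0 :: bpoint where "b0 = (q, 1, 0)"
  define h where "h = Hmat (u1, u3)"
  \<comment> \<open>Chosen so that \<open>ract (x, a', c') h = v\<close>: the fibre part of
    \<open>v\<close> is translated back to \<open>b0\<close>.\<close>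
  define a' where "a' = a / u1"
  define c' where "c' = u1 * c - u3 * a"
  have b0: "b0 \<in> H_bundle U" using q by (simp add: b0_def mem_H_bundle)
  have h: "h \<in> Hgrp" unfolding h_def Hgrp_def using u by blast
  have eq: "\<omega> (ract b0 h) (ract (x, a', c') h) = matrix_inv h ** \<omega> b0 (x, a', c') ** h"
    using \<omega> b0 h unfolding cartan_connection_def pullback_ract by blast
  have lin: "linear (\<omega> b0)" using \<omega> b0 by (auto simp: cartan_connection_def analytic_form1_def)
  have "Hlie a' c' \<in> lie_algebra Hgrp" by (auto simp: lie_algebra_Hgrp)
  then have "\<omega> b0 (0, a', c') = Hlie a' c'"
    using \<omega> b0 fundamental_field_ract[of a' c' q 1 0] unfolding cartan_connection_def b0_def by fastforce
  moreover have "\<omega> b0 ((x, 0, 0) + (0, a', c')) = \<omega> b0 (x, 0, 0) + \<omega> b0 (0, a', c')"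
    by (rule linear_add[OF lin])
  ultimately have 1: "\<omega> b0 (x, a', c') = pullback id_section \<omega> q x + Hlie a' c'"
    by (simp add: pullback_id_section b0_def)
  have "ract b0 h = b" "ract (x, a', c') h = v"
    using u by (simp_all add: b0_def h_def bq v ract_explicit Hmat_entries a'_def c'_def field_simps)
  with eq have "\<omega> b v = Hmat (1 / u1, - u3) ** (pullback id_section \<omega> q x + Hlie a' c') ** Hmat (u1, u3)"
    by (simp add: 1 h_def matrix_inv_Hmat[OF u])
  also have "c' / u1\<^sup>2 + 2 * a' * u3 / u1 = c / u1 + u3 * a / u1\<^sup>2"
    using u by (simp add: a'_def c'_def power2_eq_square field_simps)
  then have "Hmat (1 / u1, - u3) ** (pullback id_section \<omega> q x + Hlie a' c') ** Hmat (u1, u3) =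
      lift (pullback id_section \<omega>) b v"
    unfolding bq v lift_explicit[OF u] by (simp add: mm.add_left mm.add_right conj_Hlie[OF u] a'_def)
  finally show ?thesis .
qed

lemma real_analytic_at_vec:
  fixes f :: "'a::euclidean_space \<Rightarrow> 'b::euclidean_space ^ 'n"
  assumes "\<And>i. real_analytic_at (\<lambda>x. f x $ i) a"
  shows "real_analytic_at f a"
  using assms by (subst real_analytic_at_componentwise)
    (auto simp: Basis_vec_def inner_axis real_analytic_at_componentwise[of "\<lambda>x. f x $ _"])

lemma real_analytic_at_vec_nth:
  fixes f :: "'a::euclidean_space \<Rightarrow> 'b::euclidean_space ^ 'n"
  shows "real_analytic_at f a \<Longrightarrow> real_analytic_at (\<lambda>x. f x $ i) a"
  by (rule real_analytic_at_linear) (simp_all add: linear_iff)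

lemma real_analytic_at_Pair:
  assumes "real_analytic_at f a" "real_analytic_at g a"
  shows "real_analytic_at (\<lambda>x. (f x, g x)) a"
proof -
  have "real_analytic_at (\<lambda>x. (f x, 0) + (0, g x)) a"
    using assms by (intro real_analytic_at_add
      real_analytic_at_linear[of "\<lambda>y. (y, 0)"] real_analytic_at_linear[of "\<lambda>y. (0, y)"]) (auto simp: linear_iff)
  then show ?thesis by simp
qed

lemma real_analytic_at_mat3:
  fixes A :: "'a::euclidean_space \<Rightarrow> mat3"
  assumes "\<And>i j. real_analytic_at (\<lambda>x. A x $ i $ j) a"
  shows "real_analytic_at A a"
  by (intro real_analytic_at_vec assms)

lemma real_analytic_at_mat_mult:
  fixes A B :: "'a::euclidean_space \<Rightarrow> mat3"
  assumes "real_analytic_at A a" "real_analytic_at B a"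
  shows "real_analytic_at (\<lambda>x. A x ** B x) a"
  by (intro real_analytic_at_mat3)
    (simp add: mat3_mult_entry, intro real_analytic_at_add real_analytic_at_mult real_analytic_at_vec_nth assms)

lemma real_analytic_at_Hmat:
  assumes "real_analytic_at f a" "real_analytic_at g a" "real_analytic_at (\<lambda>x. 1 / f x) a"
  shows "real_analytic_at (\<lambda>x. Hmat (f x, g x)) a"
proof (rule real_analytic_at_mat3)
  have "\<forall>i j. real_analytic_at (\<lambda>x. Hmat (f x, g x) $ i $ j) a"
    unfolding forall_3 using assms by (simp add: Hmat_entries real_analytic_at_uminus)
  then show "real_analytic_at (\<lambda>x. Hmat (f x, g x) $ i $ j) a" for i j by blast
qed

lemma real_analytic_at_Hlie:
  assumes "real_analytic_at f a" "real_analytic_at g a"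
  shows "real_analytic_at (\<lambda>x. Hlie (f x) (g x)) a"
proof (rule real_analytic_at_mat3)
  have "\<forall>i j. real_analytic_at (\<lambda>x. Hlie (f x) (g x) $ i $ j) a"
    unfolding forall_3 using assms by (simp add: real_analytic_at_uminus)
  then show "real_analytic_at (\<lambda>x. Hlie (f x) (g x) $ i $ j) a" for i j by blast
qed

lemma real_analytic_at_fst_compose:
  fixes f :: "'a::euclidean_space \<Rightarrow> 'c::euclidean_space" and b :: "'a \<times> 'b::euclidean_space"
  assumes "real_analytic_at f (fst b)"
  shows "real_analytic_at (\<lambda>z. f (fst z)) b"
  by (rule real_analytic_at_compose_coords[where J = Basis and \<sigma> = "\<lambda>b. (b, 0)"])
    (use assms in \<open>auto simp: inj_on_def Basis_prod_def inner_prod_def\<close>)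

lemma real_analytic_at_fst_snd: "real_analytic_at (\<lambda>z :: bpoint. fst (snd z)) b"
  by (rule real_analytic_at_linear_self) (simp add: linear_iff)

lemma real_analytic_at_snd_snd: "real_analytic_at (\<lambda>z :: bpoint. snd (snd z)) b"
  by (rule real_analytic_at_linear_self) (simp add: linear_iff)

lemma real_analytic_at_inverse_u1:
  assumes "fst (snd b) \<noteq> 0"
  shows "real_analytic_at (\<lambda>z :: bpoint. 1 / fst (snd z)) b"
proof -
  have "real_analytic_at (\<lambda>z :: bpoint. inverse (fst (snd z))) b"
    by (rule real_analytic_at_compose_coords[where J = "{1}" and \<sigma> = "\<lambda>_. (0, 1, 0)"])
      (use assms in \<open>auto simp: Basis_prod_def inner_prod_def intro: real_analytic_at_inverse_real\<close>)
  then show ?thesis by (simp add: inverse_eq_divide)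
qed

lemma real_analytic_at_id_section_compose:
  fixes f :: "bpoint \<Rightarrow> 'c::euclidean_space"
  assumes "real_analytic_at f (q, 1, 0)"
  shows "real_analytic_at (\<lambda>q. f (q, 1, 0)) q"
  by (rule real_analytic_at_compose_coords[where J = "(\<lambda>b. (b, 0)) ` Basis" and \<sigma> = fst and g = "\<lambda>q. (q, 1, 0)"])
    (use assms in \<open>auto simp: inj_on_def Basis_prod_def inner_prod_def\<close>)

lemma analytic_form1_pullback_id_section:
  assumes "analytic_form1 \<omega> (H_bundle U)"
  shows "analytic_form1 (pullback id_section \<omega>) U"
  unfolding analytic_form1_def pullback_id_section
proof (intro conjI ballI allI)
  fix q assume "q \<in> U"
  then have b: "(q, 1, 0) \<in> H_bundle U" by (simp add: mem_H_bundle)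
  then have "linear (\<omega> (q, 1, 0))" using assms by (simp add: analytic_form1_def)
  moreover have "linear (\<lambda>v :: jet. (v, 0 :: real, 0 :: real))" by (simp add: linear_iff)
  ultimately show "linear (\<lambda>v. \<omega> (q, 1, 0) (v, 0, 0))"
    using linear_compose[of "\<lambda>v. (v, 0, 0)" "\<omega> (q, 1, 0)"] by (simp add: o_def)
next
  fix v show "real_analytic_on (\<lambda>q. \<omega> (q, 1, 0) (v, 0, 0)) U"
    using assms unfolding real_analytic_on_def analytic_form1_def
    by (auto intro!: real_analytic_at_id_section_compose simp: mem_H_bundle)
qed

lemma analytic_form1_lift:
  assumes U: "open U" and \<eta>: "analytic_form1 \<eta> U"
  shows "analytic_form1 (lift \<eta>) (H_bundle U)"
proof -
  let ?L = "\<lambda>(b :: bpoint) v. Hmat (1 / fst (snd b), - snd (snd b)) ** \<eta> (fst b) (fst v) ** Hmat (fst (snd b), snd (snd b)) +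
    Hlie (fst (snd v) / fst (snd b)) (snd (snd v) / fst (snd b) + snd (snd b) * fst (snd v) / (fst (snd b))\<^sup>2)"
  have L: "lift \<eta> b v = ?L b v" if "b \<in> H_bundle U" for b v
    using that lift_explicit[of "fst (snd b)" \<eta> "fst b" "snd (snd b)" v] by (simp add: mem_H_bundle)
  show ?thesis unfolding analytic_form1_def
  proof (intro conjI ballI allI)
    fix b assume b: "b \<in> H_bundle U"
    then have "linear (\<eta> (fst b))" using \<eta> by (auto simp: analytic_form1_def mem_H_bundle)
    moreover have "fst differentiable (at b)" "(\<lambda>b. Hmat (snd b)) differentiable (at b)"
      using has_derivative_Hmat_snd[of b] has_derivative_fst[OF has_derivative_ident] b
      by (auto simp: differentiable_def mem_H_bundle)
    ultimately show "linear (lift \<eta> b)" unfolding lift_def by (rule linear_gauge)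
  next
    fix v
    have "real_analytic_at (\<lambda>b. ?L b v) b" if b: "b \<in> H_bundle U" for b
    proof -
      have q: "fst b \<in> U" and u: "fst (snd b) \<noteq> 0" using b by (auto simp: mem_H_bundle)
      have e: "real_analytic_at (\<lambda>b. \<eta> (fst b) (fst v)) b"
        using \<eta> q by (intro real_analytic_at_fst_compose) (auto simp: analytic_form1_def real_analytic_on_def)
      note i = real_analytic_at_inverse_u1[OF u]
      note c = real_analytic_at_mult[OF real_analytic_at_const]
      have i1: "real_analytic_at (\<lambda>b :: bpoint. k / fst (snd b)) b" for k
        using c[OF i, of k] by simp
      have i2: "real_analytic_at (\<lambda>b :: bpoint. snd (snd b) * k / (fst (snd b))\<^sup>2) b" for k
        using real_analytic_at_mult[OF real_analytic_at_snd_snd real_analytic_at_mult[OF i i1], of k]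
        by (simp add: power2_eq_square)
      show ?thesis
        by (intro real_analytic_at_add real_analytic_at_mat_mult real_analytic_at_Hmat real_analytic_at_Hlie e
            real_analytic_at_uminus i i1 i2 real_analytic_at_fst_snd real_analytic_at_snd_snd)
          (simp add: real_analytic_at_fst_snd)
    qed
    then show "real_analytic_on (\<lambda>b. lift \<eta> b v) (H_bundle U)"
      using L by (subst real_analytic_on_cong[OF open_H_bundle[OF U]]) (auto simp: real_analytic_on_def)
  qed
qed

text \<open>By the coframe condition \<open>\<eta> q\<close> is injective modulo the Lie algebra of
  the group, hence bijective onto the 3-dimensional quotient; the Maurer-Cartan term fills the
  remaining 2 dimensions.\<close>

lemma cartan_connection_lift:
  assumes U: "open U" and \<eta>: "analytic_form1 \<eta> U"
    and asl: "\<And>q v. q \<in> U \<Longrightarrow> \<eta> q v \<in> asl2"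
    and coframe: "\<And>q v. q \<in> U \<Longrightarrow> \<eta> q v $ 2 $ 1 = 0 \<Longrightarrow> \<eta> q v $ 3 $ 1 = 0 \<Longrightarrow> \<eta> q v $ 3 $ 2 = 0 \<Longrightarrow> v = 0"
  shows "cartan_connection (H_bundle U) ract Hgrp asl2 (lift \<eta>)"
  unfolding cartan_connection_def
proof (intro conjI ballI allI)
  show an: "analytic_form1 (lift \<eta>) (H_bundle U)" by (rule analytic_form1_lift[OF U \<eta>])
  fix b assume b: "b \<in> H_bundle U"
  obtain q u1 u3 where bq: "b = (q, u1, u3)" by (cases b)
  have q: "q \<in> U" and u: "u1 \<noteq> 0" using b by (auto simp: bq mem_H_bundle)
  have l\<eta>: "linear (\<eta> q)" using \<eta> q by (auto simp: analytic_form1_def)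
  have row1: "\<eta> q x $ 1 = 0" and tr: "\<eta> q x $ 3 $ 3 = - \<eta> q x $ 2 $ 2" for x
    using asl[OF q, of x] by (auto simp: asl2_def eq_neg_iff_add_eq_0 add.commute)
  let ?B = "\<lambda>x. Hmat (1 / u1, - u3) ** \<eta> q x ** Hmat (u1, u3)"
  note B = conj_Hmat_entries[OF u row1]
  note ex = lift_explicit[OF u, of \<eta> q u3]
  {
    fix X assume "X \<in> lie_algebra Hgrp"
    then obtain a c where X: "X = Hlie a c" by (auto simp: lie_algebra_Hgrp)
    have e: "u1 * a / u1 = a" "(u1 * c - u3 * a) / u1 + u3 * (u1 * a) / u1\<^sup>2 = c"
      using u by (simp_all add: power2_eq_square field_simps)
    have "lift \<eta> b (0, u1 * a, u1 * c - u3 * a) = X"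
      unfolding bq ex X fst_conv snd_conv e by (simp add: linear_0[OF l\<eta>] mm.zero_left mm.zero_right)
    then show "lift \<eta> b (fundamental_field ract X b) = X" by (simp add: X bq fundamental_field_ract)
  }
  {
    fix h and v :: bpoint assume "h \<in> Hgrp"
    then obtain t1 t3 where h: "h = Hmat (t1, t3)" and t: "t1 \<noteq> 0" by (auto simp: Hgrp_def)
    obtain x a c where v: "v = (x, a, c)" by (cases v)
    have ut: "u1 * t1 \<noteq> 0" using u t by simp
    have r: "ract b h = (q, u1 * t1, u1 * t3 + u3 / t1)" "ract v h = (x, a * t1, a * t3 + c / t1)"
      by (simp_all add: bq v h ract_explicit Hmat_entries)
    have H: "Hmat (u1 * t1, u1 * t3 + u3 / t1) = Hmat (u1, u3) ** Hmat (t1, t3)"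
      using Hmat_mult[OF u t] by simp
    have H': "Hmat (1 / (u1 * t1), - (u1 * t3 + u3 / t1)) = Hmat (1 / t1, - t3) ** Hmat (1 / u1, - u3)"
    proof -
      have "- (u1 * t3 + u3 / t1) = 1 / t1 * - u3 + - t3 / (1 / u1)" using u t by (simp add: field_simps)
      then show ?thesis using u t by (subst Hmat_mult) (simp_all add: algebra_simps)
    qed
    \<comment> \<open>The left sides are the Maurer-Cartan components at the translated point, the
      right sides what \<open>conj_Hlie\<close> makes of the components at \<open>b\<close>.\<close>
    have e: "a * t1 / (u1 * t1) = a / u1"
      "(a * t3 + c / t1) / (u1 * t1) + (u1 * t3 + u3 / t1) * (a * t1) / (u1 * t1)\<^sup>2 =
        (c / u1 + u3 * a / u1\<^sup>2) / t1\<^sup>2 + 2 * (a / u1) * t3 / t1"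
      using u t by (simp_all add: power2_eq_square field_simps)
    have "lift \<eta> (ract b h) (ract v h) = Hmat (1 / t1, - t3) ** lift \<eta> b v ** Hmat (t1, t3)"
      unfolding r unfolding bq lift_explicit[OF ut] ex H H' fst_conv snd_conv v mm.add_left mm.add_right conj_Hlie[OF t] matrix_mul_assoc
      by (simp only: e)
    then show "pullback (\<lambda>z. ract z h) (lift \<eta>) b v = matrix_inv h ** lift \<eta> b v ** h"
      by (simp add: pullback_ract h matrix_inv_Hmat[OF t])
  }
  have lin: "linear (lift \<eta> b)" using an b by (auto simp: analytic_form1_def)
  show "bij_betw (lift \<eta> b) UNIV asl2"
  proof (rule bij_betw_imageI)
    show "inj (lift \<eta> b)"
      unfolding linear_injective_0[OF lin]
    proof (intro allI impI)
      fix v :: bpoint assume 0: "lift \<eta> b v = 0"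
      obtain x a c where v: "v = (x, a, c)" by (cases v)
      have E: "?B x + Hlie (a / u1) (c / u1 + u3 * a / u1\<^sup>2) = 0" using 0 by (simp add: bq ex v)
      have "(?B x + Hlie (a / u1) (c / u1 + u3 * a / u1\<^sup>2)) $ i $ j = 0" for i j unfolding E by simp
      from this[of 2 1] this[of 3 1] this[of 3 2] have "x = 0"
        using u by (intro coframe[OF q]) (auto simp: B)
      with E have "Hlie (a / u1) (c / u1 + u3 * a / u1\<^sup>2) = 0"
        by (simp add: linear_0[OF l\<eta>] mm.zero_left mm.zero_right)
      from arg_cong[OF this, of "\<lambda>M. M $ 2 $ 2"] arg_cong[OF this, of "\<lambda>M. M $ 2 $ 3"]
      have "a = 0" "c = 0" using u by auto
      with \<open>x = 0\<close> show "v = 0" by (simp add: v zero_prod_def)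
    qed
    show "range (lift \<eta> b) = asl2"
    proof (intro subset_antisym subsetI)
      fix X assume "X \<in> range (lift \<eta> b)"
      then obtain x a c where X: "X = lift \<eta> b (x, a, c)" by (metis imageE surj_pair)
      show "X \<in> asl2" unfolding X bq ex asl2_def by (simp add: B tr)
    next
      fix X assume X: "X \<in> asl2"
      define L :: "jet \<Rightarrow> real^3" where "L x = vector [\<eta> q x $ 2 $ 1, \<eta> q x $ 3 $ 1, \<eta> q x $ 3 $ 2]" for x
      have "linear L"
        by (rule linearI) (simp_all add: L_def vec_eq_iff forall_3 linear_add[OF l\<eta>] linear_scale[OF l\<eta>])
      moreover have "inj L"
        unfolding linear_injective_0[OF \<open>linear L\<close>] using coframe[OF q] by (auto simp: L_def vec_eq_iff forall_3)
      ultimately have "surj L" by (rule linear_injective_imp_surjective) simp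
      \<comment> \<open>The right hand side inverts the formulas of
        \<open>conj_Hmat_entries\<close>, so that the conjugate of \<open>\<eta> q x\<close> has the
        three prescribed entries of \<open>X\<close>.\<close>
      then obtain x where x: "L x = vector [u1 * (X $ 2 $ 1 - u3 * X $ 3 $ 1 / u1), X $ 3 $ 1 / u1, X $ 3 $ 2 / u1\<^sup>2]"
        by (metis surjD)
      then have e: "\<eta> q x $ 2 $ 1 = u1 * (X $ 2 $ 1 - u3 * X $ 3 $ 1 / u1)" "\<eta> q x $ 3 $ 1 = X $ 3 $ 1 / u1"
        "\<eta> q x $ 3 $ 2 = X $ 3 $ 2 / u1\<^sup>2"
        by (simp_all add: L_def vec_eq_iff forall_3)
      \<comment> \<open>The discrepancy in the remaining entries lies in the Lie algebra of the
        group and is supplied by the fibre direction.\<close>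
      define y1 where "y1 = X $ 2 $ 2 - ?B x $ 2 $ 2"
      define y2 where "y2 = ?B x $ 2 $ 3 - X $ 2 $ 3"
      have "X = ?B x + Hlie y1 y2"
        using u X by (intro mat3_eqI)
          (simp_all add: B(1-4) e asl2_def eq_neg_iff_add_eq_0, simp_all add: y1_def y2_def B(5,6) tr e)
      also have "\<dots> = lift \<eta> b (x, u1 * y1, u1 * y2 - u3 * y1)"
      proof -
        have e: "u1 * y1 / u1 = y1" "(u1 * y2 - u3 * y1) / u1 + u3 * (u1 * y1) / u1\<^sup>2 = y2"
          using u by (simp_all add: power2_eq_square field_simps)
        show ?thesis unfolding bq ex fst_conv snd_conv e ..
      qed
      finally show "X \<in> range (lift \<eta> b)" by blast
    qed
  qed
qed

section \<open>The normal form\<close>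

lemma partial_eq_frechet:
  fixes g :: "real^'n \<Rightarrow> real"
  assumes "g differentiable (at q)"
  shows "partial i g q = Df g q (axis i 1)"
proof -
  let ?D = "Df g q"
  have "(g has_derivative ?D) (at (q + 0 *\<^sub>R axis i 1))" using assms frechet_derivative_works by auto
  moreover have "((\<lambda>t. q + t *\<^sub>R axis i 1) has_derivative (\<lambda>t. t *\<^sub>R axis i 1)) (at 0)"
    by (auto intro!: derivative_eq_intros)
  ultimately have "((\<lambda>t. g (q + t *\<^sub>R axis i 1)) has_derivative (\<lambda>t. ?D (t *\<^sub>R axis i 1))) (at 0)"
    using diff_chain_at[of "\<lambda>t. q + t *\<^sub>R axis i 1" _ 0 g ?D] by (simp add: o_def)
  then have "((\<lambda>t. g (q + t *\<^sub>R axis i 1)) has_real_derivative ?D (axis i 1)) (at 0)"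
    by (rule has_derivative_imp_has_field_derivative)
      (simp add: linear_scale[OF linear_frechet_derivative[OF assms]])
  then show ?thesis unfolding partial_def by (rule DERIV_imp_deriv)
qed

lemma frechet_eq_partials:
  fixes g :: "jet \<Rightarrow> real"
  assumes "g differentiable (at q)"
  shows "Df g q v = d_x g q * v $ 1 + d_y g q * v $ 2 + d_p g q * v $ 3"
proof -
  have l: "linear (Df g q)" by (rule linear_frechet_derivative[OF assms])
  have "v = v $ 1 *\<^sub>R axis 1 1 + v $ 2 *\<^sub>R axis 2 1 + v $ 3 *\<^sub>R axis 3 1"
    by (simp add: vec_eq_iff forall_3 axis_def)
  then have "Df g q v =
    Df g q (v $ 1 *\<^sub>R axis 1 1 + v $ 2 *\<^sub>R axis 2 1 + v $ 3 *\<^sub>R axis 3 1)" by simp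
  then show ?thesis by (simp add: linear_add[OF l] linear_scale[OF l] partial_eq_frechet[OF assms] mult.commute)
qed

lemma has_derivative_partials:
  fixes g :: "jet \<Rightarrow> real"
  assumes "g differentiable (at q)"
  shows "(g has_derivative (\<lambda>v. d_x g q * v $ 1 + d_y g q * v $ 2 + d_p g q * v $ 3)) (at q)"
proof -
  have "Df g q = (\<lambda>v. d_x g q * v $ 1 + d_y g q * v $ 2 + d_p g q * v $ 3)"
    by (rule ext) (rule frechet_eq_partials[OF assms])
  then show ?thesis using assms frechet_derivative_works[of g "at q"] by simp
qed

lemma partial_cong_open:
  assumes "open V" "q \<in> V" "\<And>z. z \<in> V \<Longrightarrow> g z = h z"
  shows "partial i g q = partial i h q"
proof -
  have "continuous_on UNIV (\<lambda>t::real. q + t *\<^sub>R axis i 1)" by (intro continuous_intros)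
  then have "open ((\<lambda>t::real. q + t *\<^sub>R axis i 1) -` V)" using assms(1) by (rule open_vimage[rotated])
  then have "eventually (\<lambda>t. t \<in> (\<lambda>t::real. q + t *\<^sub>R axis i 1) -` V) (nhds 0)"
    using assms(2) by (intro eventually_nhds_in_open) auto
  then have "eventually (\<lambda>t. g (q + t *\<^sub>R axis i 1) = h (q + t *\<^sub>R axis i 1)) (nhds 0)"
    by eventually_elim (simp add: assms(3))
  then show ?thesis unfolding partial_def by (rule deriv_cong_ev) simp
qed

lemma partial_cmult:
  fixes g :: "jet \<Rightarrow> real"
  assumes "g differentiable (at q)"
  shows "partial i (\<lambda>z. k * g z) q = k * partial i g q"
proof -
  have d: "((\<lambda>z. k * g z) has_derivative (\<lambda>v. k * Df g q v)) (at q)"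
    using assms frechet_derivative_works by (intro derivative_intros) blast
  then have "(\<lambda>z. k * g z) differentiable (at q)" unfolding differentiable_def by blast
  from partial_eq_frechet[OF this] partial_eq_frechet[OF assms] show ?thesis
    by (simp flip: frechet_derivative_at[OF d])
qed

lemma real_analytic_on_partial:
  fixes g :: "real^'n \<Rightarrow> real"
  assumes "real_analytic_on g V" "open V"
  shows "real_analytic_on (partial i g) V"
proof -
  have "partial i g z = Df g z (axis i 1)" if "z \<in> V" for z
    using that assms by (intro partial_eq_frechet real_analytic_at_differentiable) (auto simp: real_analytic_on_def)
  then have "real_analytic_on (partial i g) V \<longleftrightarrow> real_analytic_on (\<lambda>z. Df g z (axis i 1)) V"
    by (rule real_analytic_on_cong[OF assms(2)])
  then show ?thesis using real_analytic_on_frechet_derivative[OF assms] by simp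
qed

section \<open>Torsion-free connection forms and their curvature\<close>

text \<open>The general solution of the torsion equations, with \<open>\<kappa>\<close> the contact
  form. The function \<open>c\<close> occurs twice because \<open>\<eta>\<^sup>1\<^sub>1 \<and> dx +
  \<eta>\<^sup>1\<^sub>2 \<and> \<kappa>\<close> has to vanish; the coefficient
  \<open>- \<mu>\<close> is forced by the other torsion component.\<close>

definition conn_form ::
    "(jet \<Rightarrow> real) \<Rightarrow> (jet \<Rightarrow> real) \<Rightarrow> (jet \<Rightarrow> real) \<Rightarrow> (jet \<Rightarrow> real) \<Rightarrow> (jet, mat3) form1" where
  "conn_form f \<mu> c e q v =
     (let \<kappa> = v $ 2 - q $ 3 * v $ 1; \<alpha> = - \<mu> q * v $ 1 + c q * \<kappa> in
      vector [vector [0, 0, 0],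
              vector [v $ 1, \<alpha>, c q * v $ 1 + e q * \<kappa>],
              vector [\<kappa>, v $ 3 - f q * v $ 1 + \<mu> q * \<kappa>, - \<alpha>]])"

lemma conn_form_entries:
  "conn_form f \<mu> c e q v $ 1 = 0"
  "conn_form f \<mu> c e q v $ 2 $ 1 = v $ 1"
  "conn_form f \<mu> c e q v $ 2 $ 2 = - \<mu> q * v $ 1 + c q * (v $ 2 - q $ 3 * v $ 1)"
  "conn_form f \<mu> c e q v $ 2 $ 3 = c q * v $ 1 + e q * (v $ 2 - q $ 3 * v $ 1)"
  "conn_form f \<mu> c e q v $ 3 $ 1 = v $ 2 - q $ 3 * v $ 1"
  "conn_form f \<mu> c e q v $ 3 $ 2 = v $ 3 - f q * v $ 1 + \<mu> q * (v $ 2 - q $ 3 * v $ 1)"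
  "conn_form f \<mu> c e q v $ 3 $ 3 = \<mu> q * v $ 1 - c q * (v $ 2 - q $ 3 * v $ 1)"
  by (simp_all add: conn_form_def Let_def vec_eq_iff forall_3)

lemma linear_conn_form: "linear (conn_form f \<mu> c e q)"
  by (rule linearI; rule mat3_eqI) (simp_all add: conn_form_entries algebra_simps)

lemma ext_deriv_entry:
  assumes "diff_form1 \<eta> V" "q \<in> V"
  shows "ext_deriv \<eta> q v w $ i $ j = ext_deriv (entry \<eta> i j) q v w"
proof -
  have "Df (\<lambda>z. \<eta> z w $ i $ j) q v = Df (\<lambda>z. \<eta> z w) q v $ i $ j" for v w
  proof -
    have d: "((\<lambda>z. \<eta> z w) has_derivative Df (\<lambda>z. \<eta> z w) q) (at q)"
      using assms frechet_derivative_works by (auto simp: diff_form1_def)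
    have "((\<lambda>z. \<eta> z w $ i $ j) has_derivative (\<lambda>v. Df (\<lambda>z. \<eta> z w) q v $ i $ j)) (at q)"
      by (intro bounded_linear.has_derivative[OF bounded_linear_vec_nth] d)
    from fun_cong[OF frechet_derivative_at[OF this]] show ?thesis by simp
  qed
  then show ?thesis by (simp add: ext_deriv_def entry_def[abs_def])
qed

lemma curvature_entry:
  assumes "diff_form1 \<eta> V" "q \<in> V"
  shows "curvature \<eta> q v w $ i $ j = ext_deriv (entry \<eta> i j) q v w +
    (\<eta> q v $ i $ 1 * \<eta> q w $ 1 $ j + \<eta> q v $ i $ 2 * \<eta> q w $ 2 $ j + \<eta> q v $ i $ 3 * \<eta> q w $ 3 $ j) -
    (\<eta> q w $ i $ 1 * \<eta> q v $ 1 $ j + \<eta> q w $ i $ 2 * \<eta> q v $ 2 $ j + \<eta> q w $ i $ 3 * \<eta> q v $ 3 $ j)"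
  by (simp add: curvature_def mat_wedge_def mat3_mult_entry ext_deriv_entry[OF assms])

lemma frechet_derivative_cong_open:
  assumes "open V" "q \<in> V" "\<And>z. z \<in> V \<Longrightarrow> g z = h z"
  shows "Df g q = Df h q"
proof -
  have "(g has_derivative D) (at q) \<longleftrightarrow> (h has_derivative D) (at q)" for D
    by (rule iffI; erule has_derivative_transform_within_open[OF _ assms(1,2)]) (simp_all add: assms(3))
  then show ?thesis by (simp add: frechet_derivative_def)
qed

lemma ext_deriv_cong_open:
  assumes "open V" "q \<in> V" "\<And>z v. z \<in> V \<Longrightarrow> \<eta> z v = \<eta>' z v"
  shows "ext_deriv \<eta> q v w = ext_deriv \<eta>' q v w"
proof -
  have "Df (\<lambda>z. \<eta> z w) q = Df (\<lambda>z. \<eta>' z w) q" for w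
    by (rule frechet_derivative_cong_open[OF assms(1,2)]) (rule assms(3))
  then show ?thesis by (simp add: ext_deriv_def)
qed

lemma curvature_cong_open:
  assumes "open V" "q \<in> V" "\<And>z v. z \<in> V \<Longrightarrow> \<eta> z v = \<eta>' z v"
  shows "curvature \<eta> q v w = curvature \<eta>' q v w"
  using ext_deriv_cong_open[OF assms] assms(2,3) by (simp add: curvature_def mat_wedge_def)

lemma ext_deriv_of_derivative:
  assumes "\<And>w. ((\<lambda>z. \<eta> z w) has_derivative D w) (at q)"
  shows "ext_deriv \<eta> q v w = D w v - D v w"
  by (simp add: ext_deriv_def flip: frechet_derivative_at[OF assms])

lemma diff_form1_conn_form:
  assumes "\<And>q. q \<in> V \<Longrightarrow> f differentiable (at q)" "\<And>q. q \<in> V \<Longrightarrow> \<mu> differentiable (at q)"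
    "\<And>q. q \<in> V \<Longrightarrow> c differentiable (at q)" "\<And>q. q \<in> V \<Longrightarrow> e differentiable (at q)"
  shows "diff_form1 (conn_form f \<mu> c e) V"
  unfolding diff_form1_def
proof (intro ballI conjI allI linear_conn_form)
  fix q v assume q: "q \<in> V"
  have k: "(\<lambda>z :: jet. z $ 3) differentiable (at q)"
    by (rule bounded_linear_imp_differentiable[OF bounded_linear_vec_nth])
  have "\<forall>i j. (\<lambda>z. conn_form f \<mu> c e z v $ i $ j) differentiable (at q)"
    unfolding forall_3 conn_form_entries zero_index
    by (intro conjI differentiable_add differentiable_diff differentiable_minus differentiable_mult
        differentiable_const assms[OF q] k)
  then have "((\<lambda>z. conn_form f \<mu> c e z v) has_derivative
      (\<lambda>h. \<chi> i j. Df (\<lambda>z. conn_form f \<mu> c e z v $ i $ j) q h)) (at q)"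
    by (intro has_derivative_mat3) (simp flip: frechet_derivative_works)
  then show "(\<lambda>z. conn_form f \<mu> c e z v) differentiable (at q)" unfolding differentiable_def by blast
qed

text \<open>Here \<open>d g\<close> is the differential of \<open>g\<close> at \<open>q\<close>. The
  terms with \<open>v $ 3 * w $ 1\<close> arise from the contact form, whose coefficient
  \<open>p\<close> is not constant.\<close>

lemma ext_deriv_conn_form:
  assumes "f differentiable (at q)" "\<mu> differentiable (at q)" "c differentiable (at q)" "e differentiable (at q)"
  defines "d g v \<equiv> d_x g q * v $ 1 + d_y g q * v $ 2 + d_p g q * v $ 3"
    and "\<kappa> v \<equiv> v $ 2 - q $ 3 * v $ 1"
  shows "ext_deriv (entry (conn_form f \<mu> c e) 1 j) q v w = 0"
    "ext_deriv (entry (conn_form f \<mu> c e) 2 1) q v w = 0"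
    "ext_deriv (entry (conn_form f \<mu> c e) 3 1) q v w = v $ 1 * w $ 3 - v $ 3 * w $ 1"
    "ext_deriv (entry (conn_form f \<mu> c e) 2 2) q v w =
       (- d \<mu> v * w $ 1 + d c v * \<kappa> w - c q * v $ 3 * w $ 1) - (- d \<mu> w * v $ 1 + d c w * \<kappa> v - c q * w $ 3 * v $ 1)"
    "ext_deriv (entry (conn_form f \<mu> c e) 3 3) q v w =
       - ((- d \<mu> v * w $ 1 + d c v * \<kappa> w - c q * v $ 3 * w $ 1) - (- d \<mu> w * v $ 1 + d c w * \<kappa> v - c q * w $ 3 * v $ 1))"
    "ext_deriv (entry (conn_form f \<mu> c e) 2 3) q v w =
       (d c v * w $ 1 + d e v * \<kappa> w - e q * v $ 3 * w $ 1) - (d c w * v $ 1 + d e w * \<kappa> v - e q * w $ 3 * v $ 1)"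
    "ext_deriv (entry (conn_form f \<mu> c e) 3 2) q v w =
       (- d f v * w $ 1 + d \<mu> v * \<kappa> w - \<mu> q * v $ 3 * w $ 1) - (- d f w * v $ 1 + d \<mu> w * \<kappa> v - \<mu> q * w $ 3 * v $ 1)"
proof -
  note D = assms(1-4)[THEN has_derivative_partials, folded d_def]
  have k: "((\<lambda>z :: jet. z $ 3) has_derivative (\<lambda>v. v $ 3)) (at q)"
    by (rule bounded_linear_imp_has_derivative[OF bounded_linear_vec_nth])
  note E = entry_def[abs_def] conn_form_entries
  note I = derivative_eq_intros D k
  show "ext_deriv (entry (conn_form f \<mu> c e) 1 j) q v w = 0"
    by (subst ext_deriv_of_derivative[where D = "\<lambda>w v. 0"]) (auto simp: E)
  show "ext_deriv (entry (conn_form f \<mu> c e) 2 1) q v w = 0"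
    by (subst ext_deriv_of_derivative[where D = "\<lambda>w v. 0"]) (auto simp: E)
  show "ext_deriv (entry (conn_form f \<mu> c e) 3 1) q v w = v $ 1 * w $ 3 - v $ 3 * w $ 1"
    by (subst ext_deriv_of_derivative[where D = "\<lambda>w v. - v $ 3 * w $ 1"]) (auto simp: E intro!: I)
  show "ext_deriv (entry (conn_form f \<mu> c e) 2 2) q v w =
       (- d \<mu> v * w $ 1 + d c v * \<kappa> w - c q * v $ 3 * w $ 1) - (- d \<mu> w * v $ 1 + d c w * \<kappa> v - c q * w $ 3 * v $ 1)"
    by (subst ext_deriv_of_derivative[where D = "\<lambda>w v. - d \<mu> v * w $ 1 + d c v * \<kappa> w - c q * v $ 3 * w $ 1"])
      (auto simp: E \<kappa>_def intro!: I simp: algebra_simps)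
  show "ext_deriv (entry (conn_form f \<mu> c e) 3 3) q v w =
       - ((- d \<mu> v * w $ 1 + d c v * \<kappa> w - c q * v $ 3 * w $ 1) - (- d \<mu> w * v $ 1 + d c w * \<kappa> v - c q * w $ 3 * v $ 1))"
    by (subst ext_deriv_of_derivative[where D = "\<lambda>w v. - (- d \<mu> v * w $ 1 + d c v * \<kappa> w - c q * v $ 3 * w $ 1)"])
      (auto simp: E \<kappa>_def intro!: I simp: algebra_simps)
  show "ext_deriv (entry (conn_form f \<mu> c e) 2 3) q v w =
       (d c v * w $ 1 + d e v * \<kappa> w - e q * v $ 3 * w $ 1) - (d c w * v $ 1 + d e w * \<kappa> v - e q * w $ 3 * v $ 1)"
    by (subst ext_deriv_of_derivative[where D = "\<lambda>w v. d c v * w $ 1 + d e v * \<kappa> w - e q * v $ 3 * w $ 1"])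
      (auto simp: E \<kappa>_def intro!: I simp: algebra_simps)
  show "ext_deriv (entry (conn_form f \<mu> c e) 3 2) q v w =
       (- d f v * w $ 1 + d \<mu> v * \<kappa> w - \<mu> q * v $ 3 * w $ 1) - (- d f w * v $ 1 + d \<mu> w * \<kappa> v - \<mu> q * w $ 3 * v $ 1)"
    by (subst ext_deriv_of_derivative[where D = "\<lambda>w v. - d f v * w $ 1 + d \<mu> v * \<kappa> w - \<mu> q * v $ 3 * w $ 1"])
      (auto simp: E \<kappa>_def intro!: I simp: algebra_simps)
qed

definition mu_of :: "(jet \<Rightarrow> real) \<Rightarrow> jet \<Rightarrow> real" where
  "mu_of f = (\<lambda>q. (- 1 / 3) * d_p f q)"

definition normal_form :: "(jet \<Rightarrow> real) \<Rightarrow> (jet, mat3) form1" where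
  "normal_form f = conn_form f (mu_of f) (\<lambda>q. (1 / 6) * d_p (d_p f) q) (\<lambda>q. (1 / 6) * d_p (d_p (d_p f)) q)"

lemma real_analytic_on_cmult:
  fixes g :: "'a::euclidean_space \<Rightarrow> real"
  shows "real_analytic_on g V \<Longrightarrow> real_analytic_on (\<lambda>z. k * g z) V"
  unfolding real_analytic_on_def by (auto intro!: real_analytic_at_mult)

lemma real_analytic_on_imp_differentiable:
  "real_analytic_on g V \<Longrightarrow> q \<in> V \<Longrightarrow> g differentiable (at q)"
  by (auto simp: real_analytic_on_def intro: real_analytic_at_differentiable)

lemma analytic_form1_normal_form:
  assumes V: "open V" and f: "real_analytic_on f V"
  shows "analytic_form1 (normal_form f) V"
proof -
  note p = real_analytic_on_partial[OF _ V]
  note a = real_analytic_on_cmult[OF p[OF f], of "- 1 / 3" 3] real_analytic_on_cmult[OF p[OF p[OF f]], of "1 / 6" 3 3]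
    real_analytic_on_cmult[OF p[OF p[OF p[OF f]]], of "1 / 6" 3 3 3]
  have "real_analytic_at (\<lambda>q. normal_form f q v) q" if q: "q \<in> V" for q v
  proof (rule real_analytic_at_mat3)
    have k: "real_analytic_at (\<lambda>q :: jet. q $ 3) q" by (rule real_analytic_at_linear_self) (simp add: linear_iff)
    note a' = a[unfolded real_analytic_on_def, rule_format, OF q] f[unfolded real_analytic_on_def, rule_format, OF q]
    have "\<forall>i j. real_analytic_at (\<lambda>q. normal_form f q v $ i $ j) q"
      unfolding forall_3 normal_form_def conn_form_entries mu_of_def zero_index
      by (intro conjI real_analytic_at_add real_analytic_at_diff real_analytic_at_mult real_analytic_at_uminus
          real_analytic_at_const k a')
    then show "real_analytic_at (\<lambda>q. normal_form f q v $ i $ j) q" for i j by blast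
  qed
  then show ?thesis
    by (auto simp: analytic_form1_def real_analytic_on_def) (simp add: normal_form_def linear_conn_form)
qed

lemma normal_form_entries:
  "normal_form f q v $ 1 = 0" "normal_form f q v $ 2 $ 1 = form_dx q v"
  "normal_form f q v $ 3 $ 1 = form_contact q v" "normal_form f q v $ 3 $ 2 = form_Pi f (mu_of f) q v"
  by (simp_all add: normal_form_def conn_form_entries form_dx_def form_contact_def form_Pi_def)

lemma normal_form_asl2: "normal_form f q v \<in> asl2"
  by (simp add: normal_form_def asl2_def conn_form_entries)

lemma normal_form_coframe:
  assumes "normal_form f q v $ 2 $ 1 = 0" "normal_form f q v $ 3 $ 1 = 0" "normal_form f q v $ 3 $ 2 = 0"
  shows "v = 0"
  using assms by (simp add: normal_form_entries form_dx_def form_contact_def form_Pi_def vec_eq_iff forall_3)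

text \<open>The dependence of the curvature on the fibre comes from conjugation by the group, so the
  computation is carried out on the identity section.\<close>

definition J1 :: "(jet \<Rightarrow> real) \<Rightarrow> jet \<Rightarrow> real" where "J1 f q = I1 f (q, 1, 0)"
definition J3 :: "(jet \<Rightarrow> real) \<Rightarrow> jet \<Rightarrow> real" where "J3 f q = I3 f (q, 1, 0)"

text \<open>In the entry (3,2) the coefficient of \<open>dx \<and> \<kappa>\<close>, with
  \<open>\<kappa>\<close> the contact form and \<open>D\<close> the total derivative, is
  \<open>f\<^sub>y - \<mu> f\<^sub>p + D \<mu> - \<mu>\<^sup>2\<close>. For
  \<open>\<mu> = - f\<^sub>p / 3\<close> this is the left hand side of \<open>pde\<close>; the
  constant 2/9 is 1/3 - 1/9.\<close>

lemma curvature_normal_form: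
  fixes f :: "jet \<Rightarrow> real"
  assumes V: "open V" and f: "real_analytic_on f V" and q: "q \<in> V"
    and pde: "d_y f q + (2/9) * (d_p f q)\<^sup>2 - (1/3) * total_D f (d_p f) q = 0"
  shows "curvature (normal_form f) q v w = Hlie (J1 f q * wedge form_dx form_contact q v w)
    (J3 f q * wedge form_dx form_contact q v w
      - d_p (d_p (d_p (d_p f))) q / 6 * wedge (form_Pi f (mu_of f)) form_contact q v w)"
proof -
  note p = real_analytic_on_partial[OF _ V]
  note an = p[OF f] p[OF p[OF f]] p[OF p[OF p[OF f]]]
  note dp = an[THEN real_analytic_on_imp_differentiable, OF q]
  define M where "M = mu_of f"
  define C where "C = (\<lambda>q. (1 / 6) * d_p (d_p f) q)"
  define E where "E = (\<lambda>q. (1 / 6) * d_p (d_p (d_p f)) q)"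
  have nf: "normal_form f = conn_form f M C E" by (simp add: normal_form_def M_def C_def E_def)
  have d: "f differentiable (at q)" "M differentiable (at q)" "C differentiable (at q)" "E differentiable (at q)"
    unfolding M_def mu_of_def C_def E_def
    using real_analytic_on_imp_differentiable[OF f q] dp by (auto intro!: differentiable_mult)
  have P: "M q = - (1 / 3) * d_p f q" "C q = (1 / 6) * d_p (d_p f) q" "E q = (1 / 6) * d_p (d_p (d_p f)) q"
    "partial i M q = (- 1 / 3) * partial i (d_p f) q" "partial i C q = (1 / 6) * partial i (d_p (d_p f)) q"
    "partial i E q = (1 / 6) * partial i (d_p (d_p (d_p f))) q" for i
    unfolding M_def mu_of_def C_def E_def by (simp, simp, simp, (rule partial_cmult dp)+)
  \<comment> \<open>Solved for \<open>f\<^sub>y\<close>, the hypothesis serves as a rewrite rule,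
    after which the entries agree as polynomials in the remaining derivatives.\<close>
  have fy: "d_y f q = - ((2/9) * (d_p f q)\<^sup>2) + (1/3) * (d_x (d_p f) q + q $ 3 * d_y (d_p f) q + f q * d_p (d_p f) q)"
    using pde unfolding total_D_def by linarith
  note CE = curvature_entry[OF analytic_form1_imp_diff_form1[OF analytic_form1_normal_form[OF V f]] q, unfolded nf]
  note S = CE ext_deriv_conn_form[OF d] conn_form_entries
    J1_def J3_def I1_def I3_def wedge_def form_Pi_def form_dx_def form_contact_def total_D_def
  show ?thesis unfolding nf M_def[symmetric]
  proof (rule mat3_eqI)
    show "curvature (conn_form f M C E) q v w $ 1 = Hlie (J1 f q * wedge form_dx form_contact q v w)
      (J3 f q * wedge form_dx form_contact q v w
        - d_p (d_p (d_p (d_p f))) q / 6 * wedge (form_Pi f M) form_contact q v w) $ 1"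
      by (simp add: vec_eq_iff S)
  qed (simp_all add: S P fy, simp_all add: field_simps power2_eq_square)
qed

text \<open>Hypothesis \<open>R\<close> expresses that the two curvature coefficients involving
  \<Pi> vanish: \<open>dx\<close> and the contact form are 0 on \<open>axis 3 1\<close>, while \<Pi>
  is 1 there. Differentiability of \<open>\<eta>\<close> is all that is assumed, with a view to
  gauge transforms.\<close>

lemma normal_form_unique:
  fixes f \<mu> :: "jet \<Rightarrow> real"
  assumes V: "open V" and f: "real_analytic_on f V" and \<eta>: "diff_form1 \<eta> V"
    and \<mu>: "\<And>q. q \<in> V \<Longrightarrow> \<mu> differentiable (at q)"
    and asl: "\<And>q v. q \<in> V \<Longrightarrow> \<eta> q v \<in> asl2"
    and ent: "\<And>q v. q \<in> V \<Longrightarrow> \<eta> q v $ 2 $ 1 = form_dx q v" "\<And>q v. q \<in> V \<Longrightarrow> \<eta> q v $ 3 $ 1 = form_contact q v"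
      "\<And>q v. q \<in> V \<Longrightarrow> \<eta> q v $ 3 $ 2 = form_Pi f \<mu> q v"
    and tor: "\<And>q v w. q \<in> V \<Longrightarrow> curvature \<eta> q v w $ 2 $ 1 = 0" "\<And>q v w. q \<in> V \<Longrightarrow> curvature \<eta> q v w $ 3 $ 1 = 0"
    and R: "\<And>q v i. q \<in> V \<Longrightarrow> i \<in> {2, 3} \<Longrightarrow> curvature \<eta> q v (axis 3 1) $ i $ 2 = 0"
    and q: "q \<in> V"
  shows "\<eta> q v = normal_form f q v"
proof -
  \<comment> \<open>The functions left free by torsion are read off on \<open>axis 2 1\<close>,
    where \<open>dx\<close> is 0 and the contact form is 1.\<close>
  define c where "c = (\<lambda>q. \<eta> q (axis 2 1) $ 2 $ 2)"
  define e where "e = (\<lambda>q. \<eta> q (axis 2 1) $ 2 $ 3)"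
  have ax [simp]: "axis i (1::real) $ j = (if j = i then 1 else 0)" for i j :: 3 by (auto simp: axis_def)
  have cd: "c differentiable (at q)" "e differentiable (at q)" if "q \<in> V" for q
  proof -
    have "((\<lambda>z. \<eta> z (axis 2 1)) has_derivative Df (\<lambda>z. \<eta> z (axis 2 1)) q) (at q)"
      using \<eta> that frechet_derivative_works by (auto simp: diff_form1_def)
    then have "((\<lambda>z. \<eta> z (axis 2 1) $ i $ j) has_derivative (\<lambda>v. Df (\<lambda>z. \<eta> z (axis 2 1)) q v $ i $ j)) (at q)" for i j
      by (intro bounded_linear.has_derivative[OF bounded_linear_vec_nth])
    then show "c differentiable (at q)" "e differentiable (at q)"
      unfolding c_def e_def differentiable_def by blast+
  qed
  note df = real_analytic_on_imp_differentiable[OF f]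
  have eq: "\<eta> q v = conn_form f \<mu> c e q v" if q: "q \<in> V" for q v
  proof -
    have l: "linear (\<eta> q)" using \<eta> q by (auto simp: diff_form1_def)
    have row1: "\<eta> q x $ 1 = 0" and tr: "\<eta> q x $ 3 $ 3 = - \<eta> q x $ 2 $ 2" for x
      using asl[OF q, of x] by (auto simp: asl2_def eq_neg_iff_add_eq_0 add.commute)
    have "ext_deriv (entry \<eta> 2 1) q v w = ext_deriv (entry (conn_form f \<mu> c e) 2 1) q v w"
      "ext_deriv (entry \<eta> 3 1) q v w = ext_deriv (entry (conn_form f \<mu> c e) 3 1) q v w" for v w
      by (rule ext_deriv_cong_open[OF V q]; simp add: entry_def conn_form_entries ent form_dx_def form_contact_def)+
    note ed = this ext_deriv_conn_form[OF df[OF q] \<mu>[OF q] cd[OF q]]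
    note T1 = tor(1)[OF q, unfolded curvature_entry[OF \<eta> q]]
    note T2 = tor(2)[OF q, unfolded curvature_entry[OF \<eta> q]]
    have cq: "\<eta> q (axis 2 1) $ 2 $ 2 = c q" "\<eta> q (axis 2 1) $ 2 $ 3 = e q" by (simp_all add: c_def e_def)
    note en = cq ent[OF q] row1 tr ed form_dx_def form_contact_def form_Pi_def
    \<comment> \<open>On pairs of coordinate vectors the torsion components become linear equations
      for the values of \<open>\<eta>\<close> on the \<open>x\<close> and \<open>p\<close>
      vectors.\<close>
    have 1: "\<eta> q (axis 1 1) $ 2 $ 2 = - \<mu> q - q $ 3 * c q"
      using T2[of "axis 1 1" "axis 2 1"] by (simp add: en algebra_simps)
    have 2: "\<eta> q (axis 3 1) $ 2 $ 2 = 0"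
      using T2[of "axis 2 1" "axis 3 1"] by (simp add: en)
    have 3: "\<eta> q (axis 1 1) $ 2 $ 3 = c q - q $ 3 * e q"
      using T1[of "axis 1 1" "axis 2 1"] by (simp add: en algebra_simps)
    have 4: "\<eta> q (axis 3 1) $ 2 $ 3 = 0"
      using T1[of "axis 2 1" "axis 3 1"] by (simp add: en)
    have v: "\<eta> q v = v $ 1 *\<^sub>R \<eta> q (axis 1 1) + v $ 2 *\<^sub>R \<eta> q (axis 2 1) + v $ 3 *\<^sub>R \<eta> q (axis 3 1)"
    proof -
      have "\<eta> q v = \<eta> q (v $ 1 *\<^sub>R axis 1 1 + v $ 2 *\<^sub>R axis 2 1 + v $ 3 *\<^sub>R axis 3 1)"
        by (rule arg_cong[of _ _ "\<eta> q"]) (simp add: vec_eq_iff forall_3)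
      then show ?thesis by (simp add: linear_add[OF l] linear_scale[OF l])
    qed
    have "\<eta> q v $ 2 $ 2 = conn_form f \<mu> c e q v $ 2 $ 2" "\<eta> q v $ 2 $ 3 = conn_form f \<mu> c e q v $ 2 $ 3"
      unfolding v conn_form_entries by (simp_all add: 1 2 3 4 cq) (simp_all add: algebra_simps)
    then show ?thesis
      using ent[OF q] row1 tr by (intro mat3_eqI) (simp_all add: conn_form_entries form_dx_def form_contact_def form_Pi_def)
  qed
  have main: "\<mu> q = (- 1 / 3) * d_p f q \<and> c q = (- 1 / 2) * d_p \<mu> q \<and> e q = d_p c q" if q: "q \<in> V" for q
  proof -
    note ed = ext_deriv_conn_form[OF df[OF q] \<mu>[OF q] cd[OF q]]
    have "diff_form1 (conn_form f \<mu> c e) V" by (rule diff_form1_conn_form) (rule df \<mu> cd, assumption)+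
    note CE = curvature_entry[OF this q]
    have R': "curvature (conn_form f \<mu> c e) q v (axis 3 1) $ 2 $ 2 = 0"
      "curvature (conn_form f \<mu> c e) q v (axis 3 1) $ 3 $ 2 = 0" for v
      using R[OF q] curvature_cong_open[OF V q eq] by auto
    note N = R'[unfolded CE]
    \<comment> \<open>Evaluated on pairs with \<open>axis 3 1\<close>, the entry (2,2) gives
      \<open>e = c\<^sub>p\<close> and \<open>\<mu>\<^sub>p = - 2 c\<close>; the entry (3,2) then
      gives \<open>f\<^sub>p + 3 \<mu> = 0\<close>, the origin of the factor 1/3.\<close>
    have a: "e q = d_p c q" using N(1)[of "axis 2 1"] by (simp add: ed conn_form_entries)
    have b: "d_p \<mu> q + 2 * c q = 0"
      using N(1)[of "axis 1 1"] a by (simp add: ed conn_form_entries algebra_simps)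
    then have b': "d_p \<mu> q = - 2 * c q" by simp
    have c: "d_p f q + 3 * \<mu> q = 0"
      using N(2)[of "axis 1 1"] b' by (simp add: ed conn_form_entries algebra_simps)
    show ?thesis using a b c by simp
  qed
  note p = real_analytic_on_partial[OF _ V]
  \<comment> \<open>The identities hold on the whole open set and may be differentiated in
    \<open>p\<close>: \<open>c = - \<mu>\<^sub>p / 2\<close> becomes
    \<open>f\<^sub>p\<^sub>p / 6\<close>, and \<open>e = c\<^sub>p\<close> becomes
    \<open>f\<^sub>p\<^sub>p\<^sub>p / 6\<close>.\<close>
  have m: "\<mu> q = (- 1 / 3) * d_p f q" if "q \<in> V" for q using main[OF that] by blast
  have c: "c q = (1 / 6) * d_p (d_p f) q" if q: "q \<in> V" for q
  proof -
    have "d_p \<mu> q = d_p (\<lambda>z. (- 1 / 3) * d_p f z) q" by (rule partial_cong_open[OF V q m])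
    also have "\<dots> = (- 1 / 3) * d_p (d_p f) q"
      by (rule partial_cmult[OF real_analytic_on_imp_differentiable[OF p[OF f] q]])
    finally show ?thesis using main[OF q] by simp
  qed
  have e: "e q = (1 / 6) * d_p (d_p (d_p f)) q" if q: "q \<in> V" for q
  proof -
    have "d_p c q = d_p (\<lambda>z. (1 / 6) * d_p (d_p f) z) q" by (rule partial_cong_open[OF V q c])
    also have "\<dots> = (1 / 6) * d_p (d_p (d_p f)) q"
      by (rule partial_cmult[OF real_analytic_on_imp_differentiable[OF p[OF p[OF f]] q]])
    finally show ?thesis using main[OF q] by simp
  qed
  show ?thesis
    unfolding eq[OF q] normal_form_def by (simp add: conn_form_def m[OF q] c[OF q] e[OF q] mu_of_def)
qed

section \<open>The normal connection and its curvature on the bundle\<close>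

lemma pullback_id_section_lift: "pullback id_section (lift \<eta>) = \<eta>"
  by (intro ext) (simp add: pullback_id_section lift_explicit Hmat_one mat3_eqI)

lemma lift_cong: "b \<in> H_bundle U \<Longrightarrow> (\<And>v. \<eta> (fst b) v = \<eta>' (fst b) v) \<Longrightarrow> lift \<eta> b v = lift \<eta>' b v"
  by (cases b) (simp add: lift_explicit mem_H_bundle)

lemma normal_cartan_connection_eq:
  assumes U: "open U" and f: "real_analytic_on f U" and \<omega>: "normal_cartan_connection f U \<omega>" and b: "b \<in> H_bundle U"
  shows "\<omega> b v = lift (normal_form f) b v"
proof -
  define \<eta> where "\<eta> = pullback id_section \<omega>"
  have cc: "cartan_connection (H_bundle U) ract Hgrp asl2 \<omega>"
    using \<omega> by (simp add: normal_cartan_connection_def)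
  then have an: "analytic_form1 \<eta> U"
    unfolding \<eta>_def by (intro analytic_form1_pullback_id_section) (simp add: cartan_connection_def)
  have asl: "\<eta> q v \<in> asl2" if "q \<in> U" for q v
  proof -
    have "(q, 1, 0) \<in> H_bundle U" using that by (simp add: mem_H_bundle)
    then have "bij_betw (\<omega> (q, 1, 0)) UNIV asl2" using cc by (auto simp: cartan_connection_def)
    then show ?thesis unfolding \<eta>_def pullback_id_section by (meson UNIV_I bij_betwE)
  qed
  obtain \<mu> R where \<mu>: "real_analytic_on \<mu> U"
    and ent: "\<forall>q\<in>U. \<forall>v. entry \<eta> 2 1 q v = form_dx q v \<and> entry \<eta> 3 1 q v = form_contact q v \<and> entry \<eta> 3 2 q v = form_Pi f \<mu> q v"
    and tor: "\<forall>q\<in>U. \<forall>v w. curvature \<eta> q v w $ 2 $ 1 = 0 \<and> curvature \<eta> q v w $ 3 $ 1 = 0"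
    and R: "\<And>q i v w. q \<in> U \<Longrightarrow> i \<in> {2, 3} \<Longrightarrow> curvature \<eta> q v w $ i $ 2 = R i q * wedge form_dx form_contact q v w"
  proof -
    from \<omega> obtain \<mu> R113 R123 R112 where "real_analytic_on \<mu> U"
      "\<forall>q\<in>U. \<forall>v. entry \<eta> 2 1 q v = form_dx q v \<and> entry \<eta> 3 1 q v = form_contact q v \<and> entry \<eta> 3 2 q v = form_Pi f \<mu> q v"
      "\<forall>q\<in>U. \<forall>v w. curvature \<eta> q v w $ 2 $ 1 = 0 \<and> curvature \<eta> q v w $ 3 $ 1 = 0"
      and R: "\<forall>q\<in>U. \<forall>i\<in>{2, 3}. (\<forall>v w. curvature \<eta> q v w $ i $ 2 =
                R113 i q * wedge form_dx (form_Pi f \<mu>) q v w +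
                R123 i q * wedge form_contact (form_Pi f \<mu>) q v w +
                R112 i q * wedge form_dx form_contact q v w) \<and> R113 i q = 0 \<and> R123 i q = 0"
      unfolding normal_cartan_connection_def Let_def \<eta>_def by blast
    moreover have "\<And>q i v w. q \<in> U \<Longrightarrow> i \<in> {2, 3} \<Longrightarrow> curvature \<eta> q v w $ i $ 2 = R112 i q * wedge form_dx form_contact q v w"
      using R by auto
    ultimately show thesis using that by blast
  qed
  have "\<eta> q v = normal_form f q v" if q: "q \<in> U" for q v
  proof (rule normal_form_unique[OF U f analytic_form1_imp_diff_form1[OF an] _ asl _ _ _ _ _ _ q, of \<mu>])
    show "\<And>q. q \<in> U \<Longrightarrow> \<mu> differentiable at q" by (rule real_analytic_on_imp_differentiable[OF \<mu>])
    show "\<And>q v i. q \<in> U \<Longrightarrow> i \<in> {2, 3} \<Longrightarrow> curvature \<eta> q v (axis 3 1) $ i $ 2 = 0"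
      by (simp only: R) (simp add: wedge_def form_dx_def form_contact_def axis_def)
  qed (use ent tor in \<open>auto simp: entry_def\<close>)
  then have "lift \<eta> b v = lift (normal_form f) b v"
    using b by (intro lift_cong[OF b]) (auto simp: mem_H_bundle)
  then show ?thesis unfolding \<eta>_def using cartan_connection_eq_lift[OF cc b] by simp
qed

lemma normal_cartan_connection_lift:
  assumes U: "open U" and f: "real_analytic_on f U"
    and pde: "\<forall>q\<in>U. d_y f q + (2/9) * (d_p f q)\<^sup>2 - (1/3) * total_D f (d_p f) q = 0"
  shows "normal_cartan_connection f U (lift (normal_form f))"
  unfolding normal_cartan_connection_def Let_def pullback_id_section_lift
proof (intro conjI exI)
  show "cartan_connection (H_bundle U) ract Hgrp asl2 (lift (normal_form f))"
    by (rule cartan_connection_lift[OF U analytic_form1_normal_form[OF U f] normal_form_asl2])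
      (rule normal_form_coframe)
  show "real_analytic_on (mu_of f) U"
    unfolding mu_of_def by (intro real_analytic_on_cmult real_analytic_on_partial f U)
  show "\<forall>q\<in>U. \<forall>v. entry (normal_form f) 2 1 q v = form_dx q v \<and>
      entry (normal_form f) 3 1 q v = form_contact q v \<and> entry (normal_form f) 3 2 q v = form_Pi f (mu_of f) q v"
    by (simp add: entry_def normal_form_entries)
  note C = curvature_normal_form[OF U f _ pde[rule_format]]
  show "\<forall>q\<in>U. \<forall>v w. curvature (normal_form f) q v w $ 2 $ 1 = 0 \<and> curvature (normal_form f) q v w $ 3 $ 1 = 0"
    by (simp add: C)
  show "\<forall>q\<in>U. \<forall>i\<in>{2, 3}.
      (\<forall>v w. curvature (normal_form f) q v w $ i $ 2 =
         (\<lambda>i q. 0) i q * wedge form_dx (form_Pi f (mu_of f)) q v w +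
         (\<lambda>i q. 0) i q * wedge form_contact (form_Pi f (mu_of f)) q v w +
         (\<lambda>i q. if i = 2 then J1 f q else 0) i q * wedge form_dx form_contact q v w) \<and>
      (\<lambda>i q. 0) i q = (0 :: real) \<and> (\<lambda>i q. 0) i q = (0 :: real)"
    by (simp add: C)
qed

text \<open>Curvature is horizontal: this is \<open>curvature_gauge\<close> for the bundle
  projection, whose derivative keeps only the base components of \<open>v\<close> and
  \<open>w\<close>.\<close>

lemma curvature_lift:
  assumes U: "open U" and \<eta>: "analytic_form1 \<eta> U" and b: "(q, u1, u3) \<in> H_bundle U"
  shows "curvature (lift \<eta>) (q, u1, u3) v w =
    Hmat (1 / u1, - u3) ** curvature \<eta> q (fst v) (fst w) ** Hmat (u1, u3)"
proof -
  let ?T = "\<lambda>b :: bpoint. Hmat (1 / fst (snd b), - snd (snd b))"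
  have an: "real_analytic_at (\<lambda>b :: bpoint. Hmat (snd b)) b" "real_analytic_at ?T b" if "b \<in> H_bundle U" for b
  proof -
    have u: "fst (snd b) \<noteq> 0" using that by (simp add: mem_H_bundle)
    note i = real_analytic_at_inverse_u1[OF u]
    have "real_analytic_at (\<lambda>b :: bpoint. Hmat (fst (snd b), snd (snd b))) b"
      by (intro real_analytic_at_Hmat real_analytic_at_fst_snd real_analytic_at_snd_snd i)
    then show "real_analytic_at (\<lambda>b :: bpoint. Hmat (snd b)) b" by simp
    show "real_analytic_at ?T b"
      by (rule real_analytic_at_Hmat) (simp_all add: real_analytic_at_fst_snd real_analytic_at_snd_snd real_analytic_at_uminus i)
  qed
  have "curvature (lift \<eta>) (q, u1, u3) v w = ?T (q, u1, u3) **
      curvature \<eta> (fst (q, u1, u3)) (Df fst (q, u1, u3) v) (Df fst (q, u1, u3) w)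
      ** Hmat (snd (q, u1, u3))"
    unfolding lift_def
  proof (rule curvature_gauge[OF open_H_bundle[OF U] b _ U _ analytic_form1_imp_diff_form1[OF \<eta>]])
    show "real_analytic_on fst (H_bundle U)"
      unfolding real_analytic_on_def by (auto intro!: real_analytic_at_linear_self simp: linear_iff)
  qed (use an b in \<open>auto simp: real_analytic_on_def mem_H_bundle Hmat_inverse' intro: real_analytic_at_differentiable\<close>)
  then show ?thesis by (simp add: frechet_derivative_fst)
qed

lemma curvature_lift_normal_form:
  assumes U: "open U" and f: "real_analytic_on f U" and b: "b \<in> H_bundle U"
    and pde: "\<forall>q\<in>U. d_y f q + (2/9) * (d_p f q)\<^sup>2 - (1/3) * total_D f (d_p f) q = 0"
  defines "\<omega> \<equiv> lift (normal_form f)"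
  defines "\<theta>1 \<equiv> entry \<omega> 3 1" and "\<theta>2 \<equiv> entry \<omega> 3 2" and "\<theta>3 \<equiv> entry \<omega> 2 1"
  shows "curvature \<omega> b v w = Hlie (I1 f b * wedge \<theta>3 \<theta>1 b v w)
    (I2 f b * wedge \<theta>2 \<theta>1 b v w + I3 f b * wedge \<theta>3 \<theta>1 b v w)"
proof -
  obtain q u1 u3 where bq: "b = (q, u1, u3)" by (cases b)
  have q: "q \<in> U" and u: "u1 \<noteq> 0" using b by (auto simp: bq mem_H_bundle)
  let ?dk = "wedge form_dx form_contact q (fst v) (fst w)" and ?Pk = "wedge (form_Pi f (mu_of f)) form_contact q (fst v) (fst w)"
  let ?f4 = "d_p (d_p (d_p (d_p f))) q"
  have \<omega>: "curvature \<omega> b v w = Hlie (J1 f q * ?dk)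
      ((J3 f q * ?dk - ?f4 / 6 * ?Pk) / u1\<^sup>2 + 2 * (J1 f q * ?dk) * u3 / u1)"
    unfolding \<omega>_def bq using b
    by (simp add: bq curvature_lift[OF U analytic_form1_normal_form[OF U f]]
        curvature_normal_form[OF U f q pde[rule_format, OF q]] conj_Hlie[OF u])
  have n1: "normal_form f q x $ 1 = 0" for x by (rule normal_form_entries)
  have th: "\<theta>1 b v = u1 * form_contact q (fst v)" "\<theta>2 b v = u1\<^sup>2 * form_Pi f (mu_of f) q (fst v)"
    "\<theta>3 b v = form_dx q (fst v) / u1 + u3 * form_contact q (fst v)" for v
    unfolding \<theta>1_def \<theta>2_def \<theta>3_def \<omega>_def bq entry_def lift_explicit[OF u]
    by (simp_all add: conj_Hmat_entries[OF u n1] normal_form_entries)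
  \<comment> \<open>The scalings of the coframe cancel in \<open>\<theta>3 \<and> \<theta>1\<close>,
    while \<open>\<theta>2 \<and> \<theta>1\<close> acquires \<open>u1 ^ 3\<close>. With the
    division by \<open>u1\<^sup>2\<close> from conjugation this explains the \<open>u1 ^ 5\<close>
    in \<open>I2\<close>.\<close>
  have w: "wedge \<theta>3 \<theta>1 b v w = ?dk" "wedge \<theta>2 \<theta>1 b v w = u1 ^ 3 * ?Pk"
    using u by (simp_all add: wedge_def th field_simps power2_eq_square power3_eq_cube)
  have I: "I1 f b = J1 f q" "I2 f b = - (1 / (6 * u1 ^ 5)) * ?f4"
    "I3 f b = J3 f q / u1\<^sup>2 + 2 * (u3 / u1) * J1 f q"
    by (simp_all add: bq I1_def I2_def I3_def J1_def J3_def)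
  have "(J3 f q * ?dk - ?f4 / 6 * ?Pk) / u1\<^sup>2 + 2 * (J1 f q * ?dk) * u3 / u1 =
      - (1 / (6 * u1 ^ 5)) * ?f4 * (u1 ^ 3 * ?Pk) + (J3 f q / u1\<^sup>2 + 2 * (u3 / u1) * J1 f q) * ?dk"
    using u by (simp add: field_simps power2_eq_square eval_nat_numeral)
  then show ?thesis unfolding \<omega> w I by simp
qed

section \<open>Existence of solutions\<close>

text \<open>Directional derivatives are continuous, hence bounded on a compact ball. Summed over the
  basis they bound the operator norm, and convexity of the ball yields the Lipschitz
  estimate.\<close>

lemma real_analytic_on_locally_lipschitz:
  fixes F :: "'a::euclidean_space \<Rightarrow> 'b::euclidean_space"
  assumes F: "real_analytic_on F V" and V: "open V" and r: "r \<in> V"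
  obtains \<rho> L where "0 < \<rho>" "0 < L" "cball r \<rho> \<subseteq> V"
    "\<And>x y. x \<in> cball r \<rho> \<Longrightarrow> y \<in> cball r \<rho> \<Longrightarrow> norm (F x - F y) \<le> L * norm (x - y)"
proof -
  obtain \<rho> where \<rho>: "0 < \<rho>" "cball r \<rho> \<subseteq> V" using V r open_contains_cball by blast
  let ?D = "\<lambda>x. Df F x"
  have d: "(F has_derivative ?D x) (at x)" if "x \<in> V" for x
    using F that by (auto simp: real_analytic_on_def intro: real_analytic_at_has_derivative)
  have "\<exists>B. \<forall>x\<in>cball r \<rho>. norm (?D x b) \<le> B" for b
  proof -
    have "continuous_on (cball r \<rho>) (\<lambda>x. ?D x b)"
      using real_analytic_on_imp_differentiable[OF real_analytic_on_frechet_derivative[OF F V]] \<rho>(2)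
      by (intro continuous_at_imp_continuous_on) (auto intro!: differentiable_imp_continuous_within)
    then have "bounded ((\<lambda>x. ?D x b) ` cball r \<rho>)"
      by (intro compact_imp_bounded compact_continuous_image compact_cball)
    then show ?thesis by (auto simp: bounded_iff)
  qed
  then obtain B where B: "\<And>b x. x \<in> cball r \<rho> \<Longrightarrow> norm (?D x b) \<le> B b" by metis
  \<comment> \<open>The summand 1 keeps \<open>L\<close> positive even if all derivatives
    vanish.\<close>
  define L where "L = (\<Sum>b\<in>Basis. B b) + 1"
  have B0: "0 \<le> B b" for b using B[of r b] \<rho> norm_ge_zero order_trans by (metis centre_in_cball less_imp_le)
  have L: "L > 0" unfolding L_def using sum_nonneg[of Basis B] B0 by (simp add: add_nonneg_pos)
  have on: "onorm (?D x) \<le> L" if x: "x \<in> cball r \<rho>" for x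
  proof (rule onorm_bound)
    fix v
    have "norm (?D x v) = norm (\<Sum>b\<in>Basis. (v \<bullet> b) *\<^sub>R ?D x b)"
      using d[of x] x \<rho> by (subst frechet_derivative_expand) (auto simp: differentiable_def subset_iff)
    also have "\<dots> \<le> (\<Sum>b\<in>Basis. B b * norm v)"
    proof (rule sum_norm_le)
      fix b :: 'a assume "b \<in> Basis"
      then have "norm (?D x b) * \<bar>v \<bullet> b\<bar> \<le> B b * norm v"
        by (intro mult_mono B[OF x] Basis_le_norm B0) auto
      then show "norm ((v \<bullet> b) *\<^sub>R ?D x b) \<le> B b * norm v" by (simp add: mult.commute)
    qed
    also have "\<dots> \<le> L * norm v" by (simp add: L_def sum_distrib_right distrib_right)
    finally show "norm (?D x v) \<le> L * norm v" .
  qed (use L in simp)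
  have "norm (F x - F y) \<le> L * norm (x - y)" if "x \<in> cball r \<rho>" "y \<in> cball r \<rho>" for x y
    by (rule differentiable_bound[where S = "cball r \<rho>" and f' = ?D])
      (use that on \<rho> in \<open>auto intro!: has_derivative_at_withinI d\<close>)
  with \<rho> L that show thesis by blast
qed

text \<open>
  Composing \<open>F\<close> with the projection onto a ball makes it globally Lipschitz, so that the Picard map
  is a contraction of the whole space of bounded continuous functions.
\<close>

lemma picard_lindeloef:
  fixes F :: "'a::euclidean_space \<Rightarrow> 'a"
  assumes V: "open V" and r: "r \<in> V" and F: "real_analytic_on F V"
  obtains \<delta> \<gamma> where "0 < (\<delta>::real)" "\<gamma> x0 = r"
    "\<And>x. x \<in> {x0 - \<delta><..<x0 + \<delta>} \<Longrightarrow> \<gamma> x \<in> V \<and> (\<gamma> has_vector_derivative F (\<gamma> x)) (at x)"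
proof -
  obtain \<rho> L where \<rho>: "0 < \<rho>" and L: "0 < L" and sub: "cball r \<rho> \<subseteq> V"
    and lip: "\<And>x y. x \<in> cball r \<rho> \<Longrightarrow> y \<in> cball r \<rho> \<Longrightarrow> norm (F x - F y) \<le> L * norm (x - y)"
    using real_analytic_on_locally_lipschitz[OF F V r] by blast
  let ?cp = "closest_point (cball r \<rho>)"
  define G where "G x = F (?cp x)" for x
  have cp: "?cp x \<in> cball r \<rho>" for x using \<rho> by (intro closest_point_in_set) auto
  have G: "norm (G x - G y) \<le> L * norm (x - y)" for x y
  proof -
    have "dist (?cp x) (?cp y) \<le> dist x y" using \<rho> by (intro closest_point_lipschitz) auto
    then have "L * norm (?cp x - ?cp y) \<le> L * norm (x - y)" using L by (simp add: dist_norm)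
    with lip[OF cp cp, of x y] show ?thesis unfolding G_def by linarith
  qed
  have "L-lipschitz_on UNIV G" using G L by (auto intro!: lipschitz_onI simp: dist_norm)
  then have contG: "continuous_on UNIV G" by (rule lipschitz_on_continuous_on)
  \<comment> \<open>The interval has length \<open>2 * d = 1 / (4 * L)\<close>, so \<open>J\<close>
    contracts by 1/4; \<open>T\<close> contains \<open>J\<close> twice, which gives the factor
    1/2.\<close>
  define d where "d = 1 / (8 * L)"
  have d: "0 < d" using L by (simp add: d_def)
  define a where "a = x0 - d"
  define b where "b = x0 + d"
  have ab: "a < x0" "x0 < b" "a \<le> b" "b - a = 2 * d" using d by (auto simp: a_def b_def)
  \<comment> \<open>Bounded continuous functions live on the whole line, so the Picard map is
    extended constantly beyond the interval by clamping its argument.\<close>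
  define cl where "cl x = max a (min b x)" for x :: real
  have cl: "cl x \<in> {a..b}" for x using ab by (auto simp: cl_def)
  have cl_id: "cl x = x" if "x \<in> {a..b}" for x using that by (auto simp: cl_def)
  \<comment> \<open>Integrals start at the left endpoint, which avoids oriented integrals;
    subtracting \<open>J g x0\<close> in \<open>T\<close> restores the initial value at
    \<open>x0\<close>.\<close>
  define J where "J g x = integral {a..x} (\<lambda>s. G (apply_bcontfun g s))" for g :: "real \<Rightarrow>\<^sub>C 'a" and x
  have cont: "continuous_on S (\<lambda>s. G (apply_bcontfun g s))" for g :: "real \<Rightarrow>\<^sub>C 'a" and S
    by (rule continuous_on_compose2[OF contG]) auto
  have int: "(\<lambda>s. G (apply_bcontfun g s)) integrable_on {a..x}" for g :: "real \<Rightarrow>\<^sub>C 'a" and x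
    by (rule integrable_continuous_real[OF cont])
  have contJ: "continuous_on {a..b} (J g)" for g
    unfolding J_def by (rule indefinite_integral_continuous_1[OF int])
  have cJ: "continuous_on UNIV (\<lambda>x. J g (cl x))" for g
  proof (rule continuous_on_compose2[OF contJ])
    show "continuous_on UNIV cl" unfolding cl_def by (intro continuous_intros)
  qed (use cl in blast)
  have bJ: "bounded (range (\<lambda>x. r + J g (cl x) - J g x0))" for g
  proof -
    have "bounded (J g ` {a..b})" by (intro compact_imp_bounded compact_continuous_image contJ compact_Icc)
    then obtain B where B: "\<forall>x\<in>{a..b}. norm (J g x) \<le> B" by (auto simp: bounded_iff)
    have "norm (r + J g (cl x) - J g x0) \<le> norm r + B + norm (J g x0)" for x
      using norm_triangle_ineq4[of "r + J g (cl x)" "J g x0"] norm_triangle_ineq[of r "J g (cl x)"] B cl[of x] by fastforce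
    then show ?thesis by (auto simp: bounded_iff)
  qed
  define T where "T g = Bcontfun (\<lambda>x. r + J g (cl x) - J g x0)" for g
  have T: "apply_bcontfun (T g) x = r + J g (cl x) - J g x0" for g x
    unfolding T_def by (subst Bcontfun_inverse) (auto simp: bcontfun_def bJ intro!: continuous_intros cJ)
  have Jdiff: "norm (J g x - J h x) \<le> dist g h / 4" if x: "x \<in> {a..b}" for g h x
  proof -
    have "norm (integral {a..x} (\<lambda>s. G (apply_bcontfun g s) - G (apply_bcontfun h s))) \<le> (L * dist g h) * (x - a)"
    proof (rule integral_bound)
      show "continuous_on {a..x} (\<lambda>s. G (apply_bcontfun g s) - G (apply_bcontfun h s))"
        by (intro continuous_on_diff cont)
      fix s
      have "norm (apply_bcontfun g s - apply_bcontfun h s) \<le> dist g h" using dist_bounded[of g s h] by (simp add: dist_norm)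
      then have "L * norm (apply_bcontfun g s - apply_bcontfun h s) \<le> L * dist g h" using L by simp
      with G show "norm (G (apply_bcontfun g s) - G (apply_bcontfun h s)) \<le> L * dist g h" by (rule order_trans)
    qed (use x in auto)
    also have "\<dots> \<le> (L * dist g h) * (2 * d)" using x ab L by (intro mult_left_mono) auto
    also have "\<dots> = dist g h / 4" using L by (simp add: d_def)
    finally show ?thesis unfolding J_def by (simp add: integral_diff[OF int int])
  qed
  have "dist (T g) (T h) \<le> 1 / 2 * dist g h" for g h
  proof (rule dist_bound)
    fix x
    have "norm ((J g (cl x) - J h (cl x)) - (J g x0 - J h x0)) \<le> dist g h / 4 + dist g h / 4"
      by (intro norm_triangle_le_diff add_mono Jdiff cl) (use ab in auto)
    then show "dist (apply_bcontfun (T g) x) (apply_bcontfun (T h) x) \<le> 1 / 2 * dist g h"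
      unfolding T dist_norm by (simp add: algebra_simps)
  qed
  then have "\<exists>!g. T g = g" by (intro banach_fix_type[of "1/2"]) auto
  then obtain g where g: "T g = g" by blast
  let ?g = "apply_bcontfun g"
  have gx: "?g x = r + J g (cl x) - J g x0" for x using T[of g x] g by simp
  have g0: "?g x0 = r" using ab by (simp add: gx cl_id)
  \<comment> \<open>Near \<open>x0\<close> the fixed point stays in the ball, where the projection
    is the identity and \<open>G\<close> agrees with \<open>F\<close>.\<close>
  have "open (?g -` ball r \<rho>)" by (rule open_vimage[OF open_ball]) auto
  moreover have "x0 \<in> ?g -` ball r \<rho>" using \<rho> by (simp add: g0)
  ultimately obtain e where e: "0 < e" "ball x0 e \<subseteq> ?g -` ball r \<rho>" using open_contains_ball by blast
  show thesis
  proof (rule that[of "min d e" ?g])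
    show "0 < min d e" using d e by simp
    show "?g x0 = r" by (rule g0)
    fix x assume x: "x \<in> {x0 - min d e<..<x0 + min d e}"
    then have "x \<in> ball x0 e" by (auto simp: dist_real_def)
    then have gb: "?g x \<in> cball r \<rho>" using e by auto
    have xi: "x \<in> {a<..<b}" using x by (auto simp: a_def b_def)
    have "((\<lambda>u. integral {a..u} (\<lambda>s. G (?g s))) has_vector_derivative G (?g x)) (at x within {a..b})"
      by (rule integral_has_vector_derivative[OF cont]) (use xi in auto)
    then have "(J g has_vector_derivative G (?g x)) (at x)"
      using xi unfolding J_def[abs_def] by (simp add: at_within_Icc_at)
    then have "((\<lambda>u. r + J g u - J g x0) has_vector_derivative G (?g x)) (at x)"
      by (auto intro!: derivative_eq_intros)
    then have "(?g has_vector_derivative G (?g x)) (at x)"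
      by (rule has_vector_derivative_transform_within_open[OF _ open_greaterThanLessThan xi]) (simp add: gx cl_id)
    moreover have "G (?g x) = F (?g x)" unfolding G_def by (simp add: closest_point_self[OF gb])
    ultimately show "?g x \<in> V \<and> (?g has_vector_derivative F (?g x)) (at x)" using gb sub by auto
  qed
qed

lemma vec_nth_has_vector_derivative:
  fixes \<gamma> :: "real \<Rightarrow> real^'n"
  assumes "(\<gamma> has_vector_derivative v) (at x)"
  shows "((\<lambda>t. \<gamma> t $ i) has_real_derivative v $ i) (at x)"
  using bounded_linear.has_vector_derivative[OF bounded_linear_vec_nth assms]
  by (simp add: has_real_derivative_iff_has_vector_derivative)

text \<open>The equation is solved as the autonomous system with right hand side
  \<open>(1, p, f)\<close>; the first component of its solution then coincides with the
  parameter.\<close>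

lemma ode_solution_through:
  assumes V: "open V" and f: "real_analytic_on f V" and r: "r \<in> V"
  obtains I c where "ode_solution f V I c" "r $ 1 \<in> I" "jet1 c (r $ 1) = r"
proof -
  let ?F = "\<lambda>q :: jet. vector [1, q $ 3, f q] :: jet"
  have F: "real_analytic_on ?F V"
    unfolding real_analytic_on_def
  proof
    fix q assume q: "q \<in> V"
    have k: "real_analytic_at (\<lambda>q :: jet. q $ 3) q" by (rule real_analytic_at_linear_self) (simp add: linear_iff)
    have "\<forall>i. real_analytic_at (\<lambda>q. ?F q $ i) q"
      unfolding forall_3 using f q k by (simp add: real_analytic_on_def)
    then show "real_analytic_at ?F q" by (intro real_analytic_at_vec) blast
  qed
  obtain \<delta> \<gamma> where \<delta>: "0 < \<delta>" and \<gamma>0: "\<gamma> (r $ 1) = r"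
    and \<gamma>: "\<And>x. x \<in> {r $ 1 - \<delta><..<r $ 1 + \<delta>} \<Longrightarrow> \<gamma> x \<in> V \<and> (\<gamma> has_vector_derivative ?F (\<gamma> x)) (at x)"
    using picard_lindeloef[OF V r F, of "r $ 1"] by blast
  define I where "I = {r $ 1 - \<delta><..<r $ 1 + \<delta>}"
  define c where "c = (\<lambda>x. \<gamma> x $ 2)"
  have rI: "r $ 1 \<in> I" using \<delta> by (simp add: I_def)
  have oI: "open I" "convex I" by (simp_all add: I_def)
  have d: "((\<lambda>t. \<gamma> t $ i) has_real_derivative ?F (\<gamma> x) $ i) (at x)" if "x \<in> I" for x i
    using \<gamma> that unfolding I_def by (intro vec_nth_has_vector_derivative) blast
  have g1: "\<gamma> x $ 1 = x" if x: "x \<in> I" for x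
  proof -
    have "((\<lambda>t. \<gamma> t $ 1 - t) has_real_derivative 0) (at t within I)" if "t \<in> I" for t
    proof (rule has_field_derivative_at_within)
      have "((\<lambda>t. \<gamma> t $ 1) has_real_derivative 1) (at t)" using d[OF that, of 1] by simp
      from DERIV_diff[OF this DERIV_ident] show "((\<lambda>t. \<gamma> t $ 1 - t) has_real_derivative 0) (at t)" by simp
    qed
    from has_field_derivative_zero_constant[OF oI(2) this]
    obtain k where k: "\<forall>t\<in>I. \<gamma> t $ 1 - t = k" by blast
    have "\<gamma> x $ 1 - x = \<gamma> (r $ 1) $ 1 - r $ 1" using k x rI by simp
    then show ?thesis by (simp add: \<gamma>0)
  qed
  have dc: "(c has_real_derivative \<gamma> x $ 3) (at x)" if "x \<in> I" for x
    using d[OF that, of 2] by (simp add: c_def)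
  then have j: "jet1 c x = \<gamma> x" if "x \<in> I" for x
    using that g1 by (simp add: jet1_def vec_eq_iff forall_3 c_def[symmetric] DERIV_imp_deriv) (simp add: c_def)
  have "ode_solution f V I c"
    unfolding ode_solution_def
  proof (intro conjI ballI)
    fix x assume x: "x \<in> I"
    show "jet1 c x \<in> V" using \<gamma> x by (simp add: j[OF x] I_def)
    show "c differentiable (at x)" using dc[OF x] by (auto simp: real_differentiable_def)
    have "((\<lambda>t. \<gamma> t $ 3) has_real_derivative f (\<gamma> x)) (at x)" using d[OF x, of 3] by simp
    then show "(deriv c has_real_derivative f (jet1 c x)) (at x)"
      unfolding j[OF x] by (rule has_field_derivative_transform_within_open[OF _ oI(1) x]) (simp add: DERIV_imp_deriv[OF dc])
  qed (simp_all add: I_def is_interval_convex_1)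
  then show thesis using that rI j[OF rI] \<gamma>0 by simp
qed

lemma axis3_nth [simp]: "axis i (1::real) $ j = (if j = i then 1 else 0)"
  by (auto simp: axis_def)

lemma frechet_derivative_vec_nth:
  fixes \<psi> :: "'a::real_normed_vector \<Rightarrow> real^'n"
  assumes "\<psi> differentiable (at r)"
  shows "Df (\<lambda>r. \<psi> r $ i) r v = Df \<psi> r v $ i"
proof -
  have "(\<psi> has_derivative Df \<psi> r) (at r)" using assms frechet_derivative_works by blast
  from bounded_linear.has_derivative[OF bounded_linear_vec_nth[of i] this]
  have "((\<lambda>r. \<psi> r $ i) has_derivative (\<lambda>v. Df \<psi> r v $ i)) (at r)" .
  from fun_cong[OF frechet_derivative_at[OF this]] show ?thesis by simp
qed

section \<open>Prolongations and bundle maps\<close>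

text \<open>The total derivative as a vector field: it is the velocity of curves of solution jets
  and spans the common kernel of the contact form and \<Pi>.\<close>

definition total_field :: "(jet \<Rightarrow> real) \<Rightarrow> jet \<Rightarrow> jet" where
  "total_field f q = vector [1, q $ 3, f q]"

lemma total_field_nth [simp]: "total_field f q $ 1 = 1" "total_field f q $ 2 = q $ 3" "total_field f q $ 3 = f q"
  by (simp_all add: total_field_def)

text \<open>The frame used is dual to \<open>dx\<close>, the contact form and
  \<open>dp - f dx\<close>.\<close>

lemma jet_decompose:
  "v = v $ 1 *\<^sub>R total_field f q + form_contact q v *\<^sub>R axis 2 1 + (v $ 3 - f q * v $ 1) *\<^sub>R axis 3 1"
  by (simp add: vec_eq_iff forall_3 form_contact_def)

lemma has_vector_derivative_jet:
  fixes \<gamma> :: "real \<Rightarrow> jet"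
  assumes "\<And>i. ((\<lambda>t. \<gamma> t $ i) has_real_derivative v $ i) (at x)"
  shows "(\<gamma> has_vector_derivative v) (at x)"
  unfolding has_vector_derivative_def
proof (subst has_derivative_componentwise_within, intro ballI)
  fix b :: jet assume "b \<in> Basis"
  then obtain i where b: "b = axis i 1" by (auto simp: Basis_vec_def)
  show "((\<lambda>t. \<gamma> t \<bullet> b) has_derivative (\<lambda>t. (t *\<^sub>R v) \<bullet> b)) (at x)"
    using assms[of i] unfolding has_field_derivative_def by (simp add: b inner_axis mult_commute_abs)
qed

lemma jet1_has_vector_derivative:
  assumes c: "ode_solution f V I c" and x: "x \<in> I"
  shows "(jet1 c has_vector_derivative total_field f (jet1 c x)) (at x)"
proof (rule has_vector_derivative_jet)
  have "(c has_real_derivative deriv c x) (at x)" "(deriv c has_real_derivative f (jet1 c x)) (at x)"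
    using c x by (auto simp: ode_solution_def DERIV_deriv_iff_real_differentiable)
  then have "\<forall>i. ((\<lambda>t. jet1 c t $ i) has_real_derivative total_field f (jet1 c x) $ i) (at x)"
    unfolding forall_3 total_field_nth by (simp add: jet1_def)
  then show "((\<lambda>t. jet1 c t $ i) has_real_derivative total_field f (jet1 c x) $ i) (at x)" for i by blast
qed

text \<open>Take a solution through \<open>q\<close> and differentiate
  \<open>\<psi> (jet1 c t) = jet1 cb (\<tau> t)\<close> at the parameter of \<open>q\<close>; the
  factor is the derivative of \<open>\<tau>\<close>.\<close>

lemma maps_solutions_imp_total_field:
  assumes V: "open V" and f: "real_analytic_on f V" and \<psi>: "\<And>q. q \<in> V \<Longrightarrow> \<psi> differentiable (at q)"
    and m: "maps_solutions f V fb Vb \<psi>" and q: "q \<in> V"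
  obtains k where "Df \<psi> q (total_field f q) = k *\<^sub>R total_field fb (\<psi> q)"
proof -
  obtain I c where c: "ode_solution f V I c" and x: "q $ 1 \<in> I" and j: "jet1 c (q $ 1) = q"
    using ode_solution_through[OF V f q] by blast
  let ?x = "q $ 1"
  obtain J cb \<tau> where cb: "ode_solution fb Vb J cb" and \<tau>: "bij_betw \<tau> I J"
    and *: "\<forall>x\<in>I. \<tau> differentiable at x \<and> deriv \<tau> x \<noteq> 0 \<and> \<psi> (jet1 c x) = jet1 cb (\<tau> x)"
    using m c unfolding maps_solutions_def by blast
  have I: "open I" using c by (simp add: ode_solution_def)
  have \<tau>x: "\<tau> ?x \<in> J" using \<tau> x by (auto simp: bij_betw_def)
  have \<psi>q: "jet1 cb (\<tau> ?x) = \<psi> q" using * x j by metis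
  have "(\<psi> has_derivative Df \<psi> q) (at q)" using \<psi>[OF q] frechet_derivative_works by blast
  then have "(\<psi> has_derivative Df \<psi> q) (at (jet1 c ?x))" by (simp add: j)
  moreover have "(jet1 c has_derivative (\<lambda>t. t *\<^sub>R total_field f q)) (at ?x)"
    using jet1_has_vector_derivative[OF c x] by (simp add: j has_vector_derivative_def)
  ultimately have "((\<lambda>t. \<psi> (jet1 c t)) has_derivative (\<lambda>t. Df \<psi> q (t *\<^sub>R total_field f q))) (at ?x)"
    using diff_chain_at[of "jet1 c" _ ?x \<psi>] by (simp add: o_def)
  then have 1: "((\<lambda>t. \<psi> (jet1 c t)) has_vector_derivative Df \<psi> q (total_field f q)) (at ?x)"
    by (simp add: has_vector_derivative_def linear_scale[OF linear_frechet_derivative[OF \<psi>[OF q]]])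
  have "(\<tau> has_vector_derivative deriv \<tau> ?x) (at ?x)"
    using * x by (simp add: DERIV_deriv_iff_real_differentiable flip: has_real_derivative_iff_has_vector_derivative)
  from vector_diff_chain_at[OF this jet1_has_vector_derivative[OF cb \<tau>x]]
  have "((\<lambda>t. jet1 cb (\<tau> t)) has_vector_derivative deriv \<tau> ?x *\<^sub>R total_field fb (\<psi> q)) (at ?x)"
    by (simp add: o_def \<psi>q)
  then have 2: "((\<lambda>t. \<psi> (jet1 c t)) has_vector_derivative deriv \<tau> ?x *\<^sub>R total_field fb (\<psi> q)) (at ?x)"
    by (rule has_vector_derivative_transform_within_open[OF _ I x]) (use * in auto)
  from vector_derivative_unique_at[OF 1 2] that show thesis by blast
qed

text \<open>The image of a solution jet has velocity a nonzero multiple of the total field, so its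
  first component \<open>\<tau>\<close> can serve as parameter. In that parameter the velocity is
  exactly the total field: the third component is the derivative of the second and satisfies the
  equation.\<close>

lemma total_field_imp_maps_solutions:
  assumes \<psi>: "\<And>q. q \<in> V \<Longrightarrow> \<psi> differentiable (at q)" and im: "\<psi> ` V \<subseteq> Vb"
    and u: "\<And>q. q \<in> V \<Longrightarrow> u q \<noteq> 0"
    and D: "\<And>q. q \<in> V \<Longrightarrow> Df \<psi> q (total_field f q) = u q *\<^sub>R total_field fb (\<psi> q)"
  shows "maps_solutions f V fb Vb \<psi>"
  unfolding maps_solutions_def
proof (intro allI impI)
  fix I c assume c: "ode_solution f V I c"
  then have I: "open I" "is_interval I" and cV: "\<And>x. x \<in> I \<Longrightarrow> jet1 c x \<in> V"
    by (auto simp: ode_solution_def)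
  define \<gamma> where "\<gamma> x = \<psi> (jet1 c x)" for x
  define U where "U x = u (jet1 c x)" for x
  have U0: "U x \<noteq> 0" if "x \<in> I" for x using u cV that by (simp add: U_def)
  have d: "((\<lambda>t. \<gamma> t $ i) has_real_derivative U x * total_field fb (\<gamma> x) $ i) (at x)" if x: "x \<in> I" for x i
  proof -
    have "(\<psi> has_derivative Df \<psi> (jet1 c x)) (at (jet1 c x))"
      using \<psi>[OF cV[OF x]] frechet_derivative_works by blast
    moreover have "(jet1 c has_derivative (\<lambda>t. t *\<^sub>R total_field f (jet1 c x))) (at x)"
      using jet1_has_vector_derivative[OF c x] by (simp add: has_vector_derivative_def)
    ultimately have "(\<gamma> has_derivative (\<lambda>t. Df \<psi> (jet1 c x) (t *\<^sub>R total_field f (jet1 c x)))) (at x)"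
      using diff_chain_at[of "jet1 c" _ x \<psi>] by (simp add: o_def \<gamma>_def[abs_def])
    then have "(\<gamma> has_vector_derivative U x *\<^sub>R total_field fb (\<gamma> x)) (at x)"
      by (simp add: has_vector_derivative_def linear_scale[OF linear_frechet_derivative[OF \<psi>[OF cV[OF x]]]]
          D[OF cV[OF x]] U_def \<gamma>_def)
    from vec_nth_has_vector_derivative[OF this, of i] show ?thesis by simp
  qed
  define \<tau> where "\<tau> x = \<gamma> x $ 1" for x
  have d\<tau>: "(\<tau> has_real_derivative U x) (at x)" if "x \<in> I" for x
    using d[OF that, of 1] by (simp add: \<tau>_def[abs_def])
  have cont: "continuous_on I \<tau>"
    using d\<tau> by (intro continuous_at_imp_continuous_on) (auto intro: DERIV_isCont)
  \<comment> \<open>Rolle's theorem gives injectivity from the absence of zeros of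
    \<open>U\<close>.\<close>
  have inj: "inj_on \<tau> I"
  proof (rule inj_onI, rule ccontr)
    fix x y assume xy: "x \<in> I" "y \<in> I" "\<tau> x = \<tau> y" "x \<noteq> y"
    have "False" if "a \<in> I" "b \<in> I" "\<tau> a = \<tau> b" "a < b" for a b
    proof -
      have sub: "{a..b} \<subseteq> I" using mem_is_interval_1_I[OF I(2) that(1,2)] by auto
      have "\<exists>z. a < z \<and> z < b \<and> (*) (U z) = (\<lambda>v. 0)"
      proof (rule Rolle_deriv[OF \<open>a < b\<close> that(3) continuous_on_subset[OF cont sub]])
        fix z assume "a < z" "z < b"
        then have "z \<in> I" using sub by auto
        then show "(\<tau> has_derivative (*) (U z)) (at z)" using d\<tau> by (simp add: has_field_derivative_def)
      qed
      then obtain z where z: "a < z" "z < b" "(*) (U z) = (\<lambda>v. 0)" by blast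
      from fun_cong[OF z(3), of 1] have "U z = 0" by simp
      moreover have "z \<in> I" using sub z by auto
      ultimately show False using U0 by blast
    qed
    note * = this
    from \<open>x \<noteq> y\<close> consider "x < y" | "y < x" by linarith
    then show False
      by cases (rule *[OF xy(1,2,3)], assumption, rule *[OF xy(2,1) xy(3)[symmetric]], assumption)
  qed
  define J where "J = \<tau> ` I"
  define \<sigma> where "\<sigma> = the_inv_into I \<tau>"
  have \<sigma>: "\<sigma> (\<tau> x) = x" if "x \<in> I" for x unfolding \<sigma>_def by (rule the_inv_into_f_f[OF inj that])
  have J: "open J"
    using iffD1[OF injective_eq_1d_open_map_UNIV[OF cont I(2)] inj] I(1) by (simp add: J_def)
  have Ji: "is_interval J"
    unfolding J_def is_interval_connected_1 using I(2) cont
    by (intro connected_continuous_image) (auto simp: is_interval_connected_1)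
  have d\<sigma>: "(\<sigma> has_real_derivative inverse (U x)) (at (\<tau> x))" if x: "x \<in> I" for x
    unfolding has_field_derivative_def
    by (rule has_derivative_inverse_strong[OF I(1) x cont \<sigma> d\<tau>[OF x, unfolded has_field_derivative_def]])
      (use U0[OF x] in \<open>auto simp: fun_eq_iff\<close>)
  define cb where "cb y = \<gamma> (\<sigma> y) $ 2" for y
  have chain: "((\<lambda>y. \<gamma> (\<sigma> y) $ i) has_real_derivative total_field fb (\<gamma> x) $ i) (at (\<tau> x))" if x: "x \<in> I" for x i
  proof -
    have "((\<lambda>y. \<gamma> (\<sigma> y) $ i) has_real_derivative (U x * total_field fb (\<gamma> x) $ i) * inverse (U x)) (at (\<tau> x))"
      by (rule DERIV_chain2[OF _ d\<sigma>[OF x]]) (use d[OF x, of i] \<sigma>[OF x] in simp)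
    then show ?thesis using U0[OF x] by (simp add: field_simps)
  qed
  have dcb: "(cb has_real_derivative \<gamma> x $ 3) (at (\<tau> x))" if "x \<in> I" for x
    using chain[OF that, of 2] by (simp add: cb_def[abs_def])
  have jet: "jet1 cb (\<tau> x) = \<gamma> x" if x: "x \<in> I" for x
    using DERIV_imp_deriv[OF dcb[OF x]] by (simp add: jet1_def vec_eq_iff forall_3 \<tau>_def[symmetric] cb_def \<sigma>[OF x])
  have "ode_solution fb Vb J cb"
    unfolding ode_solution_def
  proof (intro conjI ballI J Ji)
    fix y assume "y \<in> J"
    then obtain x where x: "x \<in> I" "y = \<tau> x" by (auto simp: J_def)
    show "jet1 cb y \<in> Vb" using im cV[OF x(1)] by (auto simp: x jet \<gamma>_def)
    show "cb differentiable at y" using dcb[OF x(1)] unfolding x by (auto simp: real_differentiable_def)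
    have "((\<lambda>y. \<gamma> (\<sigma> y) $ 3) has_real_derivative fb (\<gamma> x)) (at y)" using chain[OF x(1), of 3] by (simp add: x)
    then show "(deriv cb has_real_derivative fb (jet1 cb y)) (at y)"
      unfolding x jet[OF x(1)]
    proof (rule has_field_derivative_transform_within_open[OF _ J])
      show "\<tau> x \<in> J" using x by (simp add: J_def)
      fix z assume "z \<in> J"
      then obtain x' where x': "x' \<in> I" "z = \<tau> x'" by (auto simp: J_def)
      show "\<gamma> (\<sigma> z) $ 3 = deriv cb z" unfolding x' by (simp add: DERIV_imp_deriv[OF dcb[OF x'(1)]] \<sigma>[OF x'(1)])
    qed
  qed
  moreover have "bij_betw \<tau> I J" using inj by (simp add: bij_betw_def J_def)
  moreover have "\<forall>x\<in>I. \<tau> differentiable at x \<and> deriv \<tau> x \<noteq> 0 \<and> \<psi> (jet1 c x) = jet1 cb (\<tau> x)"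
  proof (intro ballI conjI)
    fix x assume x: "x \<in> I"
    show "\<tau> differentiable at x" using d\<tau>[OF x] by (auto simp: real_differentiable_def)
    show "deriv \<tau> x \<noteq> 0" using DERIV_imp_deriv[OF d\<tau>[OF x]] U0[OF x] by simp
    show "\<psi> (jet1 c x) = jet1 cb (\<tau> x)" using jet[OF x] by (simp add: \<gamma>_def)
  qed
  ultimately show "\<exists>J cb \<tau>. ode_solution fb Vb J cb \<and> bij_betw \<tau> I J \<and>
      (\<forall>x\<in>I. \<tau> differentiable at x \<and> deriv \<tau> x \<noteq> 0 \<and> \<psi> (jet1 c x) = jet1 cb (\<tau> x))" by blast
qed

section \<open>Contact transformations and the bundle maps they induce\<close>

lemma analytic_diffeo_inverse:
  fixes \<psi> :: "'a::euclidean_space \<Rightarrow> 'b::euclidean_space"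
  assumes "analytic_diffeo \<psi> V Vb"
  obtains G where "analytic_diffeo G Vb V" "\<And>x. x \<in> V \<Longrightarrow> G (\<psi> x) = x" "\<And>y. y \<in> Vb \<Longrightarrow> \<psi> (G y) = y"
    "\<And>y v. y \<in> Vb \<Longrightarrow> Df \<psi> (G y) (Df G y v) = v"
proof -
  obtain G where G: "real_analytic_on G Vb" "G ` Vb = V" "\<forall>x\<in>V. G (\<psi> x) = x" "\<forall>y\<in>Vb. \<psi> (G y) = y"
    and \<psi>: "open V" "open Vb" "real_analytic_on \<psi> V" "\<psi> ` V = Vb"
    using assms unfolding analytic_diffeo_def by blast
  have "analytic_diffeo G Vb V" unfolding analytic_diffeo_def using G \<psi> by blast
  moreover have "Df \<psi> (G y) (Df G y v) = v" if y: "y \<in> Vb" for y v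
  proof -
    have "(G has_derivative Df G y) (at y)"
      "(\<psi> has_derivative Df \<psi> (G y)) (at (G y))"
      using G \<psi> y by (auto simp: real_analytic_on_def intro!: real_analytic_at_has_derivative)
    from diff_chain_at[OF this] have "((\<lambda>y. \<psi> (G y)) has_derivative
        (\<lambda>v. Df \<psi> (G y) (Df G y v))) (at y)" by (simp add: o_def)
    then have "((\<lambda>y. y) has_derivative (\<lambda>v. Df \<psi> (G y) (Df G y v))) (at y)"
      by (rule has_derivative_transform_within_open[OF _ \<psi>(2) y]) (use G in auto)
    from fun_cong[OF has_derivative_unique[OF this has_derivative_ident], of v] show ?thesis .
  qed
  ultimately show thesis using that G by blast
qed

text \<open>The coframe \<open>(\<eta>\<^sup>1, \<eta>\<^sup>2)\<close> pulls back along \<open>\<psi>\<close> by an element \<open>Hmat (u, w)\<close> of the structure group.\<close>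

definition contact_transf :: "(jet \<Rightarrow> jet) \<Rightarrow> jet set \<Rightarrow> (jet \<Rightarrow> real) \<Rightarrow> (jet \<Rightarrow> real) \<Rightarrow> bool" where
  "contact_transf \<psi> V u w \<longleftrightarrow> (\<forall>q\<in>V. u q \<noteq> 0 \<and>
     (\<forall>v. form_dx (\<psi> q) (Df \<psi> q v) = u q * form_dx q v - w q * form_contact q v \<and>
          form_contact (\<psi> q) (Df \<psi> q v) = form_contact q v / u q))"

text \<open>The inverse of \<open>Hmat (u, w)\<close> is \<open>Hmat (1 / u, - w)\<close>, here
  evaluated at the preimage.\<close>

lemma contact_transf_inverse:
  assumes "contact_transf \<psi> V u w" and G: "\<And>y. y \<in> Vb \<Longrightarrow> G y \<in> V" "\<And>y. y \<in> Vb \<Longrightarrow> \<psi> (G y) = y"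
    "\<And>y v. y \<in> Vb \<Longrightarrow> Df \<psi> (G y) (Df G y v) = v"
  shows "contact_transf G Vb (\<lambda>y. 1 / u (G y)) (\<lambda>y. - w (G y))"
  unfolding contact_transf_def
proof (intro ballI conjI allI)
  fix y assume y: "y \<in> Vb"
  have u: "u (G y) \<noteq> 0" using assms(1) G(1)[OF y] by (simp add: contact_transf_def)
  then show "1 / u (G y) \<noteq> 0" by simp
  fix v
  let ?v = "Df G y v"
  have a: "form_dx y v = u (G y) * form_dx (G y) ?v - w (G y) * form_contact (G y) ?v"
    and "form_contact y v = form_contact (G y) ?v / u (G y)"
    using assms(1) G(1)[OF y] unfolding contact_transf_def by (metis G(2)[OF y] G(3)[OF y])+
  then have b: "form_contact (G y) ?v = u (G y) * form_contact y v" using u by simp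
  show "form_dx (G y) ?v = 1 / u (G y) * form_dx y v - - w (G y) * form_contact y v"
    using u a unfolding b by (simp add: field_simps)
  show "form_contact (G y) ?v = form_contact y v / (1 / u (G y))" by (simp add: b)
qed

text \<open>
  \<open>1 / u\<close> is a polynomial in \<open>\<psi>\<close> and its first derivatives, which avoids reciprocals of
  analytic functions.
\<close>

lemma contact_transf_analytic:
  assumes c: "contact_transf \<psi> V u w" and V: "open V" and \<psi>: "real_analytic_on \<psi> V"
  shows "real_analytic_on u V" "real_analytic_on w V" "real_analytic_on (\<lambda>q. 1 / u q) V"
proof -
  let ?D = "\<lambda>v q. Df \<psi> q v"
  have A: "?D v q $ 1 = u q * v $ 1 - w q * (v $ 2 - q $ 3 * v $ 1)"
    and B: "?D v q $ 2 - \<psi> q $ 3 * ?D v q $ 1 = (v $ 2 - q $ 3 * v $ 1) / u q" if "q \<in> V" for q v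
    using c that unfolding contact_transf_def form_dx_def form_contact_def by blast+
  \<comment> \<open>First components of the images of \<open>(1, p, 0)\<close> and
    \<open>axis 2 1\<close> isolate \<open>u\<close> and \<open>- w\<close>; the contact form of the
    image of \<open>axis 2 1\<close> is \<open>1 / u\<close>.\<close>
  have *: "u q = ?D (axis 1 1) q $ 1 + q $ 3 * ?D (axis 2 1) q $ 1" "w q = - ?D (axis 2 1) q $ 1"
      "1 / u q = ?D (axis 2 1) q $ 2 - \<psi> q $ 3 * ?D (axis 2 1) q $ 1" if q: "q \<in> V" for q
    using B[OF q, of "axis 2 1"] by (simp_all add: A[OF q])
  have D: "real_analytic_at (\<lambda>q. ?D v q $ i) q" if q: "q \<in> V" for v i q
    using real_analytic_on_frechet_derivative[OF \<psi> V, of v] q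
    by (auto simp: real_analytic_on_def intro: real_analytic_at_vec_nth)
  have k: "real_analytic_at (\<lambda>q :: jet. q $ 3) q" for q
    by (rule real_analytic_at_linear_self) (simp add: linear_iff)
  have p: "real_analytic_at (\<lambda>q. \<psi> q $ 3) q" if "q \<in> V" for q
    using \<psi> that by (auto simp: real_analytic_on_def intro: real_analytic_at_vec_nth)
  show "real_analytic_on u V"
    by (rule iffD2[OF real_analytic_on_cong[OF V *(1)]], assumption, unfold real_analytic_on_def,
      intro ballI real_analytic_at_add real_analytic_at_mult D k)
  show "real_analytic_on w V"
    by (rule iffD2[OF real_analytic_on_cong[OF V *(2)]], assumption, unfold real_analytic_on_def,
      intro ballI real_analytic_at_uminus D)
  show "real_analytic_on (\<lambda>q. 1 / u q) V"
    by (rule iffD2[OF real_analytic_on_cong[OF V *(3)]], assumption, unfold real_analytic_on_def,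
      intro ballI real_analytic_at_diff real_analytic_at_mult D p)
qed

text \<open>Coordinates of the product \<open>Hmat (u, w) ** Hmat (u1, u3)\<close>; a left factor
  commutes with the right action. The reciprocal \<open>1 / u1\<close> stands as a separate factor
  because its analyticity is known.\<close>

definition bundle_lift :: "(jet \<Rightarrow> jet) \<Rightarrow> (jet \<Rightarrow> real) \<Rightarrow> (jet \<Rightarrow> real) \<Rightarrow> bpoint \<Rightarrow> bpoint" where
  "bundle_lift \<psi> u w b = (\<psi> (fst b), u (fst b) * fst (snd b), u (fst b) * snd (snd b) + w (fst b) * (1 / fst (snd b)))"

lemma real_analytic_on_bundle_lift:
  assumes "real_analytic_on \<psi> V" "real_analytic_on u V" "real_analytic_on w V"
  shows "real_analytic_on (bundle_lift \<psi> u w) (H_bundle V)"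
  unfolding real_analytic_on_def bundle_lift_def[abs_def]
  using assms unfolding real_analytic_on_def
  by (auto simp: mem_H_bundle simp del: times_divide_eq_right intro!: real_analytic_at_Pair real_analytic_at_add real_analytic_at_mult
      real_analytic_at_fst_compose real_analytic_at_fst_snd real_analytic_at_snd_snd real_analytic_at_inverse_u1)

text \<open>The inverse is again a \<open>bundle_lift\<close>, for the inverse map and the inverse
  cocycle, so its analyticity follows in the same way.\<close>

lemma bundle_map_bundle_lift:
  assumes \<psi>: "analytic_diffeo \<psi> V Vb" and c: "contact_transf \<psi> V u w"
  shows "bundle_map V Vb \<psi> (bundle_lift \<psi> u w)"
proof -
  obtain G where G: "analytic_diffeo G Vb V" and inv: "\<And>x. x \<in> V \<Longrightarrow> G (\<psi> x) = x" "\<And>y. y \<in> Vb \<Longrightarrow> \<psi> (G y) = y"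
    and D: "\<And>y v. y \<in> Vb \<Longrightarrow> Df \<psi> (G y) (Df G y v) = v"
    using analytic_diffeo_inverse[OF \<psi>] by blast
  have V: "open V" "open Vb" "real_analytic_on \<psi> V" "\<psi> ` V = Vb" and GV: "real_analytic_on G Vb" "G ` Vb = V"
    using \<psi> G by (auto simp: analytic_diffeo_def)
  have u: "u q \<noteq> 0" if "q \<in> V" for q using c that by (simp add: contact_transf_def)
  have cG: "contact_transf G Vb (\<lambda>y. 1 / u (G y)) (\<lambda>y. - w (G y))"
    by (rule contact_transf_inverse[OF c _ inv(2) D]) (use GV in auto)
  let ?F = "bundle_lift \<psi> u w"
  let ?E = "bundle_lift G (\<lambda>y. 1 / u (G y)) (\<lambda>y. - w (G y))"
  have F: "?F b \<in> H_bundle Vb" "?E (?F b) = b" if "b \<in> H_bundle V" for b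
    using that u[of "fst b"] V(4) inv(1) by (cases b, force simp: mem_H_bundle bundle_lift_def field_simps)+
  have E: "?E b \<in> H_bundle V" "?F (?E b) = b" if "b \<in> H_bundle Vb" for b
    using that u[of "G (fst b)"] GV(2) inv(2) by (cases b, force simp: mem_H_bundle bundle_lift_def field_simps)+
  have "analytic_diffeo ?F (H_bundle V) (H_bundle Vb)"
    unfolding analytic_diffeo_def
  proof (intro conjI exI[of _ ?E] ballI)
    show "?F ` H_bundle V = H_bundle Vb" "?E ` H_bundle Vb = H_bundle V"
      using F E by (auto simp: image_iff) metis+
    show "real_analytic_on ?F (H_bundle V)"
      by (rule real_analytic_on_bundle_lift) (use V contact_transf_analytic[OF c V(1,3)] in auto)
    show "real_analytic_on ?E (H_bundle Vb)"
      by (rule real_analytic_on_bundle_lift[OF GV(1) contact_transf_analytic(1,2)[OF cG V(2) GV(1)]])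
  qed (use F E V in \<open>auto intro: open_H_bundle\<close>)
  moreover have "?F (ract b T) = ract (?F b) T" if b: "b \<in> H_bundle V" and T: "T \<in> Hgrp" for b T
  proof -
    obtain t1 t3 where t: "T = Hmat (t1, t3)" "t1 \<noteq> 0" using T by (auto simp: Hgrp_def)
    obtain q u1 u3 where bq: "b = (q, u1, u3)" by (cases b)
    have nz: "u1 \<noteq> 0" "u q \<noteq> 0" using b u by (auto simp: bq mem_H_bundle)
    show ?thesis
      using nz t(2) by (simp add: bq t(1) bundle_lift_def ract_explicit Hmat_entries) (simp add: field_simps)
  qed
  ultimately show ?thesis
    unfolding bundle_map_def using \<psi> by (auto simp: bundle_lift_def)
qed

lemma analytic_Hmat_cocycle:
  assumes "contact_transf \<psi> V u w" "open V" "real_analytic_on \<psi> V"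
  shows "real_analytic_on (\<lambda>q. Hmat (u q, w q)) V" "real_analytic_on (\<lambda>q. Hmat (1 / u q, - w q)) V"
  using contact_transf_analytic[OF assms] unfolding real_analytic_on_def
  by (auto intro!: real_analytic_at_Hmat real_analytic_at_uminus)

lemma frechet_derivative_cocycle:
  assumes "contact_transf \<psi> V u w" "open V" "real_analytic_on \<psi> V" "q \<in> V"
  shows "Df (\<lambda>q. Hmat (u q, w q)) q v =
    dHmat (u q, w q) (Df u q v, Df w q v)"
proof -
  note an = contact_transf_analytic[OF assms(1-3)]
  have "(u has_derivative Df u q) (at q)" "(w has_derivative Df w q) (at q)"
    using an assms(4) by (auto simp: real_analytic_on_def intro: real_analytic_at_has_derivative)
  then have d: "((\<lambda>q. (u q, w q)) has_derivative (\<lambda>v. (Df u q v, Df w q v))) (at q)"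
    by (rule has_derivative_Pair)
  have "fst (u q, w q) \<noteq> 0" using assms(1,4) by (simp add: contact_transf_def)
  from diff_chain_at[OF d has_derivative_Hmat[OF this]] have
    "((\<lambda>q. Hmat (u q, w q)) has_derivative (\<lambda>v. dHmat (u q, w q) (Df u q v, Df w q v))) (at q)"
    by (simp add: o_def)
  from fun_cong[OF frechet_derivative_at[OF this]] show ?thesis by simp
qed

lemma fst_frechet_derivative_covering:
  fixes F :: "bpoint \<Rightarrow> bpoint" and \<psi> :: "jet \<Rightarrow> jet"
  assumes V: "open V" and b: "b \<in> H_bundle V" and F: "F differentiable (at b)" and \<psi>: "\<psi> differentiable (at (fst b))"
    and cov: "\<And>b. b \<in> H_bundle V \<Longrightarrow> fst (F b) = \<psi> (fst b)"
  shows "fst (Df F b v) = Df \<psi> (fst b) (fst v)"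
proof -
  have "(F has_derivative Df F b) (at b)" using F frechet_derivative_works by blast
  then have "((\<lambda>b. fst (F b)) has_derivative (\<lambda>v. fst (Df F b v))) (at b)"
    by (rule has_derivative_fst)
  then have 1: "((\<lambda>b. \<psi> (fst b)) has_derivative (\<lambda>v. fst (Df F b v))) (at b)"
    by (rule has_derivative_transform_within_open[OF _ open_H_bundle[OF V] b]) (rule cov)
  have "(\<psi> has_derivative Df \<psi> (fst b)) (at (fst b))"
    using \<psi> frechet_derivative_works by blast
  moreover have "(fst has_derivative fst) (at b)" by (intro derivative_intros)
  ultimately have 2: "((\<lambda>b. \<psi> (fst b)) has_derivative (\<lambda>v. Df \<psi> (fst b) (fst v))) (at b)"
    using diff_chain_at[of fst fst b \<psi>] by (simp add: o_def)
  from fun_cong[OF has_derivative_unique[OF 1 2], of v] show ?thesis .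
qed

text \<open>With \<open>S\<^sub>0 = Hmat (u, w)\<close>, the product rule for
  \<open>S\<^sub>0 S\<close> splits the Maurer-Cartan term into that of the fibre and the conjugate
  of \<open>S\<^sub>0\<inverse> dS\<^sub>0\<close>; the latter is absorbed by the gauge transform on
  the base.\<close>

lemma pullback_bundle_lift:
  assumes c: "contact_transf \<psi> V u w" and V: "open V" and \<psi>: "real_analytic_on \<psi> V" and b: "b \<in> H_bundle V"
  shows "pullback (bundle_lift \<psi> u w) (lift \<eta>) b v =
    lift (gauge \<psi> (\<lambda>q. Hmat (u q, w q)) (\<lambda>q. Hmat (1 / u q, - w q)) \<eta>) b v"
proof -
  let ?F = "bundle_lift \<psi> u w"
  let ?S = "\<lambda>q. Hmat (u q, w q)" and ?T = "\<lambda>q. Hmat (1 / u q, - w q)"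
  obtain q u1 u3 where bq: "b = (q, u1, u3)" by (cases b)
  have q: "q \<in> V" and u1: "u1 \<noteq> 0" using b by (auto simp: bq mem_H_bundle)
  have uq: "u q \<noteq> 0" if "q \<in> V" for q using c that by (simp add: contact_transf_def)
  have open_HV: "open (H_bundle V)" by (rule open_H_bundle[OF V])
  let ?DF = "Df ?F b"
  have DF: "(?F has_derivative ?DF) (at b)"
    using real_analytic_on_bundle_lift[OF \<psi> contact_transf_analytic(1,2)[OF c V \<psi>]] b
    by (auto simp: real_analytic_on_def intro: real_analytic_at_has_derivative)
  have "(fst has_derivative fst) (at b)" by (intro derivative_intros)
  have "fst (?DF v) = Df \<psi> (fst b) (fst v)"
    by (rule fst_frechet_derivative_covering[OF V b])
      (use DF real_analytic_on_imp_differentiable[OF \<psi> q] in \<open>auto simp: bq differentiable_def bundle_lift_def\<close>)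
  then have 1: "fst (?DF v) = Df \<psi> q (fst v)" by (simp add: bq)
  have HF: "Hmat (snd (?F b)) = ?S (fst b) ** Hmat (snd b)" if "b \<in> H_bundle V" for b
    using that uq[of "fst b"] Hmat_mult[of "u (fst b)" "fst (snd b)" "w (fst b)" "snd (snd b)"]
    by (simp add: mem_H_bundle bundle_lift_def)
  \<comment> \<open>Both sides differentiate the same map, read once as \<open>Hmat\<close> after
    \<open>bundle_lift\<close> and once as a matrix product.\<close>
  have 2: "dHmat (snd (?F b)) (snd (?DF v)) =
      ?S q ** dHmat (u1, u3) (snd v) + Df ?S q (fst v) ** Hmat (u1, u3)"
  proof -
    have "((\<lambda>b. snd (?F b)) has_derivative (\<lambda>v. snd (?DF v))) (at b)" by (intro derivative_intros DF)
    moreover have "fst (snd (?F b)) \<noteq> 0" using uq[OF q] u1 by (simp add: bundle_lift_def bq)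
    ultimately have "((\<lambda>b. Hmat (snd (?F b))) has_derivative (\<lambda>v. dHmat (snd (?F b)) (snd (?DF v)))) (at b)"
      using diff_chain_at[of "\<lambda>b. snd (?F b)" "\<lambda>v. snd (?DF v)" b Hmat "dHmat (snd (?F b))"] has_derivative_Hmat[of "snd (?F b)"]
      by (simp add: o_def)
    then have A: "((\<lambda>b. ?S (fst b) ** Hmat (snd b)) has_derivative (\<lambda>v. dHmat (snd (?F b)) (snd (?DF v)))) (at b)"
      by (rule has_derivative_transform_within_open[OF _ open_HV b]) (rule HF)
    have "(?S has_derivative Df ?S q) (at (fst b))"
      using analytic_Hmat_cocycle[OF c V \<psi>] q by (auto simp: bq real_analytic_on_def intro: real_analytic_at_has_derivative)
    from diff_chain_at[OF \<open>(fst has_derivative fst) (at b)\<close> this]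
    have "((\<lambda>b. ?S (fst b)) has_derivative (\<lambda>v. Df ?S q (fst v))) (at b)" by (simp add: o_def)
    from mm.FDERIV[OF this has_derivative_Hmat_snd[of b]] u1
    have B: "((\<lambda>b. ?S (fst b) ** Hmat (snd b)) has_derivative
        (\<lambda>v. ?S (fst b) ** dHmat (snd b) (snd v) + Df ?S q (fst v) ** Hmat (snd b))) (at b)"
      by (simp add: bq)
    from fun_cong[OF has_derivative_unique[OF A B], of v] show ?thesis by (simp add: bq)
  qed
  have Fb: "?F b = (\<psi> q, u q * u1, u q * u3 + w q / u1)" by (simp add: bundle_lift_def bq)
  have ne: "u q * u1 \<noteq> 0" using uq[OF q] u1 by simp
  have T: "Hmat (1 / (u q * u1), - (u q * u3 + w q / u1)) = Hmat (1 / u1, - u3) ** ?T q"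
  proof -
    have "- (u q * u3 + w q / u1) = 1 / u1 * - w q + - u3 / (1 / u q)" using uq[OF q] by (simp add: field_simps)
    then show ?thesis using uq[OF q] u1 by (subst Hmat_mult) (simp_all add: algebra_simps)
  qed
  have TS: "?T q ** ?S q = mat 1" using Hmat_inverse(2)[OF uq[OF q]] .
  have S: "Hmat (u q * u1, u q * u3 + w q / u1) = ?S q ** Hmat (u1, u3)"
    using HF[OF b] by (simp add: Fb) (simp add: bq)
  have L: "lift \<eta> (?F b) x = Hmat (1 / (u q * u1), - (u q * u3 + w q / u1)) ** \<eta> (\<psi> q) (fst x) ** Hmat (u q * u1, u q * u3 + w q / u1)
      + Hmat (1 / (u q * u1), - (u q * u3 + w q / u1)) ** dHmat (snd (?F b)) (snd x)" for x
    unfolding Fb lift_explicit[OF ne] snd_conv using maurer_cartan_Hmat[OF ne, of "u q * u3 + w q / u1" "fst (snd x)" "snd (snd x)"] by simp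
  have M: "lift \<eta>' b v = Hmat (1 / u1, - u3) ** \<eta>' q (fst v) ** Hmat (u1, u3) + Hmat (1 / u1, - u3) ** dHmat (u1, u3) (snd v)" for \<eta>'
    unfolding bq lift_explicit[OF u1] using maurer_cartan_Hmat[OF u1, of u3 "fst (snd v)" "snd (snd v)"] by simp
  have TS': "X ** ?T q ** ?S q = X" for X :: mat3 by (simp add: TS flip: matrix_mul_assoc)
  show ?thesis
    unfolding pullback_def[of ?F] L 1 2 S T M gauge_def pullback_def[of \<psi>]
    by (simp add: mm.add_left mm.add_right matrix_mul_assoc TS')
qed

lemma form_kernel:
  assumes "form_dx q v = 0" "form_contact q v = 0"
  shows "v $ 1 = 0" "v $ 2 = 0"
  using assms by (simp_all add: form_dx_def form_contact_def)

text \<open>By \<open>tf\<close> the transformed entry (3,2) vanishes on the total field, and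
  \<open>e3\<close> normalises it to 1 on \<open>axis 3 1\<close>; the rest is a multiple of the
  contact form, which defines \<open>\<mu>\<close>. The curvature conditions carry over because
  conjugation by the group preserves the shape of the curvature.\<close>

lemma gauge_normal_form:
  assumes c: "contact_transf \<psi> V u w" and V: "open V" and \<psi>: "real_analytic_on \<psi> V"
    and Ub: "open Ub" "\<psi> ` V \<subseteq> Ub" and fb: "real_analytic_on fb Ub" and f: "real_analytic_on f V"
    and pde: "\<forall>q\<in>Ub. d_y fb q + (2/9) * (d_p fb q)\<^sup>2 - (1/3) * total_D fb (d_p fb) q = 0"
    and tf: "\<And>q. q \<in> V \<Longrightarrow> \<exists>k. Df \<psi> q (total_field f q) = k *\<^sub>R total_field fb (\<psi> q)"
    and e3: "\<And>q. q \<in> V \<Longrightarrow> Df \<psi> q (axis 3 1) $ 3 = 1 / (u q)\<^sup>2"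
    and q: "q \<in> V"
  shows "gauge \<psi> (\<lambda>q. Hmat (u q, w q)) (\<lambda>q. Hmat (1 / u q, - w q)) (normal_form fb) q v = normal_form f q v"
proof -
  let ?S = "\<lambda>q. Hmat (u q, w q)" and ?T = "\<lambda>q. Hmat (1 / u q, - w q)"
  let ?N = "normal_form fb"
  define \<eta> where "\<eta> = gauge \<psi> ?S ?T ?N"
  let ?D = "\<lambda>q. Df \<psi> q"
  have u: "u q \<noteq> 0" and cd: "form_dx (\<psi> q) (?D q v) = u q * form_dx q v - w q * form_contact q v"
    and cc: "form_contact (\<psi> q) (?D q v) = form_contact q v / u q" if "q \<in> V" for q v
    using c that unfolding contact_transf_def by blast+
  note an = analytic_Hmat_cocycle[OF c V \<psi>]
  note Nd = analytic_form1_imp_diff_form1[OF analytic_form1_normal_form[OF Ub(1) fb]]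
  have inv: "?T z ** ?S z = mat 1" "?S z ** ?T z = mat 1" if "z \<in> V" for z
    using Hmat_inverse[OF u[OF that]] by auto
  \<comment> \<open>The Maurer-Cartan term may stay anonymous: it has trace zero and does not affect
    the entries (2,1), (3,1), (3,2).\<close>
  have ex: "\<exists>a b. \<eta> q v = Hmat (1 / u q, - w q) ** ?N (\<psi> q) (?D q v) ** Hmat (u q, w q) + Hlie a b" if q: "q \<in> V" for q v
    unfolding \<eta>_def gauge_def pullback_def frechet_derivative_cocycle[OF c V \<psi> q] maurer_cartan_Hmat[OF u[OF q]] by blast
  note E = conj_Hmat_entries[OF u normal_form_entries(1)]
  have ent: "\<eta> q v $ 1 = 0" "\<eta> q v $ 2 $ 1 = form_dx q v" "\<eta> q v $ 3 $ 1 = form_contact q v"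
    "\<eta> q v $ 3 $ 2 = (u q)\<^sup>2 * form_Pi fb (mu_of fb) (\<psi> q) (?D q v)" "\<eta> q v $ 2 $ 2 + \<eta> q v $ 3 $ 3 = 0" if q: "q \<in> V" for q v
  proof -
    obtain a b where ab: "\<eta> q v = Hmat (1 / u q, - w q) ** ?N (\<psi> q) (?D q v) ** Hmat (u q, w q) + Hlie a b"
      using ex[OF q] by blast
    have tr: "?N (\<psi> q) (?D q v) $ 2 $ 2 + ?N (\<psi> q) (?D q v) $ 3 $ 3 = 0"
      using normal_form_asl2 by (simp add: asl2_def)
    show "\<eta> q v $ 1 = 0" "\<eta> q v $ 2 $ 1 = form_dx q v" "\<eta> q v $ 3 $ 1 = form_contact q v"
      "\<eta> q v $ 3 $ 2 = (u q)\<^sup>2 * form_Pi fb (mu_of fb) (\<psi> q) (?D q v)"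
      unfolding ab using u[OF q] by (simp_all add: E[OF q] normal_form_entries cd[OF q] cc[OF q] diff_divide_distrib)
    show "\<eta> q v $ 2 $ 2 + \<eta> q v $ 3 $ 3 = 0" unfolding ab using tr by (simp add: E[OF q])
  qed
  define \<mu> where "\<mu> = (\<lambda>q. \<eta> q (axis 2 1) $ 3 $ 2)"
  have lin: "linear (\<eta> q)" if q: "q \<in> V" for q
    unfolding \<eta>_def normal_form_def
    by (rule linear_gauge[OF linear_conn_form])
      (use real_analytic_on_imp_differentiable[OF \<psi> q] real_analytic_on_imp_differentiable[OF an(1) q] in auto)
  have Pi: "\<eta> q v $ 3 $ 2 = form_Pi f \<mu> q v" if q: "q \<in> V" for q v
  proof -
    obtain k where k: "?D q (total_field f q) = k *\<^sub>R total_field fb (\<psi> q)" using tf[OF q] by blast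
    have 1: "\<eta> q (total_field f q) $ 3 $ 2 = 0"
      unfolding ent(4)[OF q] k by (simp add: form_Pi_def)
    have "form_dx (\<psi> q) (?D q (axis 3 1)) = 0" "form_contact (\<psi> q) (?D q (axis 3 1)) = 0"
      unfolding cd[OF q] cc[OF q] by (simp_all add: form_dx_def form_contact_def)
    note k3 = form_kernel[OF this]
    have 3: "\<eta> q (axis 3 1) $ 3 $ 2 = 1"
      unfolding ent(4)[OF q] using u[OF q] by (simp add: form_Pi_def k3 e3[OF q])
    have "\<eta> q v = v $ 1 *\<^sub>R \<eta> q (total_field f q) + form_contact q v *\<^sub>R \<eta> q (axis 2 1) + (v $ 3 - f q * v $ 1) *\<^sub>R \<eta> q (axis 3 1)"
      by (subst jet_decompose[of v f q]) (simp only: linear_add[OF lin[OF q]] linear_scale[OF lin[OF q]])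
    then have "\<eta> q v $ 3 $ 2 = form_contact q v * \<mu> q + (v $ 3 - f q * v $ 1)"
      by (simp add: 1 3 \<mu>_def)
    then show ?thesis by (simp add: form_Pi_def form_contact_def mult.commute)
  qed
  have dif: "(\<lambda>z. \<eta> z v) differentiable (at q)" if q: "q \<in> V" for q v
    unfolding \<eta>_def
    by (rule differentiable_gauge[OF V q \<psi> Ub Nd an(1) real_analytic_on_imp_differentiable[OF an(2) q] inv])
  have \<mu>: "\<mu> differentiable (at q)" if q: "q \<in> V" for q
  proof -
    obtain D where "((\<lambda>z. \<eta> z (axis 2 1)) has_derivative D) (at q)" using dif[OF q] by (auto simp: differentiable_def)
    then have "((\<lambda>z. \<eta> z (axis 2 1) $ 3 $ 2) has_derivative (\<lambda>v. D v $ 3 $ 2)) (at q)"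
      by (intro bounded_linear.has_derivative[OF bounded_linear_vec_nth])
    then show ?thesis unfolding \<mu>_def differentiable_def by blast
  qed
  \<comment> \<open>Normality does not constrain the entry (2,3), so it is left unspecified. The
    diagonal is a multiple of the pulled back \<open>dx \<and> \<kappa>\<close>, with
    \<open>\<kappa>\<close> the contact form, which vanishes as soon as one argument is
    \<open>axis 3 1\<close>.\<close>
  have curv: "\<exists>b. curvature \<eta> q x y = Hlie (J1 fb (\<psi> q) * wedge form_dx form_contact (\<psi> q) (?D q x) (?D q y)) b"
    if "q \<in> V" for q x y
  proof -
    have "\<psi> q \<in> Ub" using that Ub(2) by blast
    note C = curvature_normal_form[OF Ub(1) fb this pde[rule_format, OF this]]
    have "curvature \<eta> q x y = Hmat (1 / u q, - w q) ** curvature ?N (\<psi> q) (?D q x) (?D q y) ** Hmat (u q, w q)"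
      unfolding \<eta>_def
      by (rule curvature_gauge[OF V that \<psi> Ub Nd an(1) real_analytic_on_imp_differentiable[OF an(2) that] inv])
    then show ?thesis unfolding C conj_Hlie[OF u[OF that]] by blast
  qed
  have "\<eta> q v = normal_form f q v"
  proof (rule normal_form_unique[OF V f _ _ _ _ _ _ _ _ _ q, of \<eta> \<mu>])
    show "diff_form1 \<eta> V" unfolding diff_form1_def using lin dif by blast
    show "\<And>q v. q \<in> V \<Longrightarrow> \<eta> q v \<in> asl2" unfolding asl2_def using ent(1,5) by blast
    show "curvature \<eta> q x y $ 2 $ 1 = 0" "curvature \<eta> q x y $ 3 $ 1 = 0" if "q \<in> V" for q x y
      using curv[OF that, of x y] by auto
    show "curvature \<eta> q v (axis 3 1) $ i $ 2 = 0" if "q \<in> V" "i \<in> {2, 3}" for q v i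
    proof -
      have "wedge form_dx form_contact (\<psi> q) (?D q v) (?D q (axis 3 1)) = 0"
        unfolding wedge_def cd[OF that(1)] cc[OF that(1)] by (simp add: form_dx_def form_contact_def)
      then show ?thesis using curv[OF that(1), of v "axis 3 1"] that(2) by auto
    qed
  qed (use ent Pi \<mu> in auto)
  then show ?thesis by (simp add: \<eta>_def)
qed

section \<open>Prolongations of plane maps as contact transformations\<close>

lemma plane_proj_nth [simp]: "plane_proj r $ 1 = r $ 1" "plane_proj r $ 2 = r $ 2"
  by (simp_all add: plane_proj_def)

lemma linear_plane_proj: "linear plane_proj"
  by (rule linearI) (simp_all add: vec_eq_iff forall_2)

lemma frechet_derivative_via_plane:
  fixes h :: "real^2 \<Rightarrow> real"
  assumes V: "open V" "r \<in> V" and g: "\<And>r. r \<in> V \<Longrightarrow> g r = h (plane_proj r)"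
    and h: "h differentiable (at (plane_proj r))"
  shows "Df g r v = partial 1 h (plane_proj r) * v $ 1 + partial 2 h (plane_proj r) * v $ 2"
proof -
  let ?D = "Df h (plane_proj r)"
  have l: "linear ?D" by (rule linear_frechet_derivative[OF h])
  have "(h has_derivative ?D) (at (plane_proj r))" using h frechet_derivative_works by blast
  from diff_chain_at[OF linear_imp_has_derivative[OF linear_plane_proj] this]
  have "((\<lambda>r. h (plane_proj r)) has_derivative (\<lambda>v. ?D (plane_proj v))) (at r)" by (simp add: o_def)
  then have "(g has_derivative (\<lambda>v. ?D (plane_proj v))) (at r)"
    by (rule has_derivative_transform_within_open[OF _ V]) (simp add: g)
  from fun_cong[OF frechet_derivative_at[OF this]] have "Df g r v = ?D (plane_proj v)" by simp
  also have "plane_proj v = v $ 1 *\<^sub>R axis 1 1 + v $ 2 *\<^sub>R axis 2 1"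
    by (simp add: vec_eq_iff forall_2 axis_def)
  finally show ?thesis
    by (simp add: linear_add[OF l] linear_scale[OF l] partial_eq_frechet[OF h] mult.commute)
qed

text \<open>Here \<open>u\<close> is the denominator of the prolongation and \<open>w\<close> is
  minus the \<open>y\<close>-derivative of the first component of \<open>\<Phi>\<close>. The contact
  form is multiplied by the Jacobian over \<open>u\<close>, and the \<open>p\<close>-derivative of
  the third coordinate is the Jacobian over \<open>u\<^sup>2\<close>; area preservation makes the
  Jacobian 1.\<close>

lemma prolongation_imp_contact_transf:
  assumes V: "open V" and \<psi>: "real_analytic_on \<psi> V" and ap: "is_area_preserving_prolongation \<psi> V"
  obtains u w where "contact_transf \<psi> V u w"
    "\<And>q. q \<in> V \<Longrightarrow> Df \<psi> q (axis 3 1) $ 3 = 1 / (u q)\<^sup>2"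
proof -
  obtain W \<Phi> where W: "plane_proj ` V \<subseteq> W" and \<Phi>: "analytic_diffeo \<Phi> W (\<Phi> ` W)"
    and J: "\<forall>z\<in>W. plane_jacobian \<Phi> z = 1"
    and P: "\<forall>r\<in>V. prolong_denom \<Phi> r \<noteq> 0 \<and> \<psi> r = prolong1 \<Phi> r"
    using ap unfolding is_area_preserving_prolongation_def by blast
  define X1 where "X1 r = partial 1 (\<lambda>z. \<Phi> z $ 1) (plane_proj r)" for r
  define X2 where "X2 r = partial 2 (\<lambda>z. \<Phi> z $ 1) (plane_proj r)" for r
  define Y1 where "Y1 r = partial 1 (\<lambda>z. \<Phi> z $ 2) (plane_proj r)" for r
  define Y2 where "Y2 r = partial 2 (\<lambda>z. \<Phi> z $ 2) (plane_proj r)" for r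
  define u where "u r = X1 r + r $ 3 * X2 r" for r
  have u: "prolong_denom \<Phi> r = u r" for r by (simp add: prolong_denom_def u_def X1_def X2_def Let_def)
  have u0: "u r \<noteq> 0" if "r \<in> V" for r using P that by (simp add: u)
  have \<psi>_nth: "\<psi> r $ 1 = \<Phi> (plane_proj r) $ 1" "\<psi> r $ 2 = \<Phi> (plane_proj r) $ 2"
    "\<psi> r $ 3 = (Y1 r + r $ 3 * Y2 r) / u r" if "r \<in> V" for r
    using P that by (simp_all add: prolong1_def Let_def Y1_def Y2_def u)
  have J: "X1 r * Y2 r - X2 r * Y1 r = 1" if "r \<in> V" for r
    using J W that unfolding plane_jacobian_def Let_def X1_def X2_def Y1_def Y2_def by blast
  have \<Phi>d: "(\<lambda>z. \<Phi> z $ i) differentiable (at (plane_proj r))" if "r \<in> V" for r i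
  proof -
    have "real_analytic_at \<Phi> (plane_proj r)" using \<Phi> W that by (auto simp: analytic_diffeo_def real_analytic_on_def)
    then show ?thesis by (intro real_analytic_at_differentiable real_analytic_at_vec_nth)
  qed
  note \<psi>d = real_analytic_on_imp_differentiable[OF \<psi>]
  have D: "Df \<psi> r v $ 1 = X1 r * v $ 1 + X2 r * v $ 2"
    "Df \<psi> r v $ 2 = Y1 r * v $ 1 + Y2 r * v $ 2" if r: "r \<in> V" for r v
    unfolding frechet_derivative_vec_nth[OF \<psi>d[OF r], symmetric] X1_def X2_def Y1_def Y2_def
    by (rule frechet_derivative_via_plane[OF V r _ \<Phi>d[OF r]]; simp add: \<psi>_nth)+
  have "contact_transf \<psi> V u (\<lambda>r. - X2 r)"
    unfolding contact_transf_def
  proof (intro ballI conjI allI)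
    fix r v assume r: "r \<in> V"
    show "u r \<noteq> 0" by (rule u0[OF r])
    show "form_dx (\<psi> r) (Df \<psi> r v) = u r * form_dx r v - - X2 r * form_contact r v"
      by (simp add: form_dx_def form_contact_def D[OF r] u_def algebra_simps)
    have "u r * (Y1 r * v $ 1 + Y2 r * v $ 2) - (Y1 r + r $ 3 * Y2 r) * (X1 r * v $ 1 + X2 r * v $ 2)
        = (X1 r * Y2 r - X2 r * Y1 r) * (v $ 2 - r $ 3 * v $ 1)"
      by (simp add: u_def algebra_simps)
    then have "u r * (Y1 r * v $ 1 + Y2 r * v $ 2) - (Y1 r + r $ 3 * Y2 r) * (X1 r * v $ 1 + X2 r * v $ 2) = v $ 2 - r $ 3 * v $ 1"
      by (simp add: J[OF r])
    then show "form_contact (\<psi> r) (Df \<psi> r v) = form_contact r v / u r"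
      using u0[OF r] unfolding form_contact_def D[OF r] \<psi>_nth[OF r] by (simp add: field_simps)
  qed
  moreover have "Df \<psi> r (axis 3 1) $ 3 = 1 / (u r)\<^sup>2" if r: "r \<in> V" for r
  proof -
    have "(\<lambda>r. \<psi> r $ 3) differentiable (at r)"
      using \<psi> r by (auto simp: real_analytic_on_def intro!: real_analytic_at_differentiable real_analytic_at_vec_nth)
    then have "Df \<psi> r (axis 3 1) $ 3 = d_p (\<lambda>r. \<psi> r $ 3) r"
      by (simp add: partial_eq_frechet frechet_derivative_vec_nth[OF \<psi>d[OF r]])
    also have "\<dots> = d_p (\<lambda>r. (Y1 r + r $ 3 * Y2 r) / u r) r"
      by (rule partial_cong_open[OF V r]) (rule \<psi>_nth)
    \<comment> \<open>Along the fibre the point of the plane is fixed, so the quotient is a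
      fractional linear function of \<open>t\<close>.\<close>
    also have "\<dots> = deriv (\<lambda>t. (Y1 r + (r $ 3 + t) * Y2 r) / (X1 r + (r $ 3 + t) * X2 r)) 0"
    proof -
      have "plane_proj (r + t *\<^sub>R axis 3 1) = plane_proj r" for t :: real by (simp add: vec_eq_iff forall_2)
      then show ?thesis unfolding partial_def u_def X1_def X2_def Y1_def Y2_def by simp
    qed
    also have "\<dots> = 1 / (u r)\<^sup>2"
    proof (rule DERIV_imp_deriv)
      have "((\<lambda>t. (Y1 r + (r $ 3 + t) * Y2 r) / (X1 r + (r $ 3 + t) * X2 r)) has_real_derivative
        (Y2 r * u r - (Y1 r + r $ 3 * Y2 r) * X2 r) / (u r * u r)) (at 0)"
        using u0[OF r] unfolding u_def by (auto intro!: derivative_eq_intros)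
      moreover have "Y2 r * u r - (Y1 r + r $ 3 * Y2 r) * X2 r = 1" using J[OF r] by (simp add: u_def algebra_simps)
      ultimately show "((\<lambda>t. (Y1 r + (r $ 3 + t) * Y2 r) / (X1 r + (r $ 3 + t) * X2 r)) has_real_derivative 1 / (u r)\<^sup>2) (at 0)"
        by (simp add: power2_eq_square)
    qed
    finally show ?thesis .
  qed
  ultimately show thesis using that by blast
qed

text \<open>The pulled back \<open>dx\<close> and contact form vanish on the fibre direction, so the
  first two components of \<open>\<psi>\<close> have derivative 0 along fibres. A ball meets each
  fibre in an interval, so they are constant there; replacing \<open>r $ 3\<close> by
  \<open>q $ 3\<close> does not increase the distance to the centre.\<close>

lemma plane_proj_constant_on_fibres:
  assumes c: "contact_transf \<psi> V u w" and \<psi>: "real_analytic_on \<psi> V" and B: "ball q e \<subseteq> V" and r: "r \<in> ball q e"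
  shows "vector [r $ 1, r $ 2, q $ 3] \<in> ball q e"
    and "plane_proj (\<psi> (vector [r $ 1, r $ 2, q $ 3])) = plane_proj (\<psi> r)"
proof -
  let ?r = "\<lambda>t. r + t *\<^sub>R axis 3 1 :: jet"
  let ?r' = "vector [r $ 1, r $ 2, q $ 3] :: jet"
  have r': "?r' = ?r (q $ 3 - r $ 3)" by (simp add: vec_eq_iff forall_3)
  have "norm (q - ?r') \<le> norm (q - r)"
  proof (rule norm_le_componentwise_cart)
    have "\<forall>i. norm ((q - ?r') $ i) \<le> norm ((q - r) $ i)" unfolding forall_3 by simp
    then show "norm ((q - ?r') $ i) \<le> norm ((q - r) $ i)" for i by blast
  qed
  then show r'B: "?r' \<in> ball q e" using r by (simp add: dist_norm)
  let ?I = "{t. ?r t \<in> ball q e}"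
  have cI: "convex ?I"
  proof (rule convexI)
    fix s t a b :: real assume st: "s \<in> ?I" "t \<in> ?I" and ab: "0 \<le> a" "0 \<le> b" "a + b = 1"
    have "?r (a *\<^sub>R s + b *\<^sub>R t) = a *\<^sub>R ?r s + b *\<^sub>R ?r t"
      using ab(3) by (simp add: scaleR_add_right scaleR_add_left algebra_simps flip: scaleR_add_left)
    then show "a *\<^sub>R s + b *\<^sub>R t \<in> ?I"
      using convexD[OF convex_ball[of q e] _ _ ab, of "?r s" "?r t"] st by simp
  qed
  have "\<psi> ?r' $ i = \<psi> r $ i" if i: "i = 1 \<or> i = 2" for i :: 3
  proof -
    have d: "((\<lambda>t. \<psi> (?r t) $ i) has_real_derivative 0) (at t within ?I)" if t: "t \<in> ?I" for t
    proof (rule has_field_derivative_at_within)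
      let ?D = "Df \<psi> (?r t)"
      have tV: "?r t \<in> V" using t B by auto
      have \<psi>d: "\<psi> differentiable (at (?r t))" by (rule real_analytic_on_imp_differentiable[OF \<psi> tV])
      have "form_dx (\<psi> (?r t)) (?D (axis 3 1)) = 0" "form_contact (\<psi> (?r t)) (?D (axis 3 1)) = 0"
        using c tV unfolding contact_transf_def by (simp_all add: form_dx_def[of "?r t"] form_contact_def[of "?r t"])
      note k = form_kernel[OF this]
      have "(\<psi> has_derivative ?D) (at (?r t))" using \<psi>d frechet_derivative_works by blast
      moreover have "(?r has_derivative (\<lambda>t. t *\<^sub>R axis 3 1)) (at t)" by (auto intro!: derivative_eq_intros)
      ultimately have "((\<lambda>t. \<psi> (?r t)) has_derivative (\<lambda>t. ?D (t *\<^sub>R axis 3 1))) (at t)"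
        using diff_chain_at[of ?r _ t \<psi>] by (simp add: o_def)
      then have "((\<lambda>t. \<psi> (?r t)) has_vector_derivative ?D (axis 3 1)) (at t)"
        by (simp add: has_vector_derivative_def linear_scale[OF linear_frechet_derivative[OF \<psi>d]])
      from vec_nth_has_vector_derivative[OF this, of i] k i
      show "((\<lambda>t. \<psi> (?r t) $ i) has_real_derivative 0) (at t)" by auto
    qed
    from has_field_derivative_zero_constant[OF cI d]
    obtain k where k: "\<forall>t\<in>?I. \<psi> (?r t) $ i = k" by blast
    have "0 \<in> ?I" "q $ 3 - r $ 3 \<in> ?I" using r r'B r' by simp_all
    with k have "\<psi> (?r 0) $ i = \<psi> (?r (q $ 3 - r $ 3)) $ i" by metis
    then show ?thesis by (simp add: r')
  qed
  then show "plane_proj (\<psi> ?r') = plane_proj (\<psi> r)" by (simp add: plane_proj_def)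
qed

lemma real_analytic_at_slice:
  fixes g :: "jet \<Rightarrow> 'c::euclidean_space" and z :: "real^2"
  assumes "real_analytic_at g (vector [z $ 1, z $ 2, p])"
  shows "real_analytic_at (\<lambda>z :: real^2. g (vector [z $ 1, z $ 2, p])) z"
proof (rule real_analytic_at_compose_coords[where J = "{axis 1 1, axis 2 1}"
      and \<sigma> = "\<lambda>b. if b = axis 1 1 then axis 1 1 else axis 2 1"])
  show "inj_on (\<lambda>b :: jet. if b = axis 1 1 then axis 1 1 else axis 2 1 :: real^2) {axis 1 1, axis 2 1}"
    by (auto simp: inj_on_def axis_eq_axis)
  fix x :: "real^2" and b :: jet
  show "(vector [x $ 1, x $ 2, p] - vector [z $ 1, z $ 2, p]) \<bullet> b = 0" if b: "b \<in> Basis - {axis 1 1, axis 2 1}"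
  proof -
    obtain i :: 3 where "b = axis i 1" using b by (auto simp: Basis_vec_def)
    then have "b = axis 3 1" using b exhaust_3[of i] by auto
    then show ?thesis by (simp add: inner_axis)
  qed
qed (use assms in \<open>auto simp: inner_axis axis_eq_axis Basis_vec_def\<close>)

text \<open>The plane map is \<open>\<psi>\<close> on the slice \<open>p = q $ 3\<close>, and its
  inverse is \<open>G\<close> on the slice through the image point. That they do not depend on the
  slice requires connected fibres, which balls provide.\<close>

lemma contact_transf_local_prolongation:
  assumes \<psi>: "analytic_diffeo \<psi> V Vb" and c: "contact_transf \<psi> V u w" and q: "q \<in> V"
  obtains V' where "open V'" "V' \<subseteq> V" "q \<in> V'" "open (\<psi> ` V')" "analytic_diffeo \<psi> V' (\<psi> ` V')"
    "is_area_preserving_prolongation \<psi> V'"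
proof -
  obtain G where G: "analytic_diffeo G Vb V" and inv: "\<And>x. x \<in> V \<Longrightarrow> G (\<psi> x) = x" "\<And>y. y \<in> Vb \<Longrightarrow> \<psi> (G y) = y"
    and DG: "\<And>y v. y \<in> Vb \<Longrightarrow> Df \<psi> (G y) (Df G y v) = v"
    using analytic_diffeo_inverse[OF \<psi>] by blast
  have V: "open V" "open Vb" "real_analytic_on \<psi> V" "\<psi> ` V = Vb" and GV: "real_analytic_on G Vb" "G ` Vb = V"
    using \<psi> G by (auto simp: analytic_diffeo_def)
  have cG: "contact_transf G Vb (\<lambda>y. 1 / u (G y)) (\<lambda>y. - w (G y))"
    by (rule contact_transf_inverse[OF c _ inv(2) DG]) (use GV in auto)
  have cont: "continuous_on V \<psi>" "continuous_on Vb G"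
    using real_analytic_on_imp_differentiable[OF V(3)] real_analytic_on_imp_differentiable[OF GV(1)]
    by (auto intro!: continuous_at_imp_continuous_on differentiable_imp_continuous_within)
  define qb where "qb = \<psi> q"
  have qb: "qb \<in> Vb" using V(4) q by (auto simp: qb_def)
  obtain e where e: "e > 0" "ball q e \<subseteq> V" using V(1) q open_contains_ball by blast
  obtain eb where eb: "eb > 0" "ball qb eb \<subseteq> Vb" using V(2) qb open_contains_ball by blast
  \<comment> \<open>Source in a ball around \<open>q\<close>, image in a ball around
    \<open>qb\<close>: constancy along fibres is then available for \<open>\<psi>\<close> and for
    \<open>G\<close>, although \<open>V'\<close> need not be a ball.\<close>
  define V' where "V' = ball q e \<inter> (V \<inter> \<psi> -` ball qb eb)"
  have "open (V \<inter> \<psi> -` ball qb eb)" by (rule continuous_open_preimage[OF cont(1) V(1) open_ball])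
  then have V': "open V'" unfolding V'_def by (rule open_Int[OF open_ball])
  have im: "\<psi> ` V' = ball qb eb \<inter> (Vb \<inter> G -` ball q e)"
  proof (intro subset_antisym subsetI)
    fix y assume "y \<in> \<psi> ` V'"
    then obtain x where x: "x \<in> V'" "y = \<psi> x" by blast
    then have "x \<in> V" "x \<in> ball q e" "\<psi> x \<in> ball qb eb" by (simp_all only: V'_def Int_iff vimage_eq)
    then show "y \<in> ball qb eb \<inter> (Vb \<inter> G -` ball q e)" using inv(1)[of x] V(4) x by blast
  next
    fix y assume y: "y \<in> ball qb eb \<inter> (Vb \<inter> G -` ball q e)"
    then have "G y \<in> V'" using inv(2)[of y] GV(2) by (auto simp: V'_def simp del: mem_ball)
    then show "y \<in> \<psi> ` V'" using inv(2)[of y] y by force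
  qed
  have "open (Vb \<inter> G -` ball q e)" by (rule continuous_open_preimage[OF cont(2) V(2) open_ball])
  then have oim: "open (\<psi> ` V')" unfolding im by (rule open_Int[OF open_ball])
  have V'V: "V' \<subseteq> V" and qV': "q \<in> V'" using e eb q by (auto simp: V'_def qb_def)
  have imV: "\<psi> ` V' \<subseteq> Vb" using V'V V(4) by blast
  have diffeo: "analytic_diffeo \<psi> V' (\<psi> ` V')"
    unfolding analytic_diffeo_def
  proof (intro conjI exI[of _ G])
    show "G ` \<psi> ` V' = V'" using inv(1) V'V by (force simp: image_iff)
    show "\<forall>x\<in>V'. G (\<psi> x) = x" "\<forall>y\<in>\<psi> ` V'. \<psi> (G y) = y" using inv V'V imV by auto
  qed (use V' oim real_analytic_on_subset[OF V(3) V'V] real_analytic_on_subset[OF GV(1) imV] in auto)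
  define \<Phi> :: "real^2 \<Rightarrow> real^2" where "\<Phi> z = plane_proj (\<psi> (vector [z $ 1, z $ 2, q $ 3]))" for z
  define \<Xi> :: "real^2 \<Rightarrow> real^2" where "\<Xi> z = plane_proj (G (vector [z $ 1, z $ 2, qb $ 3]))" for z
  define W where "W = plane_proj ` V'"
  have surj: "surj plane_proj"
  proof (rule surjI)
    show "plane_proj (vector [z $ 1, z $ 2, 0]) = z" for z by (simp add: vec_eq_iff forall_2)
  qed
  have op: "open (plane_proj ` S)" if "open S" for S
    by (rule open_surjective_linear_image[OF that linear_plane_proj surj])
  note fib = plane_proj_constant_on_fibres[OF c V(3) e(2)]
  note fibG = plane_proj_constant_on_fibres[OF cG GV(1) eb(2)]
  have \<Phi>: "\<Phi> (plane_proj r) = plane_proj (\<psi> r)" if "r \<in> V'" for r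
    using fib(2)[of r] that by (simp add: \<Phi>_def V'_def)
  have \<Xi>: "\<Xi> (plane_proj y) = plane_proj (G y)" if "y \<in> \<psi> ` V'" for y
    using fibG(2)[of y] that by (simp add: \<Xi>_def im)
  have \<Phi>W: "\<Phi> ` W = plane_proj ` \<psi> ` V'" using \<Phi> by (auto simp: W_def image_iff)
  have \<Xi>\<Phi>: "\<Xi> (\<Phi> z) = z" if "z \<in> W" for z
  proof -
    obtain r where r: "r \<in> V'" "z = plane_proj r" using \<open>z \<in> W\<close> by (auto simp: W_def)
    then have "\<Xi> (\<Phi> z) = plane_proj (G (\<psi> r))" using \<Phi>[of r] \<Xi>[of "\<psi> r"] by auto
    then show ?thesis using r inv(1) V'V by auto
  qed
  have an\<Phi>: "real_analytic_on \<Phi> W"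
    unfolding real_analytic_on_def
  proof
    fix z assume "z \<in> W"
    then obtain r where r: "r \<in> V'" "z = plane_proj r" by (auto simp: W_def)
    have "vector [z $ 1, z $ 2, q $ 3] \<in> V" using fib(1)[of r] r e(2) by (auto simp: V'_def)
    then have "real_analytic_at (\<lambda>z. \<psi> (vector [z $ 1, z $ 2, q $ 3])) z"
      using V(3) by (intro real_analytic_at_slice) (auto simp: real_analytic_on_def)
    then show "real_analytic_at \<Phi> z" unfolding \<Phi>_def[abs_def]
      by (rule real_analytic_at_linear[OF linear_plane_proj])
  qed
  have an\<Xi>: "real_analytic_on \<Xi> (\<Phi> ` W)"
    unfolding real_analytic_on_def
  proof
    fix z assume "z \<in> \<Phi> ` W"
    then obtain y where y: "y \<in> \<psi> ` V'" "z = plane_proj y" unfolding \<Phi>W by blast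
    have "vector [z $ 1, z $ 2, qb $ 3] \<in> Vb" using fibG(1)[of y] y eb(2) by (auto simp: im)
    then have "real_analytic_at (\<lambda>z. G (vector [z $ 1, z $ 2, qb $ 3])) z"
      using GV(1) by (intro real_analytic_at_slice) (auto simp: real_analytic_on_def)
    then show "real_analytic_at \<Xi> z" unfolding \<Xi>_def[abs_def]
      by (rule real_analytic_at_linear[OF linear_plane_proj])
  qed
  have "analytic_diffeo \<Phi> W (\<Phi> ` W)"
    unfolding analytic_diffeo_def
  proof (intro conjI exI[of _ \<Xi>])
    show "open W" unfolding W_def by (rule op[OF V'])
    show "open (\<Phi> ` W)" unfolding \<Phi>W by (rule op[OF oim])
    show "\<Xi> ` \<Phi> ` W = W" using \<Xi>\<Phi> by (force simp: image_iff)
    show "\<forall>x\<in>W. \<Xi> (\<Phi> x) = x" using \<Xi>\<Phi> by blast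
    show "\<forall>y\<in>\<Phi> ` W. \<Phi> (\<Xi> y) = y" using \<Xi>\<Phi> by auto
  qed (use an\<Phi> an\<Xi> in auto)
  moreover have "plane_jacobian \<Phi> (plane_proj r) = 1 \<and> prolong_denom \<Phi> r \<noteq> 0 \<and> \<psi> r = prolong1 \<Phi> r" if r: "r \<in> V'" for r
  proof -
    let ?z = "plane_proj r"
    define X1 where "X1 = partial 1 (\<lambda>z. \<Phi> z $ 1) ?z"
    define X2 where "X2 = partial 2 (\<lambda>z. \<Phi> z $ 1) ?z"
    define Y1 where "Y1 = partial 1 (\<lambda>z. \<Phi> z $ 2) ?z"
    define Y2 where "Y2 = partial 2 (\<lambda>z. \<Phi> z $ 2) ?z"
    have rV: "r \<in> V" using r V'V by blast
    have "real_analytic_at \<Phi> ?z" using an\<Phi> r by (auto simp: real_analytic_on_def W_def)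
    then have \<Phi>d: "(\<lambda>z. \<Phi> z $ i) differentiable (at ?z)" for i
      by (intro real_analytic_at_differentiable real_analytic_at_vec_nth)
    have \<psi>d: "\<psi> differentiable (at r)" by (rule real_analytic_on_imp_differentiable[OF V(3) rV])
    have D: "Df \<psi> r v $ 1 = X1 * v $ 1 + X2 * v $ 2"
      "Df \<psi> r v $ 2 = Y1 * v $ 1 + Y2 * v $ 2" for v
      unfolding frechet_derivative_vec_nth[OF \<psi>d, symmetric] X1_def X2_def Y1_def Y2_def
      by (rule frechet_derivative_via_plane[OF V' r _ \<Phi>d]; simp add: \<Phi>)+
    have u: "u r \<noteq> 0" and cd: "\<And>v. form_dx (\<psi> r) (Df \<psi> r v) = u r * form_dx r v - w r * form_contact r v"
      and cc: "\<And>v. form_contact (\<psi> r) (Df \<psi> r v) = form_contact r v / u r"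
      using c rV unfolding contact_transf_def by blast+
    note cd' = cd[unfolded form_dx_def form_contact_def D]
    note cc' = cc[unfolded form_dx_def form_contact_def D]
    \<comment> \<open>On \<open>(1, p, 0)\<close> the form \<open>dx\<close> is 1 and the contact
      form is 0, which yields \<open>u\<close> and the new third coordinate. On
      \<open>axis 2 1\<close> the contact form is 1, and multiplication by \<open>u\<close> turns
      this relation into the Jacobian identity.\<close>
    have u_eq: "X1 + r $ 3 * X2 = u r" using cd'[of "vector [1, r $ 3, 0]"] by (simp add: mult.commute)
    have "Y1 + Y2 * r $ 3 - \<psi> r $ 3 * (X1 + X2 * r $ 3) = 0" using cc'[of "vector [1, r $ 3, 0]"] by simp
    then have p: "\<psi> r $ 3 * u r = Y1 + r $ 3 * Y2" by (simp add: u_eq[symmetric] algebra_simps)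
    have "Y2 - \<psi> r $ 3 * X2 = 1 / u r" using cc'[of "axis 2 1"] by simp
    then have "u r * Y2 - (\<psi> r $ 3 * u r) * X2 = 1" using u by (simp add: field_simps)
    then have J: "X1 * Y2 - X2 * Y1 = 1" unfolding p by (simp add: u_eq[symmetric] algebra_simps)
    have den: "prolong_denom \<Phi> r = u r" using u_eq by (simp add: prolong_denom_def Let_def X1_def X2_def)
    have p3: "\<psi> r $ 3 = (Y1 + r $ 3 * Y2) / u r" using p u by (simp add: field_simps)
    have "\<psi> r = prolong1 \<Phi> r"
      unfolding prolong1_def Let_def den Y1_def[symmetric] Y2_def[symmetric] p3[symmetric] \<Phi>[OF r]
      by (simp add: vec_eq_iff forall_3)
    moreover have "plane_jacobian \<Phi> ?z = 1"
      using J by (simp add: plane_jacobian_def Let_def X1_def X2_def Y1_def Y2_def)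
    ultimately show ?thesis using den u by simp
  qed
  ultimately have "is_area_preserving_prolongation \<psi> V'"
    unfolding is_area_preserving_prolongation_def
    by (intro exI[of _ W] exI[of _ \<Phi>]) (auto simp: W_def)
  then show thesis using that V' V'V qV' oim diffeo by blast
qed

text \<open>\<open>u\<close> and \<open>w\<close> are the fibre coordinates of \<open>F\<close> on
  the identity section. The vertical part of the derivative of \<open>F\<close> enters only through
  a Maurer-Cartan term, which has zeros at (2,1), (3,1), (3,2), so these entries can be compared
  without knowing it.\<close>

lemma bundle_map_imp_contact_transf:
  assumes bm: "bundle_map V Vb \<psi> F"
    and pb: "\<And>b v. b \<in> H_bundle V \<Longrightarrow> pullback F (lift (normal_form fb)) b v = lift (normal_form f) b v"
  obtains u w where "contact_transf \<psi> V u w"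
    "\<And>q. q \<in> V \<Longrightarrow> Df \<psi> q (total_field f q) = u q *\<^sub>R total_field fb (\<psi> q)"
proof -
  have \<psi>: "analytic_diffeo \<psi> V Vb" and F: "analytic_diffeo F (H_bundle V) (H_bundle Vb)"
    and cov: "\<And>b. b \<in> H_bundle V \<Longrightarrow> fst (F b) = \<psi> (fst b)"
    using bm by (auto simp: bundle_map_def)
  have V: "open V" "real_analytic_on \<psi> V" and Fa: "real_analytic_on F (H_bundle V)" "F ` H_bundle V = H_bundle Vb"
    using \<psi> F by (auto simp: analytic_diffeo_def)
  define u where "u q = fst (snd (F (q, 1, 0)))" for q
  define w where "w q = snd (snd (F (q, 1, 0)))" for q
  let ?D = "\<lambda>q. Df \<psi> q"
  have main: "u q \<noteq> 0 \<and> form_dx (\<psi> q) (?D q v) / u q + w q * form_contact (\<psi> q) (?D q v) = form_dx q v \<and>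
      u q * form_contact (\<psi> q) (?D q v) = form_contact q v \<and>
      (u q)\<^sup>2 * form_Pi fb (mu_of fb) (\<psi> q) (?D q v) = form_Pi f (mu_of f) q v" if q: "q \<in> V" for q v
  proof -
    have b: "(q, 1, 0) \<in> H_bundle V" using q by (simp add: mem_H_bundle)
    have Fq: "F (q, 1, 0) = (\<psi> q, u q, w q)" using cov[OF b] by (simp add: u_def w_def prod_eq_iff)
    have "F (q, 1, 0) \<in> H_bundle Vb" using Fa(2) b by blast
    then have u: "u q \<noteq> 0" by (simp add: Fq mem_H_bundle)
    let ?DF = "Df F (q, 1, 0) (v, 0, 0)"
    have 1: "fst ?DF = ?D q v"
      using fst_frechet_derivative_covering[of V "(q, 1, 0)" F \<psi> "(v, 0, 0)", OF V(1) b _ _ cov]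
        real_analytic_on_imp_differentiable[OF Fa(1) b] real_analytic_on_imp_differentiable[OF V(2) q] by simp
    have "lift (normal_form fb) (\<psi> q, u q, w q) ?DF = normal_form f q v"
      using pb[OF b, of "(v, 0, 0)"] fun_cong[OF fun_cong[OF pullback_id_section_lift[of "normal_form f"], of q], of v]
      by (simp add: pullback_def[of F] Fq pullback_id_section)
    then obtain a b where "Hmat (1 / u q, - w q) ** normal_form fb (\<psi> q) (?D q v) ** Hmat (u q, w q) + Hlie a b = normal_form f q v"
      unfolding lift_explicit[OF u] 1 by blast
    then have e: "(Hmat (1 / u q, - w q) ** normal_form fb (\<psi> q) (?D q v) ** Hmat (u q, w q) + Hlie a b) $ i $ j
        = normal_form f q v $ i $ j" for i j by simp
    show ?thesis
      using e[of 2 1] e[of 3 1] e[of 3 2] u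
      by (simp add: conj_Hmat_entries[OF u normal_form_entries(1)] normal_form_entries)
  qed
  have "contact_transf \<psi> V u w"
    unfolding contact_transf_def
  proof (intro ballI conjI allI)
    fix q v assume q: "q \<in> V"
    have u: "u q \<noteq> 0" using main[OF q] by blast
    then show "u q \<noteq> 0" .
    show k: "form_contact (\<psi> q) (?D q v) = form_contact q v / u q"
      using main[OF q, of v] u by (simp add: field_simps)
    have "form_dx (\<psi> q) (?D q v) / u q + w q * (form_contact q v / u q) = form_dx q v" using main[OF q, of v] k by simp
    then show "form_dx (\<psi> q) (?D q v) = u q * form_dx q v - w q * form_contact q v"
      using u by (simp add: field_simps)
  qed
  moreover have "?D q (total_field f q) = u q *\<^sub>R total_field fb (\<psi> q)" if q: "q \<in> V" for q
  proof -
    \<comment> \<open>The total field is the vector on which \<open>dx\<close> is 1 and the contact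
      form and \<Pi> are 0; the scaling of \<open>dx\<close> determines the factor.\<close>
    have "form_dx q (total_field f q) = 1" "form_contact q (total_field f q) = 0" "form_Pi f (mu_of f) q (total_field f q) = 0"
      by (simp_all add: form_dx_def form_contact_def form_Pi_def)
    with main[OF q, of "total_field f q"] have "form_dx (\<psi> q) (?D q (total_field f q)) = u q"
      "form_contact (\<psi> q) (?D q (total_field f q)) = 0" "form_Pi fb (mu_of fb) (\<psi> q) (?D q (total_field f q)) = 0"
      by (auto simp: field_simps)
    then show ?thesis by (simp add: vec_eq_iff forall_3 form_dx_def form_contact_def form_Pi_def mult.commute)
  qed
  ultimately show thesis using that by blast
qed

section \<open>Equivalence of equations and of their connections\<close>

lemma H_bundle_mono: "V \<subseteq> U \<Longrightarrow> b \<in> H_bundle V \<Longrightarrow> b \<in> H_bundle U"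
  by (auto simp: mem_H_bundle)

lemma equivalent_imp_bundle_map:
  assumes U: "open U" "real_analytic_on f U" and Ub: "open Ub" "real_analytic_on fb Ub"
    and pde: "\<forall>q\<in>Ub. d_y fb q + (2/9) * (d_p fb q)\<^sup>2 - (1/3) * total_D fb (d_p fb) q = 0"
    and eq: "area_preserving_equivalent f U fb Ub q qb"
  shows "\<exists>V Vb \<psi> F. open V \<and> V \<subseteq> U \<and> q \<in> V \<and> open Vb \<and> Vb \<subseteq> Ub \<and> qb \<in> Vb \<and>
    bundle_map V Vb \<psi> F \<and> \<psi> q = qb \<and>
    (\<forall>b\<in>H_bundle V. \<forall>v. pullback F (lift (normal_form fb)) b v = lift (normal_form f) b v)"
proof -
  obtain V Vb \<psi> where V: "open V" "V \<subseteq> U" "q \<in> V" "open Vb" "Vb \<subseteq> Ub" "qb \<in> Vb"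
    and \<psi>: "analytic_diffeo \<psi> V Vb" "\<psi> q = qb" and ap: "is_area_preserving_prolongation \<psi> V"
    and ms: "maps_solutions f V fb Vb \<psi>"
    using eq unfolding area_preserving_equivalent_def by blast
  have an: "real_analytic_on \<psi> V" and im: "\<psi> ` V \<subseteq> Ub" using \<psi>(1) V(5) by (auto simp: analytic_diffeo_def)
  have fV: "real_analytic_on f V" by (rule real_analytic_on_subset[OF U(2) V(2)])
  obtain u w where c: "contact_transf \<psi> V u w"
    and e3: "\<And>q. q \<in> V \<Longrightarrow> Df \<psi> q (axis 3 1) $ 3 = 1 / (u q)\<^sup>2"
    using prolongation_imp_contact_transf[OF V(1) an ap] by blast
  have tf: "\<exists>k. Df \<psi> q (total_field f q) = k *\<^sub>R total_field fb (\<psi> q)" if "q \<in> V" for q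
    using maps_solutions_imp_total_field[OF V(1) fV real_analytic_on_imp_differentiable[OF an] ms that] by blast
  have "pullback (bundle_lift \<psi> u w) (lift (normal_form fb)) b v = lift (normal_form f) b v" if b: "b \<in> H_bundle V" for b v
    unfolding pullback_bundle_lift[OF c V(1) an b]
    by (intro lift_cong[OF b] gauge_normal_form[OF c V(1) an Ub(1) im Ub(2) fV pde tf e3])
      (use b in \<open>auto simp: mem_H_bundle\<close>)
  with V \<psi> bundle_map_bundle_lift[OF \<psi>(1) c] show ?thesis by blast
qed

lemma bundle_map_imp_equivalent:
  assumes V: "V \<subseteq> U" "q \<in> V" "Vb \<subseteq> Ub" and bm: "bundle_map V Vb \<psi> F" and q: "\<psi> q = qb"
    and pb: "\<And>b v. b \<in> H_bundle V \<Longrightarrow> pullback F (lift (normal_form fb)) b v = lift (normal_form f) b v"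
  shows "area_preserving_equivalent f U fb Ub q qb"
proof -
  have \<psi>: "analytic_diffeo \<psi> V Vb" using bm by (simp add: bundle_map_def)
  then have an: "real_analytic_on \<psi> V" and im: "\<psi> ` V = Vb" by (auto simp: analytic_diffeo_def)
  obtain u w where c: "contact_transf \<psi> V u w"
    and tf: "\<And>q. q \<in> V \<Longrightarrow> Df \<psi> q (total_field f q) = u q *\<^sub>R total_field fb (\<psi> q)"
    using bundle_map_imp_contact_transf[OF bm pb] by blast
  \<comment> \<open>The covered map is shown to be a prolongation only near \<open>q\<close>;
    equivalence is local, so \<open>V\<close> may be shrunk.\<close>
  obtain V' where V': "open V'" "V' \<subseteq> V" "q \<in> V'" "open (\<psi> ` V')" "analytic_diffeo \<psi> V' (\<psi> ` V')"
    "is_area_preserving_prolongation \<psi> V'"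
    using contact_transf_local_prolongation[OF \<psi> c V(2)] by blast
  have "maps_solutions f V' fb (\<psi> ` V') \<psi>"
    by (rule total_field_imp_maps_solutions[where u = u])
      (use V'(2) c tf real_analytic_on_imp_differentiable[OF an] in \<open>auto simp: contact_transf_def\<close>)
  then show ?thesis
    unfolding area_preserving_equivalent_def
    using V' V im q by (intro exI[of _ V'] exI[of _ "\<psi> ` V'"] exI[of _ \<psi>]) auto
qed

theorem theorem4p6:
  fixes U :: "jet set" and f :: "jet \<Rightarrow> real"
  assumes "open U" and "real_analytic_on f U"
    and "\<forall>q\<in>U. d_y f q + (2/9) * (d_p f q)\<^sup>2 - (1/3) * total_D f (d_p f) q = 0"
  shows
    "((\<exists>\<omega>. normal_cartan_connection f U \<omega>) \<and>
      (\<forall>\<omega> \<omega>'. normal_cartan_connection f U \<omega> \<longrightarrow> normal_cartan_connection f U \<omega>' \<longrightarrow>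
         (\<forall>b\<in>H_bundle U. \<forall>v. \<omega> b v = \<omega>' b v)))
   \<and> (\<forall>\<omega>. normal_cartan_connection f U \<omega> \<longrightarrow>
        (let \<theta>1 = entry \<omega> 3 1; \<theta>2 = entry \<omega> 3 2; \<theta>3 = entry \<omega> 2 1 in
         \<forall>b\<in>H_bundle U. \<forall>v w.
           curvature \<omega> b v w =
             vector [vector [0, 0, 0],
                     vector [0, I1 f b * wedge \<theta>3 \<theta>1 b v w,
                             - I2 f b * wedge \<theta>2 \<theta>1 b v w - I3 f b * wedge \<theta>3 \<theta>1 b v w],
                     vector [0, 0, - I1 f b * wedge \<theta>3 \<theta>1 b v w]]))
   \<and> (\<forall>Ub fb \<omega> \<omega>b.
        open Ub \<longrightarrow> real_analytic_on fb Ub \<longrightarrow>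
        (\<forall>q\<in>Ub. d_y fb q + (2/9) * (d_p fb q)\<^sup>2 - (1/3) * total_D fb (d_p fb) q = 0) \<longrightarrow>
        normal_cartan_connection f U \<omega> \<longrightarrow> normal_cartan_connection fb Ub \<omega>b \<longrightarrow>
        (\<forall>q\<in>U. \<forall>qb\<in>Ub.
           area_preserving_equivalent f U fb Ub q qb \<longleftrightarrow>
           (\<exists>V Vb \<psi> F. open V \<and> V \<subseteq> U \<and> q \<in> V \<and> open Vb \<and> Vb \<subseteq> Ub \<and> qb \<in> Vb \<and>
              bundle_map V Vb \<psi> F \<and> \<psi> q = qb \<and>
              (\<forall>b\<in>H_bundle V. \<forall>v. pullback F \<omega>b b v = \<omega> b v))))"
proof (intro conjI allI impI ballI)
  note nc = normal_cartan_connection_eq[OF assms(1,2)]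
  show "\<exists>\<omega>. normal_cartan_connection f U \<omega>"
    using normal_cartan_connection_lift[OF assms] by blast
  show "\<omega> b v = \<omega>' b v" if "normal_cartan_connection f U \<omega>" "normal_cartan_connection f U \<omega>'" "b \<in> H_bundle U"
    for \<omega> \<omega>' b v
    using nc[OF that(1,3)] nc[OF that(2,3)] by simp
  show "let \<theta>1 = entry \<omega> 3 1; \<theta>2 = entry \<omega> 3 2; \<theta>3 = entry \<omega> 2 1 in
         \<forall>b\<in>H_bundle U. \<forall>v w.
           curvature \<omega> b v w =
             vector [vector [0, 0, 0],
                     vector [0, I1 f b * wedge \<theta>3 \<theta>1 b v w,
                             - I2 f b * wedge \<theta>2 \<theta>1 b v w - I3 f b * wedge \<theta>3 \<theta>1 b v w],
                     vector [0, 0, - I1 f b * wedge \<theta>3 \<theta>1 b v w]]"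
    if \<omega>: "normal_cartan_connection f U \<omega>" for \<omega>
    unfolding Let_def
  proof (intro ballI allI)
    fix b v w assume b: "b \<in> H_bundle U"
    have wedge: "wedge (entry \<omega> i j) (entry \<omega> k l) b v w =
        wedge (entry (lift (normal_form f)) i j) (entry (lift (normal_form f)) k l) b v w" for i j k l
      by (simp add: wedge_def entry_def nc[OF \<omega> b])
    show "curvature \<omega> b v w =
             vector [vector [0, 0, 0],
                     vector [0, I1 f b * wedge (entry \<omega> 2 1) (entry \<omega> 3 1) b v w,
                             - I2 f b * wedge (entry \<omega> 3 2) (entry \<omega> 3 1) b v w
                             - I3 f b * wedge (entry \<omega> 2 1) (entry \<omega> 3 1) b v w],
                     vector [0, 0, - I1 f b * wedge (entry \<omega> 2 1) (entry \<omega> 3 1) b v w]]"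
      \<comment> \<open>Curvature involves derivatives, so agreement of \<open>\<omega>\<close> with
        the lifted normal form is used on the whole open set \<open>H_bundle U\<close>.\<close>
      unfolding wedge
      by (subst curvature_cong_open[OF open_H_bundle[OF assms(1)] b nc[OF \<omega>]])
        (simp_all add: curvature_lift_normal_form[OF assms(1,2) b assms(3)] Hlie_def)
  qed
next
  fix Ub fb \<omega> \<omega>b q qb
  assume Ub: "open Ub" "real_analytic_on fb Ub"
    and pde: "\<forall>q\<in>Ub. d_y fb q + (2/9) * (d_p fb q)\<^sup>2 - (1/3) * total_D fb (d_p fb) q = 0"
    and \<omega>: "normal_cartan_connection f U \<omega>" and \<omega>b: "normal_cartan_connection fb Ub \<omega>b"
  \<comment> \<open>The connections are determined only over \<open>U\<close> and \<open>Ub\<close>,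
    so \<open>F b\<close> has to be placed in \<open>H_bundle Ub\<close> before the lifted normal
    form can replace \<open>\<omega>b\<close>.\<close>
  have pullback: "(pullback F \<omega>b b v = \<omega> b v) = (pullback F (lift (normal_form fb)) b v = lift (normal_form f) b v)"
    if "V \<subseteq> U" "Vb \<subseteq> Ub" "bundle_map V Vb \<psi> F" "b \<in> H_bundle V" for V Vb \<psi> F b v
  proof -
    have "F b \<in> H_bundle Vb" using that(3,4) by (auto simp: bundle_map_def analytic_diffeo_def)
    then have "F b \<in> H_bundle Ub" by (rule H_bundle_mono[OF that(2)])
    then show ?thesis
      by (simp add: pullback_def normal_cartan_connection_eq[OF Ub \<omega>b]
          normal_cartan_connection_eq[OF assms(1,2) \<omega> H_bundle_mono[OF that(1,4)]])
  qed
  show "area_preserving_equivalent f U fb Ub q qb \<longleftrightarrow>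
           (\<exists>V Vb \<psi> F. open V \<and> V \<subseteq> U \<and> q \<in> V \<and> open Vb \<and> Vb \<subseteq> Ub \<and> qb \<in> Vb \<and>
              bundle_map V Vb \<psi> F \<and> \<psi> q = qb \<and>
              (\<forall>b\<in>H_bundle V. \<forall>v. pullback F \<omega>b b v = \<omega> b v))"
  proof
    assume "area_preserving_equivalent f U fb Ub q qb"
    from equivalent_imp_bundle_map[OF assms(1,2) Ub pde this]
    obtain V Vb \<psi> F where *: "open V" "V \<subseteq> U" "q \<in> V" "open Vb" "Vb \<subseteq> Ub" "qb \<in> Vb" "bundle_map V Vb \<psi> F" "\<psi> q = qb"
      "\<forall>b\<in>H_bundle V. \<forall>v. pullback F (lift (normal_form fb)) b v = lift (normal_form f) b v" by blast
    then have "\<forall>b\<in>H_bundle V. \<forall>v. pullback F \<omega>b b v = \<omega> b v" using pullback[OF *(2,5,7)] by blast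
    with * show "\<exists>V Vb \<psi> F. open V \<and> V \<subseteq> U \<and> q \<in> V \<and> open Vb \<and> Vb \<subseteq> Ub \<and> qb \<in> Vb \<and>
              bundle_map V Vb \<psi> F \<and> \<psi> q = qb \<and> (\<forall>b\<in>H_bundle V. \<forall>v. pullback F \<omega>b b v = \<omega> b v)" by blast
  next
    assume "\<exists>V Vb \<psi> F. open V \<and> V \<subseteq> U \<and> q \<in> V \<and> open Vb \<and> Vb \<subseteq> Ub \<and> qb \<in> Vb \<and>
              bundle_map V Vb \<psi> F \<and> \<psi> q = qb \<and> (\<forall>b\<in>H_bundle V. \<forall>v. pullback F \<omega>b b v = \<omega> b v)"
    then obtain V Vb \<psi> F where *: "V \<subseteq> U" "q \<in> V" "Vb \<subseteq> Ub" "bundle_map V Vb \<psi> F" "\<psi> q = qb"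
      and "\<forall>b\<in>H_bundle V. \<forall>v. pullback F \<omega>b b v = \<omega> b v" by blast
    then have "pullback F (lift (normal_form fb)) b v = lift (normal_form f) b v" if "b \<in> H_bundle V" for b v
      using pullback[OF *(1,3,4) that] that by blast
    then show "area_preserving_equivalent f U fb Ub q qb" by (rule bundle_map_imp_equivalent[OF *])
  qed
qed

end
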